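(* Let $\Omega\subset\mathbb{R}^3$ be a periodicity box and $\nu>0$. There exists a positive constant $c_{11}$, depending only on $\Omega$ and $\nu$ (and not on $u_0$ or on time), such that the following holds. Let $u_0\in V_1$ and let $u$ be the strong solution of the 3D Navier--Stokes equations with zero force $f=0$ and initial datum $u(0)=u_0$. If $$c_{11}\,\|u(0)\|^{2}+\arctan\left(\|u(0)\|_{1}^{2}\right)<\frac{\pi}{2},$$ then $u$ exists globally and remains regular, i.e. it is a strong solution on $[0,T]$ for all $T>0$.
   Context: $\Omega$ is a periodicity box in $\mathbb{R}^3$ and $\nu>0$ is the viscosity. $H^m_{per}(\Omega)$ is the Sobolev space of periodic functions with inner product $(u,v)=\sum_{|\beta|\le m}(D^\beta u,D^\beta v)_{L^2(\Omega)}$ and associated norm $\|u\|_m=\left(\sum_{|\beta|\le m}\|D^\beta u\|_{L^2(\Omega)}^2\right)^{1/2}$. $\|\cdot\|$ denotes the $L^2(\Omega)$ norm. $V_m$ is the completion, in the $H^m_{per}$ norm, of the smooth, divergence-free, periodic, zero-average vector fields on $\Omega$. $P$ is the $L^2$-orthogonal projection onto $V_0$, and $A=-P\Delta$ is the Stokes operator. The Navier--Stokes equations with zero force are $$\partial_t u-\nu\Delta u+u\cdot\nabla u=0,\qquad \operatorname{div}u=0,\qquad u(x,0)=u_0(x),$$ with periodic boundary conditions, the equation being understood after projection by $P$, that is, $\partial_t u+\nu Au+P(u\cdot\nabla u)=0$ (equivalently, modulo a pressure gradient). For finite $T>0$, a strong solution on $[0,T]$ is a solution $u\in L^\infty(0,T;V_1)\cap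 L^2(0,T;V_2)$. For $u_0\in V_1$ a unique strong solution exists at least on some short time interval. "The strong solution $u$" means this solution, continued as long as it remains a strong solution. *)

theory Defs
  imports "HOL-Analysis.Analysis"
begin

text \<open>
  The box is \<open>(0,L\<^sub>1) \<times> (0,L\<^sub>2) \<times> (0,L\<^sub>3)\<close>. A periodic function in a Lebesgue or Sobolev class
  is represented by any function on \<open>\<real>\<^sup>3\<close>; only its values almost everywhere on the box
  matter. Periodicity of Sobolev functions is enforced by testing weak derivatives against all
  smooth periodic functions (rather than compactly supported ones). Smooth functions, in
  contrast, are honest periodic functions on the whole of \<open>\<real>\<^sup>3\<close>.
\<close>

type_synonym scalar_field = "real^3 \<Rightarrow> real"
type_synonym vector_field = "real^3 \<Rightarrow> real^3"

abbreviation box_measure :: "real^3 \<Rightarrow> (real^3) measure" where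
  "box_measure L \<equiv> lebesgue_on (box 0 L)"

definition periodic :: "real^3 \<Rightarrow> (real^3 \<Rightarrow> 'a) \<Rightarrow> bool" where
  "periodic L f \<longleftrightarrow> (\<forall>i x. f (x + axis i (L $ i)) = f x)"


subsection \<open>Smooth periodic functions\<close>

definition partial :: "3 \<Rightarrow> scalar_field \<Rightarrow> scalar_field" where
  "partial j f x = deriv (\<lambda>h. f (x + axis j h)) 0"

definition smooth :: "scalar_field \<Rightarrow> bool" where
  "smooth f \<longleftrightarrow> (\<forall>js x. foldr partial js f differentiable (at x))"

type_synonym multi_index = "3 \<Rightarrow> nat"

definition mi_order :: "multi_index \<Rightarrow> nat" where
  "mi_order \<beta> = (\<Sum>i\<in>UNIV. \<beta> i)"

definition unit_index :: "3 \<Rightarrow> multi_index" where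
  "unit_index j = (\<lambda>i. if i = j then 1 else 0)"

definition classical_D :: "multi_index \<Rightarrow> scalar_field \<Rightarrow> scalar_field" where
  "classical_D \<beta> f =
    (partial 1 ^^ \<beta> 1) ((partial 2 ^^ \<beta> 2) ((partial 3 ^^ \<beta> 3) f))"

definition div_free_test_fields :: "real^3 \<Rightarrow> vector_field set" where
  "div_free_test_fields L = {\<phi>.
     periodic L \<phi> \<and>
     (\<forall>i. smooth (\<lambda>x. \<phi> x $ i)) \<and>
     (\<forall>x. (\<Sum>i\<in>UNIV. partial i (\<lambda>y. \<phi> y $ i) x) = 0) \<and>
     (LINT x|box_measure L. \<phi> x) = 0}"


subsection \<open>The space \<open>L\<^sup>2\<close> and periodic Sobolev spaces\<close>

definition square_integrable :: "real^3 \<Rightarrow> vector_field \<Rightarrow> bool" where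
  "square_integrable L u \<longleftrightarrow>
     u \<in> borel_measurable (box_measure L) \<and>
     integrable (box_measure L) (\<lambda>x. (norm (u x))\<^sup>2)"

definition l2_inner :: "real^3 \<Rightarrow> vector_field \<Rightarrow> vector_field \<Rightarrow> real" where
  "l2_inner L u v = (LINT x|box_measure L. u x \<bullet> v x)"

definition l2_norm :: "real^3 \<Rightarrow> vector_field \<Rightarrow> real" where
  "l2_norm L u = sqrt (LINT x|box_measure L. (norm (u x))\<^sup>2)"

definition has_weak_D :: "real^3 \<Rightarrow> multi_index \<Rightarrow> vector_field \<Rightarrow> vector_field \<Rightarrow> bool" where
  "has_weak_D L \<beta> u g \<longleftrightarrow>
     square_integrable L g \<and>
     (\<forall>\<phi>. smooth \<phi> \<and> periodic L \<phi> \<longrightarrow>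
        (LINT x|box_measure L. classical_D \<beta> \<phi> x *\<^sub>R u x) =
        (-1) ^ mi_order \<beta> *\<^sub>R (LINT x|box_measure L. \<phi> x *\<^sub>R g x))"

text \<open>A representative of the weak derivative, which is unique up to null sets of the box.\<close>

definition weak_D :: "real^3 \<Rightarrow> multi_index \<Rightarrow> vector_field \<Rightarrow> vector_field" where
  "weak_D L \<beta> u = (SOME g. has_weak_D L \<beta> u g)"

definition H_per :: "real^3 \<Rightarrow> nat \<Rightarrow> vector_field set" where
  "H_per L m = {u. square_integrable L u \<and> (\<forall>\<beta>. mi_order \<beta> \<le> m \<longrightarrow> (\<exists>g. has_weak_D L \<beta> u g))}"

definition H_inner :: "real^3 \<Rightarrow> nat \<Rightarrow> vector_field \<Rightarrow> vector_field \<Rightarrow> real" where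
  "H_inner L m u v = (\<Sum>\<beta> | mi_order \<beta> \<le> m. l2_inner L (weak_D L \<beta> u) (weak_D L \<beta> v))"

definition H_norm :: "real^3 \<Rightarrow> nat \<Rightarrow> vector_field \<Rightarrow> real" where
  "H_norm L m u = sqrt (\<Sum>\<beta> | mi_order \<beta> \<le> m. (l2_norm L (weak_D L \<beta> u))\<^sup>2)"

text \<open>
  The completion of the test fields is realised as their closure in the Hilbert space
  \<open>H_per L m\<close>.
\<close>

definition V :: "real^3 \<Rightarrow> nat \<Rightarrow> vector_field set" where
  "V L m = {u \<in> H_per L m. \<exists>\<phi> :: nat \<Rightarrow> vector_field.
     (\<forall>n. \<phi> n \<in> div_free_test_fields L) \<and>
     (\<lambda>n. H_norm L m (\<lambda>x. \<phi> n x - u x)) \<longlonglongrightarrow> 0}"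


subsection \<open>The operators in the Navier--Stokes equations\<close>

text \<open>A representative of the orthogonal projection, meaningful for square integrable fields.\<close>

definition leray :: "real^3 \<Rightarrow> vector_field \<Rightarrow> vector_field" where
  "leray L f = (SOME g. g \<in> V L 0 \<and> (\<forall>v\<in>V L 0. l2_inner L (\<lambda>x. f x - g x) v = 0))"

definition laplacian :: "real^3 \<Rightarrow> vector_field \<Rightarrow> vector_field" where
  "laplacian L u x = (\<Sum>j\<in>UNIV. weak_D L (\<lambda>i. 2 * unit_index j i) u x)"

definition stokes :: "real^3 \<Rightarrow> vector_field \<Rightarrow> vector_field" where
  "stokes L u x = - leray L (laplacian L u) x"

definition advection :: "real^3 \<Rightarrow> vector_field \<Rightarrow> vector_field" where
  "advection L u x = (\<Sum>j\<in>UNIV. (u x $ j) *\<^sub>R weak_D L (unit_index j) u x)"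


subsection \<open>Strong solutions\<close>

text \<open>
  Measurability of \<open>V L m\<close>-valued functions of time is weak measurability, which by
  Pettis' theorem is the same as strong (Bochner) measurability because \<open>V L m\<close> is separable.
\<close>

definition time_measurable :: "real^3 \<Rightarrow> nat \<Rightarrow> real \<Rightarrow> (real \<Rightarrow> vector_field) \<Rightarrow> bool" where
  "time_measurable L m T u \<longleftrightarrow>
     (\<forall>v\<in>V L m. (\<lambda>t. H_inner L m (u t) v) \<in> borel_measurable (lebesgue_on {0<..<T}))"

definition Linf_V :: "real^3 \<Rightarrow> nat \<Rightarrow> real \<Rightarrow> (real \<Rightarrow> vector_field) set" where
  "Linf_V L m T = {u. (AE t in lebesgue_on {0<..<T}. u t \<in> V L m) \<and> time_measurable L m T u \<and>
     (\<exists>M. AE t in lebesgue_on {0<..<T}. H_norm L m (u t) \<le> M)}"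

definition L2_V :: "real^3 \<Rightarrow> nat \<Rightarrow> real \<Rightarrow> (real \<Rightarrow> vector_field) set" where
  "L2_V L m T = {u. (AE t in lebesgue_on {0<..<T}. u t \<in> V L m) \<and> time_measurable L m T u \<and>
     integrable (lebesgue_on {0<..<T}) (\<lambda>t. (H_norm L m (u t))\<^sup>2)}"

text \<open>
  The projected equation \<open>\<partial>\<^sub>t u + \<nu> A u + P (u \<cdot> \<nabla>u) = 0\<close> is an equation between functions of
  time with values in \<open>V L 0\<close>. It is stated in time-integrated form, tested against an
  arbitrary element of \<open>V L 0\<close>. Requiring it at every time selects the representative of \<open>u\<close>
  that is continuous in time (as an \<open>L\<^sup>2\<close>-valued function), so that the initial value is meaningful.
\<close>

definition strong_solution ::
    "real^3 \<Rightarrow> real \<Rightarrow> vector_field \<Rightarrow> (real \<Rightarrow> vector_field) \<Rightarrow> real \<Rightarrow> bool" where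
  "strong_solution L \<nu> u0 u T \<longleftrightarrow>
     u \<in> Linf_V L 1 T \<and> u \<in> L2_V L 2 T \<and>
     (\<forall>t\<in>{0..T}. u t \<in> V L 0) \<and>
     (AE x in box_measure L. u 0 x = u0 x) \<and>
     (\<forall>v\<in>V L 0.
        let F = (\<lambda>s. l2_inner L (\<lambda>x. \<nu> *\<^sub>R stokes L (u s) x + leray L (advection L (u s)) x) v)
        in integrable (lebesgue_on {0..T}) F \<and>
           (\<forall>t\<in>{0..T}. l2_inner L (u t) v - l2_inner L (u 0) v + (LINT s|lebesgue_on {0..t}. F s) = 0))"

text \<open>
  The strong solution, continued for as long as possible: \<open>u\<close> is a strong solution on some time
  interval, and it is one on every \<open>[0,T]\<close> that carries a strong solution with the same initial
  datum. Since strong solutions are unique, the latter are exactly the continuations of \<open>u\<close>.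
  Nothing is assumed about the behaviour of \<open>u\<close> at the end of its interval of existence.
\<close>

definition maximal_strong_solution ::
    "real^3 \<Rightarrow> real \<Rightarrow> vector_field \<Rightarrow> (real \<Rightarrow> vector_field) \<Rightarrow> bool" where
  "maximal_strong_solution L \<nu> u0 u \<longleftrightarrow>
     (\<exists>T>0. strong_solution L \<nu> u0 u T) \<and>
     (\<forall>T>0. (\<exists>w. strong_solution L \<nu> u0 w T) \<longrightarrow> strong_solution L \<nu> u0 u T)"

end

theory Submission
  imports Defs "HOL-Complex_Analysis.Great_Picard"
begin

text \<open>
  In Fourier coefficients the Galerkin approximations are ordinary differential equations whose
  energy \<open>E\<close> and enstrophy \<open>Z\<close> satisfy \<open>E' = -2\<nu>Z\<close> and \<open>Z' + \<nu>A \<le> C Z\<^sup>3\<close>, where \<open>A\<close> is the squared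
  norm of the Laplacian. With \<open>X = E + Z\<close> this gives \<open>(arctan X)' \<le> C Z\<close>, so that
  \<open>arctan X + C/(2\<nu>) E\<close> does not increase, and the smallness condition with \<open>c\<^sub>1\<^sub>1 = C/(2\<nu>)\<close> bounds \<open>X\<close>
  uniformly in time and in the order of the approximation. Since each coefficient is Lipschitz in
  time, a subsequence converges to a strong solution on \<open>[0,T]\<close> for arbitrary \<open>T\<close>. By maximality of
  \<open>u\<close> it suffices that some strong solution with the same initial datum exists, so uniqueness is
  never used.
\<close>

section \<open>Fourier modes on the box and their completeness\<close>

text \<open>The inverse tangent is matched to the power 3. Since
  \<open>Z\<^sup>3 \<le> Z (1 + X\<^sup>2)\<close>, dividing the growth of \<open>X\<close> by
  \<open>1 + X\<^sup>2\<close> leaves only a multiple of \<open>Z\<close>, and the energy identity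
  pays for exactly that, whatever the length of the time interval. The power 3 itself comes from
  dimension three. The lattice sum of
  \<open>1 / (|\<kappa>|\<^sup>2 (1 + s |\<kappa>|\<^sup>2))\<close> is of order
  \<open>1 / sqrt s\<close>, so the l1 norm \<open>S\<close> of the coefficients satisfies an Agmon
  inequality: \<open>S\<^sup>2\<close> is at most of the order of \<open>sqrt (Z A)\<close> after
  optimising \<open>s\<close>. The trilinear term is then of order \<open>A^(3/4) Z^(3/4)\<close>,
  and Young's inequality against \<open>\<nu> A\<close> leaves \<open>Z\<^sup>3\<close>. Two
  obstacles shape the rest. The Galerkin field is quadratic, hence not globally Lipschitz, so it is
  first composed with a retraction that the energy bound later shows to be inactive. And the limit
  is only coefficientwise: the uniform bound on \<open>X\<close> makes the tails of the convolution
  small uniformly in the order of approximation, which is all the compactness that the nonlinear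
  term requires.\<close>

definition vol :: "real^3 \<Rightarrow> real" where
  "vol L = (\<Prod>i\<in>UNIV. L $ i)"

definition wave :: "real^3 \<Rightarrow> int^3 \<Rightarrow> real^3" where
  "wave L k = (\<chi> i. 2 * pi * of_int (k $ i) / L $ i)"

text \<open>The factor \<open>1 / sqrt (vol L)\<close> makes the modes orthonormal on the box. Its
  price is that a product of two modes carries one such factor, which later becomes the coefficient
  \<open>b\<close> in front of the nonlinearity.\<close>

definition fmode :: "real^3 \<Rightarrow> int^3 \<Rightarrow> real^3 \<Rightarrow> complex" where
  "fmode L k x = cis (wave L k \<bullet> x) / of_real (sqrt (vol L))"

lemma wave_0 [simp]: "wave L 0 = 0"
  by (simp add: wave_def vec_eq_iff)

lemma wave_add: "wave L (k + l) = wave L k + wave L l"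
  by (simp add: wave_def vec_eq_iff add_divide_distrib distrib_left)

lemma wave_minus: "wave L (- k) = - wave L k"
  by (simp add: wave_def vec_eq_iff)

lemma wave_diff: "wave L (k - l) = wave L k - wave L l"
  by (simp add: wave_def vec_eq_iff diff_divide_distrib right_diff_distrib)

lemma continuous_fmode: "continuous_on S (fmode L k)"
  unfolding fmode_def divide_inverse by (intro continuous_intros)

lemma cnj_fmode: "cnj (fmode L k x) = fmode L (- k) x"
  by (simp add: fmode_def wave_minus cis_cnj)

lemma fmode_mult: "fmode L k x * fmode L l x = fmode L (k + l) x / of_real (sqrt (vol L))"
  by (simp add: fmode_def wave_add inner_add_left cis_mult)

lemma fmode_0: "fmode L 0 x = 1 / of_real (sqrt (vol L))"
  by (simp add: fmode_def)

section \<open>The periodic box: invariance of integrals under shifts, orthonormality of the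
  modes\<close>

locale periodic_box =
  fixes L :: "real^3"
  assumes side_pos: "\<And>i. L $ i > 0"
begin

abbreviation "M \<equiv> box_measure L"

lemma vol_pos: "vol L > 0"
  unfolding vol_def by (intro prod_pos) (auto simp: side_pos)

lemma mem_box0: "x \<in> box 0 L \<longleftrightarrow> (\<forall>i. 0 < x $ i \<and> x $ i < L $ i)"
  by (simp add: mem_box_cart)

lemma mem_cbox0: "x \<in> cbox 0 L \<longleftrightarrow> (\<forall>i. 0 \<le> x $ i \<and> x $ i \<le> L $ i)"
  by (simp add: mem_box_cart)

lemma finite_M: "finite_measure M"
  by (intro finite_measure_lebesgue_on) simp

lemma measure_box: "measure M (space M) = vol L"
proof -
  have "measure M (space M) = measure lebesgue (box 0 L)"
    by (simp add: measure_restrict_space)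
  also have "\<dots> = (\<Prod>b\<in>Basis. (L - 0) \<bullet> b)"
    using side_pos by (subst measure_completion)
      (auto simp: measure_lborel_box_eq Basis_vec_def inner_axis less_imp_le)
  also have "\<dots> = vol L"
    using prod.reindex[of "\<lambda>i. axis i (1::real)" "UNIV :: 3 set" "\<lambda>b. L \<bullet> b"]
    by (simp add: vol_def Basis_vec_def inner_axis inj_on_def axis_eq_axis UNION_singleton_eq_range)
  finally show ?thesis .
qed

lemma measurable_continuous:
  fixes f :: "real^3 \<Rightarrow> 'b::euclidean_space"
  assumes "continuous_on UNIV f"
  shows "f \<in> borel_measurable M"
  by (rule continuous_imp_measurable_on_sets_lebesgue)
     (auto intro: continuous_on_subset[OF assms])

lemma bounded_on_box:
  fixes f :: "real^3 \<Rightarrow> 'b::euclidean_space"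
  assumes "continuous_on UNIV f"
  obtains B where "B \<ge> 0" "\<And>x. x \<in> cbox 0 L \<Longrightarrow> norm (f x) \<le> B"
proof -
  have "bounded (f ` cbox 0 L)"
    by (intro compact_imp_bounded compact_continuous_image continuous_on_subset[OF assms]) auto
  then obtain B where "\<And>x. x \<in> cbox 0 L \<Longrightarrow> norm (f x) \<le> B"
    by (auto simp: bounded_iff)
  then show ?thesis
    by (intro that[of "max B 0"]) (auto intro: order_trans[OF _ max.cobounded1])
qed

lemma integrable_continuous:
  fixes f :: "real^3 \<Rightarrow> 'b::euclidean_space"
  assumes "continuous_on UNIV f"
  shows "integrable M f"
proof -
  obtain B where "\<And>x. x \<in> cbox 0 L \<Longrightarrow> norm (f x) \<le> B"
    using bounded_on_box[OF assms] by metis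
  then have "AE x in M. norm (f x) \<le> B"
    using box_subset_cbox by (intro AE_I2) (auto simp: subset_iff)
  then show ?thesis
    using finite_measure.integrable_const_bound[OF finite_M _ measurable_continuous[OF assms]] by blast
qed

lemma integral_M_lborel:
  fixes f :: "real^3 \<Rightarrow> 'b::euclidean_space"
  assumes "continuous_on UNIV f"
  shows "(LINT x|M. f x) = (LINT x|lborel. indicator (box 0 L) x *\<^sub>R f x)"
proof -
  have [measurable]: "f \<in> borel_measurable borel"
    using assms by (rule borel_measurable_continuous_onI)
  show ?thesis
    by (subst integral_restrict_space) (auto intro!: integral_completion)
qed

text \<open>A shift by \<open>h\<close> pushes the slab \<open>x $ j > L $ j - h\<close> out of the
  box. By periodicity the integrand on that slab may be read with the shift \<open>h - L $ j\<close>
  instead, and the two slabs then land on the two sides \<open>U\<close> and \<open>W\<close> of the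
  plane \<open>y $ j = h\<close>.\<close>

lemma integral_translate:
  fixes f :: "real^3 \<Rightarrow> 'b::euclidean_space"
  assumes f: "continuous_on UNIV f" and per: "periodic L f" and h: "0 < h" "h < L $ j"
  shows "(LINT x|M. f (x + axis j h)) = (LINT x|M. f x)"
proof -
  define a where "a = axis j h"
  \<comment> \<open>The same shift followed by one full period backwards: \<open>f\<close> cannot
    tell it from \<open>a\<close>, but it keeps the slab crossing the face inside the box.\<close>
  define a' where "a' = axis j (h - L $ j)"
  define U where "U = box 0 L \<inter> {y. y $ j > h}"
  define W where "W = box 0 L \<inter> {y. y $ j < h}"
  have meas [measurable]: "f \<in> borel_measurable borel" "U \<in> sets borel" "W \<in> sets borel"
    using f by (auto simp: U_def W_def intro!: borel_measurable_continuous_onI borel_open open_Int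
        open_halfspace_component_gt_cart open_halfspace_component_lt_cart)
  \<comment> \<open>The slabs and their images omit a separating hyperplane, so the decompositions
    below hold only almost everywhere.\<close>
  have null: "AE x in lborel. (x::real^3) $ j \<noteq> c" for c
  proof -
    have "negligible {x::real^3. x \<bullet> axis j 1 = c}"
      by (rule negligible_standard_hyperplane) (simp add: axis_in_Basis_iff)
    then have "AE x in lebesgue. (x::real^3) $ j \<noteq> c"
      by (auto simp: negligible_iff_null_sets inner_axis intro: AE_I' )
    then show ?thesis by (simp add: AE_completion_iff)
  qed
  have shift: "f (x + a') = f (x + a)" for x
  proof -
    have "f (x + a') = f (x + a' + axis j (L $ j))"
      using per by (simp add: periodic_def)
    also have "x + a' + axis j (L $ j) = x + a"
      by (simp add: a_def a'_def vec_eq_iff axis_def)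
    finally show ?thesis .
  qed
  have int: "integrable lborel (\<lambda>x. indicator A x *\<^sub>R f x)" if "A \<in> sets borel" "A \<subseteq> cbox 0 L" for A
  proof -
    have "integrable lborel (\<lambda>x. indicator A x *\<^sub>R (indicator (cbox 0 L) x *\<^sub>R f x))"
      using that f by (intro integrable_mult_indicator borel_integrable_compact)
        (auto intro: continuous_on_subset)
    moreover have "indicator A x *\<^sub>R (indicator (cbox 0 L) x *\<^sub>R f x) = indicator A x *\<^sub>R f x" for x
      using that by (auto simp: indicator_def)
    ultimately show ?thesis by (simp only:)
  qed
  have UW: "U \<subseteq> cbox 0 L" "W \<subseteq> cbox 0 L"
    using box_subset_cbox by (auto simp: U_def W_def subset_iff)
  have int_shift: "integrable lborel (\<lambda>x. indicator A (c + x) *\<^sub>R f (c + x))"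
      and val_shift: "(LINT x|lborel. indicator A (c + x) *\<^sub>R f (c + x)) = (LINT x|lborel. indicator A x *\<^sub>R f x)"
    if A: "A \<in> sets borel" "A \<subseteq> cbox 0 L" for A c
  proof -
    have [measurable]: "A \<in> sets borel" by fact
    have "integrable (distr lborel borel ((+) c)) (\<lambda>x. indicator A x *\<^sub>R f x)"
      using int[OF A] by (simp add: lborel_distr_plus)
    then show "integrable lborel (\<lambda>x. indicator A (c + x) *\<^sub>R f (c + x))"
      by (subst (asm) integrable_distr_eq) auto
    have "(LINT x|distr lborel borel ((+) c). indicator A x *\<^sub>R f x) = (LINT x|lborel. indicator A (c + x) *\<^sub>R f (c + x))"
      by (subst integral_distr) auto
    then show "(LINT x|lborel. indicator A (c + x) *\<^sub>R f (c + x)) = (LINT x|lborel. indicator A x *\<^sub>R f x)"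
      by (simp add: lborel_distr_plus)
  qed
  have memU: "a + x \<in> U \<longleftrightarrow> x \<in> box 0 L \<and> x $ j < L $ j - h" for x
  proof -
    have c: "(a + x) $ j = h + x $ j" "\<And>i. i \<noteq> j \<Longrightarrow> (a + x) $ i = x $ i"
      by (simp_all add: a_def axis_def)
    have "(\<forall>i. 0 < (a + x) $ i \<and> (a + x) $ i < L $ i) \<and> h < (a + x) $ j \<longleftrightarrow>
        (\<forall>i. 0 < x $ i \<and> x $ i < L $ i) \<and> x $ j < L $ j - h" (is "?l \<longleftrightarrow> ?r")
    proof
      assume l: ?l
      then have "0 < x $ i \<and> x $ i < L $ i" for i using c h by (cases "i = j") (smt (verit))+
      then show ?r using l c by (smt (verit))
    next
      assume r: ?r
      then have "0 < (a + x) $ i \<and> (a + x) $ i < L $ i" for i using c h by (cases "i = j") (smt (verit))+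
      then show ?l using r c by (smt (verit))
    qed
    then show ?thesis by (simp add: U_def mem_box0 del: vector_add_component)
  qed
  have memW: "a' + x \<in> W \<longleftrightarrow> x \<in> box 0 L \<and> x $ j > L $ j - h" for x
  proof -
    have c: "(a' + x) $ j = h - L $ j + x $ j" "\<And>i. i \<noteq> j \<Longrightarrow> (a' + x) $ i = x $ i"
      by (simp_all add: a'_def axis_def)
    have "(\<forall>i. 0 < (a' + x) $ i \<and> (a' + x) $ i < L $ i) \<and> (a' + x) $ j < h \<longleftrightarrow>
        (\<forall>i. 0 < x $ i \<and> x $ i < L $ i) \<and> L $ j - h < x $ j" (is "?l \<longleftrightarrow> ?r")
    proof
      assume l: ?l
      then have "0 < x $ i \<and> x $ i < L $ i" for i using c h by (cases "i = j") (smt (verit))+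
      then show ?r using l c by (smt (verit))
    next
      assume r: ?r
      then have "0 < (a' + x) $ i \<and> (a' + x) $ i < L $ i" for i using c h by (cases "i = j") (smt (verit))+
      then show ?l using r c by (smt (verit))
    qed
    then show ?thesis by (simp add: W_def mem_box0 del: vector_add_component)
  qed
  have ca: "continuous_on UNIV (\<lambda>x. f (x + a))"
    by (intro continuous_on_compose2[OF f] continuous_intros) auto
  have "(LINT x|M. f (x + a)) = (LINT x|lborel. indicator (box 0 L) x *\<^sub>R f (x + a))"
    by (rule integral_M_lborel[OF ca])
  also have "\<dots> = (LINT x|lborel. indicator U (a + x) *\<^sub>R f (a + x) + indicator W (a' + x) *\<^sub>R f (a' + x))"
  proof (rule integral_cong_AE)
    show "AE x in lborel. indicator (box 0 L) x *\<^sub>R f (x + a) =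
        indicator U (a + x) *\<^sub>R f (a + x) + indicator W (a' + x) *\<^sub>R f (a' + x)"
      using null[of "L $ j - h"]
    proof eventually_elim
      case (elim x)
      have "f (a' + x) = f (a + x)" "f (x + a) = f (a + x)" using shift[of x] by (simp_all add: add.commute)
      then show ?case using elim by (auto simp: indicator_def memU memW)
    qed
  qed measurable
  also have "\<dots> = (LINT x|lborel. indicator U x *\<^sub>R f x) + (LINT x|lborel. indicator W x *\<^sub>R f x)"
    using UW by (subst Bochner_Integration.integral_add) (auto intro!: int_shift simp: val_shift)
  also have "\<dots> = (LINT x|lborel. indicator U x *\<^sub>R f x + indicator W x *\<^sub>R f x)"
    using UW by (subst Bochner_Integration.integral_add) (auto intro!: int)
  also have "\<dots> = (LINT x|lborel. indicator (box 0 L) x *\<^sub>R f x)"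
  proof (rule integral_cong_AE)
    show "AE x in lborel. indicator U x *\<^sub>R f x + indicator W x *\<^sub>R f x = indicator (box 0 L) x *\<^sub>R f x"
      using null[of h]
      by eventually_elim (auto simp: U_def W_def indicator_def)
  qed measurable
  also have "\<dots> = (LINT x|M. f x)"
    by (rule integral_M_lborel[OF f, symmetric])
  finally show ?thesis by (simp add: a_def)
qed

lemma periodic_fmode: "periodic L (fmode L k)"
proof -
  have "fmode L k (x + axis i (L $ i)) = fmode L k x" for i x
  proof -
    have "wave L k \<bullet> (x + axis i (L $ i)) = wave L k \<bullet> x + of_int (k $ i) * (2 * pi)"
      using side_pos[of i] by (simp add: inner_add_right inner_axis wave_def)
    moreover have "cis (of_int (k $ i) * (2 * pi)) = 1"
      using cis_multiple_2pi[of "of_int (k $ i)"] by (simp add: mult.commute)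
    ultimately show ?thesis
      by (simp only: fmode_def cis_mult[symmetric] mult_1_right)
  qed
  then show ?thesis by (simp add: periodic_def)
qed

lemma integral_fmode: "(LINT x|M. fmode L k x) = (if k = 0 then of_real (sqrt (vol L)) else 0)"
proof (cases "k = 0")
  case True
  have "(LINT x|M. fmode L k x) = (LINT x|M. 1 / of_real (sqrt (vol L)))"
    using True by (simp add: fmode_0)
  also have "\<dots> = of_real (vol L) / of_real (sqrt (vol L))"
    using measure_box by (simp add: scaleR_conv_of_real)
  also have "\<dots> = of_real (sqrt (vol L))"
    by (metis of_real_divide real_div_sqrt vol_pos less_imp_le)
  finally show ?thesis using True by simp
next
  case False
  then obtain j where j: "k $ j \<noteq> 0" by (auto simp: vec_eq_iff)
  \<comment> \<open>Half a wavelength in direction \<open>j\<close>: this shift multiplies the mode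
    by -1, so its integral equals its own negative.\<close>
  define h where "h = L $ j / (2 * \<bar>of_int (k $ j)\<bar>)"
  have k1: "\<bar>of_int (k $ j) :: real\<bar> \<ge> 1" using j by linarith
  have h0: "h > 0" using side_pos[of j] k1 by (simp add: h_def)
  have "h \<le> L $ j / 2" unfolding h_def
    using side_pos[of j] k1 by (intro divide_left_mono) auto
  with side_pos[of j] have h1: "h < L $ j" by linarith
  have "fmode L k (x + axis j h) = - fmode L k x" for x
  proof -
    have "wave L k \<bullet> axis j h = pi * sgn (of_int (k $ j))"
      using side_pos[of j] j by (simp add: inner_axis wave_def h_def sgn_if abs_if field_simps)
    moreover have "cis (pi * sgn (of_int (k $ j))) = -1"
      using j by (auto simp: sgn_if cis.ctr complex_eq_iff)
    ultimately show ?thesis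
      by (simp add: fmode_def inner_add_right cis_mult[symmetric])
  qed
  then have "- (LINT x|M. fmode L k x) = (LINT x|M. fmode L k x)"
    using integral_translate[OF continuous_fmode periodic_fmode h0 h1, of k] by simp
  then show ?thesis using False by simp
qed

lemma fmode_orthonormal: "(LINT x|M. fmode L k x * cnj (fmode L l x)) = (if k = l then 1 else 0)"
proof -
  have "(LINT x|M. fmode L k x * cnj (fmode L l x)) = (LINT x|M. fmode L (k - l) x / of_real (sqrt (vol L)))"
    by (simp add: cnj_fmode fmode_mult)
  also have "\<dots> = (LINT x|M. fmode L (k - l) x) / of_real (sqrt (vol L))"
    by simp
  finally show ?thesis using vol_pos by (simp add: integral_fmode)
qed

lemma norm_fmode: "norm (fmode L k x) = 1 / sqrt (vol L)"
  using vol_pos by (simp add: fmode_def norm_divide)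

lemma measurable_fmode [measurable]: "fmode L k \<in> borel_measurable M"
  by (intro measurable_continuous continuous_fmode)

lemma integrable_mult_bounded:
  fixes F g :: "real^3 \<Rightarrow> complex"
  assumes F: "integrable M F" and g: "continuous_on UNIV g"
  shows "integrable M (\<lambda>x. F x * g x)"
proof -
  obtain B where B: "\<And>x. x \<in> cbox 0 L \<Longrightarrow> norm (g x) \<le> B" "B \<ge> 0"
    using bounded_on_box[OF g] by metis
  show ?thesis
  proof (rule Bochner_Integration.integrable_bound)
    show "integrable M (\<lambda>x. F x * of_real B)" using F by simp
    show "(\<lambda>x. F x * g x) \<in> borel_measurable M"
      using F measurable_continuous[OF g] by measurable
    show "AE x in M. norm (F x * g x) \<le> norm (F x * of_real B)"
      using B box_subset_cbox by (intro AE_I2) (auto simp: norm_mult subset_iff intro!: mult_left_mono)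
  qed
qed

section \<open>Completeness of the modes by the Stone--Weierstrass theorem\<close>

definition annihilates :: "(real^3 \<Rightarrow> complex) \<Rightarrow> bool" where
  "annihilates F \<longleftrightarrow> integrable M F \<and> (\<forall>k. (LINT x|M. F x * fmode L k x) = 0)"

text \<open>A product of two modes is a mode up to a constant, so the annihilator of the modes is a
  module over them, and in the end over all trigonometric polynomials.\<close>

lemma annihilates_fmode:
  assumes "annihilates F" shows "annihilates (\<lambda>x. F x * fmode L l x)"
  using assms unfolding annihilates_def
  by (auto simp: mult.assoc fmode_mult intro!: integrable_mult_bounded continuous_fmode)

lemma annihilates_add:
  assumes "annihilates F" "annihilates G" shows "annihilates (\<lambda>x. F x + G x)"
  using assms unfolding annihilates_def
  by (auto simp: distrib_right integrable_mult_bounded continuous_fmode)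

lemma annihilates_cmult:
  assumes "annihilates F" shows "annihilates (\<lambda>x. F x * c)"
  using assms unfolding annihilates_def by (auto simp: mult.commute[of _ c] mult.assoc)

text \<open>The box is mapped to a torus in \<open>\<real>\<^sup>6\<close>; functions vanishing on the boundary of the box descend
  to the torus, where the Stone--Weierstrass theorem applies.\<close>

definition torus_map :: "real^3 \<Rightarrow> (real^3) \<times> (real^3)" where
  "torus_map x = (\<chi> i. cos (2 * pi * x $ i / L $ i), \<chi> i. sin (2 * pi * x $ i / L $ i))"

lemma continuous_torus_map: "continuous_on S torus_map"
  unfolding torus_map_def using side_pos
  by (intro continuous_on_Pair continuous_on_vec_lambda continuous_intros) (metis less_irrefl)+

lemma annihilates_trig:
  assumes "annihilates F"
  shows "annihilates (\<lambda>x. F x * of_real (cos (2 * pi * x $ i / L $ i)))"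
    and "annihilates (\<lambda>x. F x * of_real (sin (2 * pi * x $ i / L $ i)))"
proof -
  define e :: "int^3" where "e = axis i 1"
  have w: "wave L e \<bullet> x = 2 * pi * x $ i / L $ i" for x
  proof -
    have "wave L e = axis i (2 * pi / L $ i)" by (simp add: wave_def e_def vec_eq_iff axis_def)
    then show ?thesis by (simp add: inner_axis' )
  qed
  have v: "sqrt (vol L) \<noteq> 0" using vol_pos by simp
  have c: "F x * of_real (cos (2 * pi * x $ i / L $ i)) =
      F x * fmode L e x * (of_real (sqrt (vol L)) / 2) + F x * fmode L (- e) x * (of_real (sqrt (vol L)) / 2)" for x
    unfolding cnj_fmode[symmetric] using v
    by (simp add: fmode_def w complex_eq_iff add_divide_distrib diff_divide_distrib)
  have s: "F x * of_real (sin (2 * pi * x $ i / L $ i)) =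
      F x * fmode L e x * (of_real (sqrt (vol L)) / (2 * \<i>)) + F x * fmode L (- e) x * (- (of_real (sqrt (vol L)) / (2 * \<i>)))" for x
    unfolding cnj_fmode[symmetric] using v
    by (simp add: fmode_def w complex_eq_iff Re_divide Im_divide power2_eq_square field_simps)
  show "annihilates (\<lambda>x. F x * of_real (cos (2 * pi * x $ i / L $ i)))"
    unfolding c by (intro annihilates_add annihilates_cmult annihilates_fmode assms)
  show "annihilates (\<lambda>x. F x * of_real (sin (2 * pi * x $ i / L $ i)))"
    unfolding s by (intro annihilates_add annihilates_cmult annihilates_fmode assms)
qed

lemma annihilates_sum:
  assumes "finite I" "\<And>i. i \<in> I \<Longrightarrow> annihilates (F i)" shows "annihilates (\<lambda>x. \<Sum>i\<in>I. F i x)"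
  using assms by (induction I rule: finite_induct) (auto simp: annihilates_add, simp add: annihilates_def)

text \<open>\<open>F\<close> is generalised in the induction because a product is handled one factor
  at a time: \<open>F\<close> times the first factor is again an annihilator and takes the place of
  \<open>F\<close> for the second.\<close>

lemma annihilates_polynomial:
  assumes "real_polynomial_function p"
  shows "annihilates F \<Longrightarrow> annihilates (\<lambda>x. F x * of_real (p (torus_map x)))"
  using assms
proof (induction p arbitrary: F rule: real_polynomial_function.induct)
  case (linear f)
  interpret f: bounded_linear f by fact
  have *: "f (torus_map x) = (\<Sum>i\<in>UNIV. cos (2 * pi * x $ i / L $ i) * f (axis i 1, 0)) +
      (\<Sum>i\<in>UNIV. sin (2 * pi * x $ i / L $ i) * f (0, axis i 1))" for x
  proof -
    have "torus_map x = (\<Sum>i\<in>UNIV. cos (2 * pi * x $ i / L $ i) *\<^sub>R (axis i 1, 0)) +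
      (\<Sum>i\<in>UNIV. sin (2 * pi * x $ i / L $ i) *\<^sub>R (0, axis i 1))"
      by (rule prod_eqI) (simp_all add: torus_map_def fst_sum snd_sum vec_eq_iff axis_def if_distrib cong: if_cong)
    then show ?thesis by (simp only: f.add f.sum f.scaleR real_scaleR_def)
  qed
  have "(\<lambda>x. F x * of_real (f (torus_map x))) =
     (\<lambda>x. (\<Sum>i\<in>UNIV. F x * of_real (cos (2 * pi * x $ i / L $ i)) * of_real (f (axis i 1, 0))) +
      (\<Sum>i\<in>UNIV. F x * of_real (sin (2 * pi * x $ i / L $ i)) * of_real (f (0, axis i 1))))"
    unfolding * by (simp add: distrib_left sum_distrib_left mult.assoc)
  then show ?case
    using linear by (auto intro!: annihilates_add annihilates_sum annihilates_cmult annihilates_trig)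
next
  case (const c) then show ?case by (intro annihilates_cmult)
next
  case (add f g) then show ?case by (simp add: distrib_left annihilates_add)
next
  case (mult f g)
  have "annihilates (\<lambda>x. F x * of_real (f (torus_map x)) * of_real (g (torus_map x)))"
    by (intro mult)
  then show ?case by (simp add: mult.assoc)
qed

text \<open>The torus map identifies nothing but boundary points, where \<open>h\<close> vanishes,
  so \<open>h\<close> is constant on its fibres. Being continuous on a compact set, the map is a
  quotient map onto its image, whence the induced function is continuous.\<close>

lemma continuous_on_torus:
  fixes h :: "real^3 \<Rightarrow> real"
  assumes h: "continuous_on (cbox 0 L) h" and bd: "\<And>x. x \<in> cbox 0 L - box 0 L \<Longrightarrow> h x = 0"
  obtains g where "continuous_on (torus_map ` cbox 0 L) g" "\<And>x. x \<in> cbox 0 L \<Longrightarrow> g (torus_map x) = h x"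
proof -
  \<comment> \<open>Equal angles force the coordinates to differ by \<open>n * L $ i\<close> with
    integer \<open>n\<close>; as \<open>x\<close> is interior, \<open>|n| < 1\<close>. Two boundary
    points on opposite faces do collide, which is why one point is taken in the open box.\<close>
  have inj: "x = y" if x: "x \<in> box 0 L" and y: "y \<in> cbox 0 L" and e: "torus_map x = torus_map y" for x y
  proof -
    have "x $ i = y $ i" for i
    proof -
      have "cos (2 * pi * x $ i / L $ i) = cos (2 * pi * y $ i / L $ i)" "sin (2 * pi * x $ i / L $ i) = sin (2 * pi * y $ i / L $ i)"
        using e by (auto simp: torus_map_def vec_eq_iff)
      then obtain n :: int where "2 * pi * x $ i / L $ i = 2 * pi * y $ i / L $ i + 2 * pi * n"
        using sin_cos_eq_iff by metis
      then have "2 * pi * (x $ i) = 2 * pi * (y $ i + n * L $ i)"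
        using side_pos[of i] by (simp add: field_simps)
      then have n: "x $ i = y $ i + n * L $ i" by simp
      have b: "0 < x $ i" "x $ i < L $ i" "0 \<le> y $ i" "y $ i \<le> L $ i"
        using x y by (auto simp: mem_box0 mem_cbox0)
      have "of_int n * L $ i < 1 * L $ i" "(-1) * L $ i < of_int n * L $ i" using n b by linarith+
      then have "of_int n < (1::real)" "(-1::real) < of_int n"
        using side_pos[of i] mult_less_cancel_right_pos by blast+
      then have "n = 0" by linarith
      then show ?thesis using n by simp
    qed
    then show ?thesis by (simp add: vec_eq_iff)
  qed
  have wd: "h x = h y" if "x \<in> cbox 0 L" "y \<in> cbox 0 L" "torus_map x = torus_map y" for x y
    using inj[of x y] inj[of y x] bd[of x] bd[of y] that by (metis DiffI)
  define g where "g = (\<lambda>z. h (inv_into (cbox 0 L) torus_map z))"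
  have g: "g (torus_map x) = h x" if "x \<in> cbox 0 L" for x
    unfolding g_def using that
    by (intro wd) (auto intro: inv_into_into f_inv_into_f)
  moreover have "continuous_on (torus_map ` cbox 0 L) g"
    unfolding continuous_on_open
  proof (intro allI impI)
    fix V assume V: "openin (top_of_set (g ` torus_map ` cbox 0 L)) V"
    have "g ` torus_map ` cbox 0 L = h ` cbox 0 L" using g by (force simp: image_iff)
    then have "openin (top_of_set (cbox 0 L)) (cbox 0 L \<inter> h -` V)"
      using V h unfolding continuous_on_open by metis
    also have "cbox 0 L \<inter> h -` V = cbox 0 L \<inter> torus_map -` (torus_map ` cbox 0 L \<inter> g -` V)"
      by (rule set_eqI, simp only: Int_iff vimage_eq) (metis g imageI)
    finally show "openin (top_of_set (torus_map ` cbox 0 L)) (torus_map ` cbox 0 L \<inter> g -` V)"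
      by (rule iffD1[OF Abstract_Topology_2.continuous_imp_quotient_map
            [OF continuous_torus_map refl compact_cbox Int_lower1]])
  qed
  ultimately show ?thesis using that by blast
qed

lemma annihilates_continuous:
  fixes h :: "real^3 \<Rightarrow> real"
  assumes F: "annihilates F"
    and h: "continuous_on UNIV h" and bd: "\<And>x. x \<in> cbox 0 L - box 0 L \<Longrightarrow> h x = 0"
  shows "(LINT x|M. F x * of_real (h x)) = 0"
proof -
  obtain g where g: "continuous_on (torus_map ` cbox 0 L) g" "\<And>x. x \<in> cbox 0 L \<Longrightarrow> g (torus_map x) = h x"
    using continuous_on_torus[OF continuous_on_subset[OF h] bd] by auto
  have Fi: "integrable M F" using F by (simp add: annihilates_def)
  have ih: "integrable M (\<lambda>x. F x * of_real (h x))"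
    by (intro integrable_mult_bounded Fi continuous_intros h)
  have le: "norm (LINT x|M. F x * of_real (h x)) \<le> e * (LINT x|M. norm (F x))" if e: "e > 0" for e
  proof -
    have "compact (torus_map ` cbox 0 L)"
      by (intro compact_continuous_image continuous_torus_map) auto
    then obtain p where p: "real_polynomial_function p" "\<And>z. z \<in> torus_map ` cbox 0 L \<Longrightarrow> \<bar>g z - p z\<bar> < e"
      using Stone_Weierstrass_real_polynomial_function[OF _ g(1) e] by metis
    have A: "annihilates (\<lambda>x. F x * of_real (p (torus_map x)))"
      by (rule annihilates_polynomial[OF p(1) F])
    have v: "complex_of_real (sqrt (vol L)) \<noteq> 0" using vol_pos by simp
    \<comment> \<open>The zero mode is a nonzero constant, so annihilating it means having vanishing
      integral.\<close>
    have "(LINT x|M. F x * of_real (p (torus_map x)) * fmode L 0 x) = 0"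
      using A by (auto simp: annihilates_def)
    then have z: "(LINT x|M. F x * of_real (p (torus_map x))) = 0"
      using v by (simp add: fmode_0)
    have ip: "integrable M (\<lambda>x. F x * of_real (p (torus_map x)))"
      using A by (simp add: annihilates_def)
    have "(LINT x|M. F x * of_real (h x)) = (LINT x|M. F x * of_real (h x) - F x * of_real (p (torus_map x)))"
      using z ih ip by simp
    also have "norm \<dots> \<le> (LINT x|M. e * norm (F x))"
    proof (rule order_trans[OF integral_norm_bound integral_mono_AE])
      show "integrable M (\<lambda>x. norm (F x * of_real (h x) - F x * of_real (p (torus_map x))))"
        using ih ip by auto
      show "integrable M (\<lambda>x. e * norm (F x))" using Fi by auto
      show "AE x in M. norm (F x * of_real (h x) - F x * of_real (p (torus_map x))) \<le> e * norm (F x)"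
      proof (rule AE_I2)
        fix x assume "x \<in> space M"
        then have x: "x \<in> cbox 0 L" using box_subset_cbox by (auto simp: subset_iff)
        then have "\<bar>h x - p (torus_map x)\<bar> \<le> e" using p(2)[of "torus_map x"] g(2)[of x] by force
        moreover have "F x * of_real (h x) - F x * of_real (p (torus_map x)) = of_real (h x - p (torus_map x)) * F x"
          by (simp add: algebra_simps)
        ultimately show "norm (F x * of_real (h x) - F x * of_real (p (torus_map x))) \<le> e * norm (F x)"
          by (simp add: norm_mult mult_right_mono del: of_real_diff)
      qed
    qed
    finally show ?thesis by simp
  qed
  have "norm (LINT x|M. F x * of_real (h x)) \<le> 0 + e" if e: "e > 0" for e :: real
  proof -
    define I where "I = (LINT x|M. norm (F x))"
    have I: "I \<ge> 0" by (simp add: I_def)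
    \<comment> \<open>Dividing by \<open>I + 1\<close> instead of \<open>I\<close> covers the case
      \<open>I = 0\<close>.\<close>
    have "norm (LINT x|M. F x * of_real (h x)) \<le> e / (I + 1) * I"
    proof -
      have "e / (I + 1) > 0" using e I by simp
      from le[OF this] show ?thesis unfolding I_def .
    qed
    also have "\<dots> \<le> e" using e I by (simp add: field_simps)
    finally show ?thesis by simp
  qed
  then have "norm (LINT x|M. F x * of_real (h x)) \<le> 0" by (rule field_le_epsilon)
  then show ?thesis by simp
qed

text \<open>\<open>sgn G\<close> is an almost everywhere limit of continuous functions. Clipped to
  \<open>[-1, 1]\<close> and cut off near the boundary they become admissible test functions
  dominated by 1, and the limit of the hypotheses reads that the integral of \<open>|G|\<close> is
  zero.\<close>

lemma real_zero_AE:
  fixes G :: "real^3 \<Rightarrow> real"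
  assumes G: "integrable M G"
    and z: "\<And>h. continuous_on UNIV h \<Longrightarrow> (\<And>x. x \<in> cbox 0 L - box 0 L \<Longrightarrow> h x = 0) \<Longrightarrow> (LINT x|M. G x * h x) = 0"
  shows "AE x in M. G x = 0"
proof -
  have [measurable]: "G \<in> borel_measurable M" using G by auto
  have "(\<lambda>x. sgn (G x)) \<in> borel_measurable M" by measurable
  then have "(\<lambda>x. sgn (G x)) measurable_on (box 0 L)"
    by (subst measurable_on_iff_borel_measurable) auto
  then obtain N g where N: "negligible N" and g: "\<And>n. continuous_on UNIV (g n)"
      and lim: "\<And>x. x \<notin> N \<Longrightarrow> (\<lambda>n. g n x) \<longlonglongrightarrow> (if x \<in> box 0 L then sgn (G x) else 0)"
    unfolding measurable_on_def by blast
  \<comment> \<open>The product vanishes on every face and is positive inside; multiplied by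
    \<open>n\<close> and clipped it equals 1 at any given interior point from some \<open>n\<close>
    on.\<close>
  define cut where "cut = (\<lambda>(n::nat) (x::real^3). max (-1) (min 1 (real n * (\<Prod>i\<in>UNIV. x $ i * (L $ i - x $ i)))))"
  define h where "h = (\<lambda>n x. cut n x * max (-1) (min 1 (g n x)))"
  have hc: "continuous_on UNIV (h n)" for n
    unfolding h_def cut_def by (intro continuous_intros continuous_on_max continuous_on_min g)
  have hb: "h n x = 0" if x: "x \<in> cbox 0 L - box 0 L" for n x
  proof -
    obtain i where "\<not> (0 < x $ i \<and> x $ i < L $ i)"
      using x unfolding mem_box0 Diff_iff by blast
    moreover have "0 \<le> x $ i" "x $ i \<le> L $ i"
      using x unfolding mem_cbox0 Diff_iff by blast+
    ultimately have "x $ i * (L $ i - x $ i) = 0" by force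
    then have "(\<Prod>i\<in>UNIV. x $ i * (L $ i - x $ i)) = 0" by (intro prod_zero bexI[of _ i]) simp_all
    then show ?thesis unfolding h_def cut_def by (simp only: mult_zero_right max_def min_def) simp
  qed
  have h1: "\<bar>h n x\<bar> \<le> 1" for n x
    unfolding h_def cut_def abs_mult by (rule mult_le_one) auto
  have "(\<lambda>n. LINT x|M. G x * h n x) \<longlonglongrightarrow> (LINT x|M. G x * sgn (G x))"
  proof (rule integral_dominated_convergence)
    show "(\<lambda>x. G x * sgn (G x)) \<in> borel_measurable M" by measurable
    show "(\<lambda>x. G x * h n x) \<in> borel_measurable M" for n
      using measurable_continuous[OF hc[of n]] by measurable
    show "integrable M (\<lambda>x. \<bar>G x\<bar>)" using G by auto
    show "AE x in M. norm (G x * h n x) \<le> \<bar>G x\<bar>" for n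
      using h1 by (intro AE_I2) (auto simp: abs_mult intro: mult_left_le)
    have "AE x in M. x \<notin> N"
      using AE_not_in[of N lebesgue] N
      by (subst AE_restrict_space_iff) (auto simp: negligible_iff_null_sets)
    then show "AE x in M. (\<lambda>n. G x * h n x) \<longlonglongrightarrow> G x * sgn (G x)"
    proof (rule AE_mp, intro AE_I2 impI)
      fix x assume x: "x \<in> space M" "x \<notin> N"
      have "(\<Prod>i\<in>UNIV. x $ i * (L $ i - x $ i)) > 0" (is "?p > 0")
        using x by (intro prod_pos) (auto simp: mem_box0)
      then obtain n0 :: nat where n0: "1 \<le> real n0 * ?p"
        using reals_Archimedean3[of ?p] less_imp_le by blast
      have "cut n x = 1" if "n \<ge> n0" for n
      proof -
        have "real n0 * ?p \<le> real n * ?p" using that \<open>?p > 0\<close> by (intro mult_right_mono) auto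
        then show ?thesis using n0 by (simp add: cut_def)
      qed
      then have c1: "(\<lambda>n. cut n x) \<longlonglongrightarrow> 1"
        by (intro tendsto_eventually) (auto simp: eventually_sequentially)
      have "(\<lambda>n. max (-1) (min 1 (g n x))) \<longlonglongrightarrow> max (-1) (min 1 (sgn (G x)))"
        using lim[OF x(2)] x(1) by (intro tendsto_intros) auto
      moreover have "max (-1) (min 1 (sgn (G x))) = sgn (G x)" by (simp add: sgn_if)
      ultimately have "(\<lambda>n. G x * h n x) \<longlonglongrightarrow> G x * (1 * sgn (G x))"
        unfolding h_def by (intro tendsto_intros c1) auto
      then show "(\<lambda>n. G x * h n x) \<longlonglongrightarrow> G x * sgn (G x)" by simp
    qed
  qed
  moreover have "(LINT x|M. G x * h n x) = 0" for n
    by (rule z[OF hc hb])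
  ultimately have "(LINT x|M. G x * sgn (G x)) = 0"
    by (simp add: LIMSEQ_const_iff)
  moreover have "G x * sgn (G x) = \<bar>G x\<bar>" for x by (simp add: sgn_if)
  ultimately have "(LINT x|M. \<bar>G x\<bar>) = 0" by simp
  then show ?thesis
    using G by (subst (asm) integral_nonneg_eq_0_iff_AE) auto
qed

theorem fourier_complete:
  assumes F: "annihilates F"
  shows "AE x in M. F x = 0"
proof -
  have Fi: "integrable M F" using F by (simp add: annihilates_def)
  have "AE x in M. Re (F x) = 0"
  proof (rule real_zero_AE)
    show "integrable M (\<lambda>x. Re (F x))" using Fi by simp
    fix h :: "real^3 \<Rightarrow> real" assume h: "continuous_on UNIV h" "\<And>x. x \<in> cbox 0 L - box 0 L \<Longrightarrow> h x = 0"
    have "(LINT x|M. Re (F x * of_real (h x))) = Re (LINT x|M. F x * of_real (h x))"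
      by (intro integral_Re integrable_mult_bounded Fi continuous_intros h)
    then show "(LINT x|M. Re (F x) * h x) = 0" using annihilates_continuous[OF F h] by simp
  qed
  moreover have "AE x in M. Im (F x) = 0"
  proof (rule real_zero_AE)
    show "integrable M (\<lambda>x. Im (F x))" using Fi by simp
    fix h :: "real^3 \<Rightarrow> real" assume h: "continuous_on UNIV h" "\<And>x. x \<in> cbox 0 L - box 0 L \<Longrightarrow> h x = 0"
    have "(LINT x|M. Im (F x * of_real (h x))) = Im (LINT x|M. F x * of_real (h x))"
      by (intro integral_Im integrable_mult_bounded Fi continuous_intros h)
    then show "(LINT x|M. Im (F x) * h x) = 0" using annihilates_continuous[OF F h] by simp
  qed
  ultimately show ?thesis by eventually_elim (simp add: complex_eq_iff)
qed

end

section \<open>Square summable Fourier series\<close>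

text \<open>Truncation by cubes is invariant under \<open>k \<mapsto> -k\<close>, so truncated
  series of real fields stay real, and the number of points in a shell is explicit.\<close>

definition cube :: "nat \<Rightarrow> (int^3) set" where
  "cube n = {k. \<forall>i. \<bar>k $ i\<bar> \<le> int n}"

lemma finite_cube [simp]: "finite (cube n)"
proof -
  have "cube n \<subseteq> (\<lambda>f. \<chi> i. f i) ` (PiE UNIV (\<lambda>_. {- int n..int n}))"
  proof
    fix k assume "k \<in> cube n"
    then have "vec_nth k \<in> PiE UNIV (\<lambda>_. {- int n..int n})" "k = (\<chi> i. vec_nth k i)"
      by (auto simp: cube_def abs_le_iff minus_le_iff)
    then show "k \<in> (\<lambda>f. \<chi> i. f i) ` (PiE UNIV (\<lambda>_. {- int n..int n}))" by blast
  qed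
  then show ?thesis by (rule finite_subset) (intro finite_imageI finite_PiE; simp)
qed

lemma cube_mono: "m \<le> n \<Longrightarrow> cube m \<subseteq> cube n"
  unfolding cube_def by (auto intro: order_trans)

lemma ex_cube: "\<exists>n. k \<in> cube n"
proof -
  have "\<bar>k $ i\<bar> \<le> (\<Sum>i\<in>UNIV. \<bar>k $ i\<bar>)" for i
    by (rule member_le_sum) auto
  then have "k \<in> cube (nat (\<Sum>i\<in>UNIV. \<bar>k $ i\<bar>))"
    by (auto simp: cube_def sum_nonneg)
  then show ?thesis ..
qed

lemma finite_subset_cube:
  assumes "finite K" shows "\<exists>n. K \<subseteq> cube n"
  using assms
proof (induction K rule: finite_induct)
  case (insert k K)
  then obtain m n where "K \<subseteq> cube m" "k \<in> cube n" using ex_cube by metis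
  then have "insert k K \<subseteq> cube (max m n)"
    using cube_mono[of m "max m n"] cube_mono[of n "max m n"] by auto
  then show ?case ..
qed auto

lemma uminus_cube [simp]: "- k \<in> cube n \<longleftrightarrow> k \<in> cube n"
  by (simp add: cube_def)

lemma zero_in_cube [simp]: "0 \<in> cube n"
  by (simp add: cube_def)

text \<open>Unconditional sums may be computed along the cubes. This turns \<open>has_sum\<close>
  statements into limits of sequences, to which Fatou's lemma and dominated convergence
  apply.\<close>

lemma filterlim_cube: "filterlim cube (finite_subsets_at_top UNIV) sequentially"
  unfolding filterlim_finite_subsets_at_top
proof (intro allI impI)
  fix X :: "(int^3) set" assume "finite X \<and> X \<subseteq> UNIV"
  then obtain n where "X \<subseteq> cube n" using finite_subset_cube by blast
  then show "\<forall>\<^sub>F y in sequentially. finite (cube y) \<and> X \<subseteq> cube y \<and> cube y \<subseteq> UNIV"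
    unfolding eventually_sequentially using cube_mono by (intro exI[of _ n]) fastforce
qed

lemma borel_measurable_cnj [measurable (raw)]:
  "f \<in> borel_measurable N \<Longrightarrow> (\<lambda>x. cnj (f x)) \<in> borel_measurable N"
  by (rule borel_measurable_continuous_on[OF continuous_on_cnj[OF continuous_on_id]])

lemma has_sum_cube:
  "(f has_sum S) UNIV \<Longrightarrow> (\<lambda>n. sum f (cube n)) \<longlonglongrightarrow> S"
  unfolding has_sum_def by (rule filterlim_compose[OF _ filterlim_cube])

lemma countable_int3: "countable (UNIV :: (int^3) set)"
proof -
  have "UNIV = (\<Union>n. cube n)" using ex_cube by auto
  then show ?thesis by (metis countable_UN countable_finite finite_cube uncountable_def countableI_type)
qed

text \<open>Polarisation turns Bessel and Parseval statements for norms into statements for products.\<close>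

lemma polarisation:
  fixes z w :: complex
  shows "z * cnj w = (of_real ((cmod (z + w))\<^sup>2) + (-1) * of_real ((cmod (z - w))\<^sup>2)
    + \<i> * of_real ((cmod (z + \<i> * w))\<^sup>2) + (- \<i>) * of_real ((cmod (z - \<i> * w))\<^sup>2)) * (1 / 4)"
  by (simp add: cmod_power2 complex_eq_iff) (simp add: power2_eq_square algebra_simps)

section \<open>Bessel, Riesz--Fischer, Parseval and the convolution theorem for scalar
  functions\<close>

definition sq_int :: "real^3 \<Rightarrow> (real^3 \<Rightarrow> complex) \<Rightarrow> bool" where
  "sq_int L f \<longleftrightarrow> f \<in> borel_measurable (box_measure L) \<and> integrable (box_measure L) (\<lambda>x. (cmod (f x))\<^sup>2)"

definition fcoef :: "real^3 \<Rightarrow> (real^3 \<Rightarrow> complex) \<Rightarrow> int^3 \<Rightarrow> complex" where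
  "fcoef L f k = (LINT x|box_measure L. f x * cnj (fmode L k x))"

definition psum :: "real^3 \<Rightarrow> (int^3) set \<Rightarrow> (int^3 \<Rightarrow> complex) \<Rightarrow> real^3 \<Rightarrow> complex" where
  "psum L K a x = (\<Sum>k\<in>K. a k * fmode L k x)"

lemma continuous_psum: "continuous_on S (psum L K a)"
  unfolding psum_def by (intro continuous_intros continuous_fmode)

context periodic_box
begin

lemma sq_int_measurable [measurable_dest]: "sq_int L f \<Longrightarrow> f \<in> borel_measurable M"
  by (simp add: sq_int_def)

lemma sq_int_continuous: "continuous_on UNIV f \<Longrightarrow> sq_int L f"
  unfolding sq_int_def
  by (intro conjI measurable_continuous integrable_continuous) (auto intro!: continuous_intros)

lemma sq_int_mult_integrable:
  assumes f: "sq_int L f" and g: "sq_int L g"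
  shows "integrable M (\<lambda>x. f x * g x)"
proof (rule Bochner_Integration.integrable_bound)
  show "integrable M (\<lambda>x. (cmod (f x))\<^sup>2 + (cmod (g x))\<^sup>2)"
    using f g by (auto simp: sq_int_def)
  show "(\<lambda>x. f x * g x) \<in> borel_measurable M"
    using f g by measurable
  have "a * b \<le> a\<^sup>2 + b\<^sup>2" for a b :: real
    using sum_squares_bound[of a b] zero_le_power2[of a] zero_le_power2[of b]
    by (smt (verit) mult_2 distrib_right)
  then show "AE x in M. norm (f x * g x) \<le> norm ((cmod (f x))\<^sup>2 + (cmod (g x))\<^sup>2)"
    by (intro AE_I2) (auto simp: norm_mult intro: order_trans[OF _ abs_ge_self])
qed

lemma sq_int_const: "sq_int L (\<lambda>x. c)"
  by (intro sq_int_continuous) auto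

lemma sq_int_integrable: "sq_int L f \<Longrightarrow> integrable M f"
  using sq_int_mult_integrable[of f "\<lambda>_. 1"] sq_int_const by simp

lemma sq_int_add:
  assumes f: "sq_int L f" and g: "sq_int L g"
  shows "sq_int L (\<lambda>x. f x + g x)"
  unfolding sq_int_def
proof
  show "(\<lambda>x. f x + g x) \<in> borel_measurable M" using f g by measurable
  show "integrable M (\<lambda>x. (cmod (f x + g x))\<^sup>2)"
  proof (rule Bochner_Integration.integrable_bound)
    show "integrable M (\<lambda>x. 2 * (cmod (f x))\<^sup>2 + 2 * (cmod (g x))\<^sup>2)"
      using f g by (auto simp: sq_int_def)
    show "(\<lambda>x. (cmod (f x + g x))\<^sup>2) \<in> borel_measurable M" using f g by measurable
    have "(cmod (a + b))\<^sup>2 \<le> 2 * (cmod a)\<^sup>2 + 2 * (cmod b)\<^sup>2" for a b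
    proof -
      have "(cmod (a + b))\<^sup>2 \<le> (cmod a + cmod b)\<^sup>2"
        by (intro power_mono norm_triangle_ineq) auto
      also have "\<dots> \<le> 2 * (cmod a)\<^sup>2 + 2 * (cmod b)\<^sup>2"
        using sum_squares_bound[of "cmod a" "cmod b"] by (simp add: power2_sum)
      finally show ?thesis .
    qed
    then show "AE x in M. norm ((cmod (f x + g x))\<^sup>2) \<le> norm (2 * (cmod (f x))\<^sup>2 + 2 * (cmod (g x))\<^sup>2)"
      by (intro AE_I2) auto
  qed
qed

lemma sq_int_cmult: "sq_int L f \<Longrightarrow> sq_int L (\<lambda>x. c * f x)"
  by (auto simp: sq_int_def norm_mult power_mult_distrib)

lemma sq_int_diff: "sq_int L f \<Longrightarrow> sq_int L g \<Longrightarrow> sq_int L (\<lambda>x. f x - g x)"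
  using sq_int_add[of f "\<lambda>x. (-1) * g x"] sq_int_cmult[of g "-1"] by simp

lemma sq_int_cnj: "sq_int L f \<Longrightarrow> sq_int L (\<lambda>x. cnj (f x))"
  by (auto simp: sq_int_def)

lemma sq_int_fmode: "sq_int L (fmode L k)"
  by (intro sq_int_continuous continuous_fmode)

lemma sq_int_psum: "sq_int L (psum L K a)"
  by (intro sq_int_continuous continuous_psum)

lemma sq_int_bounded_mult:
  assumes f: "sq_int L f" and g: "g \<in> borel_measurable M" and b: "AE x in M. cmod (g x) \<le> B"
  shows "sq_int L (\<lambda>x. g x * f x)"
  unfolding sq_int_def
proof
  show "(\<lambda>x. g x * f x) \<in> borel_measurable M" using f g by measurable
  show "integrable M (\<lambda>x. (cmod (g x * f x))\<^sup>2)"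
  proof (rule Bochner_Integration.integrable_bound)
    show "integrable M (\<lambda>x. B\<^sup>2 * (cmod (f x))\<^sup>2)" using f by (auto simp: sq_int_def)
    show "(\<lambda>x. (cmod (g x * f x))\<^sup>2) \<in> borel_measurable M" using f g by measurable
    show "AE x in M. norm ((cmod (g x * f x))\<^sup>2) \<le> norm (B\<^sup>2 * (cmod (f x))\<^sup>2)"
      using b by eventually_elim (auto simp: norm_mult power_mult_distrib intro!: mult_right_mono power_mono)
  qed
qed

lemma sq_int_mult_fmode: "sq_int L f \<Longrightarrow> sq_int L (\<lambda>x. fmode L k x * f x)"
  by (rule sq_int_bounded_mult[where B="1 / sqrt (vol L)"]) (auto simp: norm_fmode)

lemma sq_int_AE_cong:
  assumes "sq_int L f" "g \<in> borel_measurable M" "AE x in M. f x = g x"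
  shows "sq_int L g"
proof -
  have "integrable M (\<lambda>x. (cmod (f x))\<^sup>2) \<longleftrightarrow> integrable M (\<lambda>x. (cmod (g x))\<^sup>2)"
    using assms by (intro integrable_cong_AE) (auto simp: sq_int_def)
  then show ?thesis using assms by (auto simp: sq_int_def)
qed

lemma fcoef_add: "sq_int L f \<Longrightarrow> sq_int L g \<Longrightarrow> fcoef L (\<lambda>x. f x + g x) k = fcoef L f k + fcoef L g k"
  unfolding fcoef_def distrib_right
  by (intro Bochner_Integration.integral_add sq_int_mult_integrable sq_int_cnj sq_int_fmode)

lemma fcoef_cmult: "fcoef L (\<lambda>x. c * f x) k = c * fcoef L f k"
  unfolding fcoef_def by (simp add: mult.assoc)

lemma fcoef_diff: "sq_int L f \<Longrightarrow> sq_int L g \<Longrightarrow> fcoef L (\<lambda>x. f x - g x) k = fcoef L f k - fcoef L g k"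
  unfolding fcoef_def left_diff_distrib
  by (intro Bochner_Integration.integral_diff sq_int_mult_integrable sq_int_cnj sq_int_fmode)

lemma fcoef_cnj: "fcoef L (\<lambda>x. cnj (f x)) k = cnj (fcoef L f (- k))"
proof -
  have "cnj (fcoef L f (- k)) = (LINT x|M. cnj (f x * cnj (fmode L (- k) x)))"
    unfolding fcoef_def by (rule Bochner_Integration.integral_cnj[symmetric])
  then show ?thesis by (simp add: fcoef_def cnj_fmode)
qed

lemma fcoef_AE_cong:
  assumes "f \<in> borel_measurable M" "g \<in> borel_measurable M" "AE x in M. f x = g x"
  shows "fcoef L f k = fcoef L g k"
  unfolding fcoef_def
proof (rule integral_cong_AE)
  show "AE x in M. f x * cnj (fmode L k x) = g x * cnj (fmode L k x)"
    using assms(3) by eventually_elim simp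
qed (use assms in measurable)

lemma fcoef_psum:
  assumes "finite K" shows "fcoef L (psum L K a) k = (if k \<in> K then a k else 0)"
proof -
  have "fcoef L (psum L K a) k = (LINT x|M. (\<Sum>l\<in>K. a l * (fmode L l x * cnj (fmode L k x))))"
    unfolding fcoef_def psum_def by (simp add: sum_distrib_right mult.assoc)
  also have "\<dots> = (\<Sum>l\<in>K. a l * (LINT x|M. fmode L l x * cnj (fmode L k x)))"
    by (subst Bochner_Integration.integral_sum)
       (auto intro!: integrable_mult_right sq_int_mult_integrable sq_int_fmode sq_int_cnj)
  also have "\<dots> = (if k \<in> K then a k else 0)"
    using assms by (simp add: fmode_orthonormal if_distrib cong: if_cong)
  finally show ?thesis .
qed

lemma cnj_psum: "cnj (psum L K a x) = (\<Sum>k\<in>K. cnj (a k) * cnj (fmode L k x))"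
  by (simp add: psum_def)

lemma integral_cnj_psum:
  assumes "sq_int L f" "finite K"
  shows "(LINT x|M. f x * cnj (psum L K a x)) = (\<Sum>k\<in>K. cnj (a k) * fcoef L f k)"
proof -
  have "(LINT x|M. f x * cnj (psum L K a x)) = (LINT x|M. (\<Sum>k\<in>K. cnj (a k) * (f x * cnj (fmode L k x))))"
    by (simp add: cnj_psum sum_distrib_left mult_ac)
  also have "\<dots> = (\<Sum>k\<in>K. cnj (a k) * fcoef L f k)"
    unfolding fcoef_def using assms
    by (subst Bochner_Integration.integral_sum)
       (auto intro!: integrable_mult_right sq_int_mult_integrable sq_int_fmode sq_int_cnj)
  finally show ?thesis .
qed

lemma of_real_integral_norm2:
  "complex_of_real (LINT x|M. (cmod (f x))\<^sup>2) = (LINT x|M. f x * cnj (f x))"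
  unfolding integral_complex_of_real[symmetric] complex_norm_square ..

text \<open>Pythagoras: the coefficients of the residual vanish on \<open>K\<close>, so the residual
  is orthogonal to the partial sum.\<close>

lemma bessel_identity:
  assumes f: "sq_int L f" and K: "finite K"
  shows "(LINT x|M. (cmod (f x - psum L K (fcoef L f) x))\<^sup>2) =
    (LINT x|M. (cmod (f x))\<^sup>2) - (\<Sum>k\<in>K. (cmod (fcoef L f k))\<^sup>2)"
proof -
  let ?S = "psum L K (fcoef L f)"
  let ?d = "\<lambda>x. f x - ?S x"
  have d: "sq_int L ?d" by (intro sq_int_diff f sq_int_psum)
  have 1: "(LINT x|M. ?d x * cnj (?S x)) = 0"
    using K by (subst integral_cnj_psum[OF d K]) (simp add: fcoef_diff f sq_int_psum fcoef_psum)
  have 2: "(LINT x|M. ?S x * cnj (f x)) = (\<Sum>k\<in>K. fcoef L f k * cnj (fcoef L f k))"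
  proof -
    have "(LINT x|M. ?S x * cnj (f x)) = (LINT x|M. cnj (f x * cnj (?S x)))"
      by (simp add: mult.commute)
    also have "\<dots> = cnj (LINT x|M. f x * cnj (?S x))" by (rule Bochner_Integration.integral_cnj)
    also have "\<dots> = (\<Sum>k\<in>K. fcoef L f k * cnj (fcoef L f k))"
      by (simp add: integral_cnj_psum[OF f K])
    finally show ?thesis .
  qed
  have "complex_of_real (LINT x|M. (cmod (?d x))\<^sup>2) = (LINT x|M. ?d x * cnj (f x) - ?d x * cnj (?S x))"
    unfolding of_real_integral_norm2 by (simp add: right_diff_distrib)
  also have "\<dots> = (LINT x|M. ?d x * cnj (f x))"
    using 1 by (subst Bochner_Integration.integral_diff)
      (auto intro!: sq_int_mult_integrable sq_int_cnj d f sq_int_psum simp del: complex_cnj_diff)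
  also have "\<dots> = (LINT x|M. f x * cnj (f x)) - (LINT x|M. ?S x * cnj (f x))"
    unfolding left_diff_distrib
    by (intro Bochner_Integration.integral_diff sq_int_mult_integrable sq_int_cnj f sq_int_psum)
  also have "\<dots> = of_real ((LINT x|M. (cmod (f x))\<^sup>2) - (\<Sum>k\<in>K. (cmod (fcoef L f k))\<^sup>2))"
    unfolding 2 of_real_integral_norm2[symmetric] by (simp add: complex_norm_square[symmetric])
  finally show ?thesis by (simp only: of_real_eq_iff)
qed

lemma bessel:
  assumes "sq_int L f" "finite K"
  shows "(\<Sum>k\<in>K. (cmod (fcoef L f k))\<^sup>2) \<le> (LINT x|M. (cmod (f x))\<^sup>2)"
proof -
  have "0 \<le> (LINT x|M. (cmod (f x - psum L K (fcoef L f) x))\<^sup>2)"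
    by (intro integral_nonneg_AE) auto
  then show ?thesis using bessel_identity[OF assms] by linarith
qed

lemma fcoef_square_summable:
  assumes "sq_int L f" shows "(\<lambda>k. (cmod (fcoef L f k))\<^sup>2) summable_on UNIV"
  by (rule nonneg_bdd_above_summable_on) (auto intro!: bdd_aboveI bessel assms)

lemma norm_psum2:
  assumes "finite K"
  shows "(LINT x|M. (cmod (psum L K a x))\<^sup>2) = (\<Sum>k\<in>K. (cmod (a k))\<^sup>2)"
proof -
  have "psum L K (fcoef L (psum L K a)) x = psum L K a x" for x
    unfolding psum_def[of _ _ _ x] by (intro sum.cong) (auto simp: fcoef_psum assms)
  then show ?thesis
    using bessel_identity[OF sq_int_psum[of K a] assms]
    by (simp add: fcoef_psum assms)
qed

text \<open>The Cauchy--Schwarz inequality against the constant 1, read off from the nonnegative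
  integral of \<open>(|h| - m)\<^sup>2\<close>, where \<open>m\<close> is the mean of
  \<open>|h|\<close>.\<close>

lemma l1_le_l2:
  assumes "sq_int L h"
  shows "(LINT x|M. cmod (h x))\<^sup>2 \<le> vol L * (LINT x|M. (cmod (h x))\<^sup>2)"
proof -
  define m where "m = (LINT x|M. cmod (h x)) / vol L"
  have i1: "integrable M (\<lambda>x. cmod (h x))" using sq_int_integrable[OF assms] by simp
  have i2: "integrable M (\<lambda>x. (cmod (h x))\<^sup>2)" using assms by (simp add: sq_int_def)
  have i3: "integrable M (\<lambda>x. m\<^sup>2)" by (intro integrable_continuous) auto
  have "0 \<le> (LINT x|M. (cmod (h x) - m)\<^sup>2)" by (intro integral_nonneg_AE) auto
  also have "\<dots> = (LINT x|M. (cmod (h x))\<^sup>2 - 2 * m * cmod (h x) + m\<^sup>2)"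
    by (simp add: power2_diff algebra_simps)
  also have "\<dots> = (LINT x|M. (cmod (h x))\<^sup>2) - 2 * m * (LINT x|M. cmod (h x)) + m\<^sup>2 * vol L"
    using i1 i2 i3 measure_box by simp
  also have "\<dots> = (LINT x|M. (cmod (h x))\<^sup>2) - (LINT x|M. cmod (h x))\<^sup>2 / vol L"
    using vol_pos by (simp add: m_def power2_eq_square field_simps)
  finally show ?thesis using vol_pos by (simp add: field_simps)
qed

text \<open>The partial sums are Cauchy in the mean, because \<open>l1_le_l2\<close> controls the L1
  distance by the tail of the series. A subsequence therefore converges almost everywhere, and
  Fatou's lemma upgrades its limit to an L2 limit of the whole sequence.\<close>

theorem riesz_fischer:
  assumes a: "(\<lambda>k. (cmod (a k))\<^sup>2) summable_on UNIV"
  obtains f where "sq_int L f" "\<And>k. fcoef L f k = a k"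
    "(\<lambda>n. LINT x|M. (cmod (f x - psum L (cube n) a x))\<^sup>2) \<longlonglongrightarrow> 0"
proof -
  define s where "s = (\<lambda>n. psum L (cube n) a)"
  define tail where "tail = (\<lambda>n. (\<Sum>\<^sub>\<infinity>k. (cmod (a k))\<^sup>2) - (\<Sum>k\<in>cube n. (cmod (a k))\<^sup>2))"
  have le: "(\<Sum>k\<in>K. (cmod (a k))\<^sup>2) \<le> (\<Sum>\<^sub>\<infinity>k. (cmod (a k))\<^sup>2)" if "finite K" for K
    using that by (intro finite_sum_le_infsum a) auto
  have "(\<lambda>n. (\<Sum>k\<in>cube n. (cmod (a k))\<^sup>2)) \<longlonglongrightarrow> (\<Sum>\<^sub>\<infinity>k. (cmod (a k))\<^sup>2)"
    by (intro has_sum_cube) (use a in \<open>simp add: has_sum_infsum\<close>)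
  then have "(\<lambda>n. (\<Sum>\<^sub>\<infinity>k. (cmod (a k))\<^sup>2) - (\<Sum>k\<in>cube n. (cmod (a k))\<^sup>2)) \<longlonglongrightarrow> (\<Sum>\<^sub>\<infinity>k. (cmod (a k))\<^sup>2) - (\<Sum>\<^sub>\<infinity>k. (cmod (a k))\<^sup>2)"
    by (intro tendsto_intros)
  then have tail0: "tail \<longlonglongrightarrow> 0" by (simp add: tail_def)
  have tail_pos: "tail n \<ge> 0" for n using le[of "cube n"] by (simp add: tail_def)
  have sq_s: "sq_int L (s n)" for n by (simp add: s_def sq_int_psum)
  have diff: "(LINT x|M. (cmod (s i x - s n x))\<^sup>2) \<le> tail n" if "n \<le> i" for i n
  proof -
    have "s i x - s n x = psum L (cube i - cube n) a x" for x
      unfolding s_def psum_def using cube_mono[OF that] by (subst sum_diff) auto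
    then have "(LINT x|M. (cmod (s i x - s n x))\<^sup>2) = (\<Sum>k\<in>cube i - cube n. (cmod (a k))\<^sup>2)"
      by (simp add: norm_psum2)
    also have "\<dots> \<le> tail n"
      using le[of "cube i"] cube_mono[OF that] by (simp add: tail_def sum_diff)
    finally show ?thesis .
  qed
  have cauchy: "\<exists>N. \<forall>i\<ge>N. \<forall>j\<ge>N. (LINT x|M. norm (s i x - s j x)) < e" if e: "e > 0" for e
  proof -
    have "e\<^sup>2 / vol L > 0" using e vol_pos by simp
    then obtain N where N: "\<And>n. n \<ge> N \<Longrightarrow> tail n < e\<^sup>2 / vol L"
      using order_tendstoD(2)[OF tail0, of "e\<^sup>2 / vol L"] by (auto simp: eventually_sequentially)
    have 1: "(LINT x|M. norm (s i x - s j x)) < e" if "i \<ge> j" "j \<ge> N" for i j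
    proof -
      have "(LINT x|M. norm (s i x - s j x))\<^sup>2 \<le> vol L * (LINT x|M. (cmod (s i x - s j x))\<^sup>2)"
        by (intro l1_le_l2 sq_int_diff sq_s)
      also have "\<dots> \<le> vol L * tail j"
        using diff[OF that(1)] vol_pos by (intro mult_left_mono) auto
      also have "\<dots> < e\<^sup>2" using N[OF that(2)] vol_pos by (simp add: field_simps)
      finally show ?thesis using e by (meson power2_less_imp_less less_imp_le)
    qed
    show ?thesis
    proof (intro exI allI impI)
      fix i j assume "i \<ge> N" "j \<ge> N"
      then show "(LINT x|M. norm (s i x - s j x)) < e"
        using 1[of j i] 1[of i j] by (cases "i \<ge> j") (auto simp: norm_minus_commute)
    qed
  qed
  obtain r where r: "strict_mono r" and rc: "AE x in M. Cauchy (\<lambda>i. s (r i) x)"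
    using cauchy_L1_AE_cauchy_subseq[of M s, OF sq_int_integrable[OF sq_s] cauchy] by blast
  define f where "f = (\<lambda>x. lim (\<lambda>i. s (r i) x))"
  have lim: "AE x in M. (\<lambda>i. s (r i) x) \<longlonglongrightarrow> f x"
    using rc by eventually_elim (simp add: f_def Cauchy_convergent_iff convergent_LIMSEQ_iff)
  have [measurable]: "s n \<in> borel_measurable M" for n using sq_s by measurable
  have [measurable]: "f \<in> borel_measurable M" unfolding f_def by measurable
  \<comment> \<open>Stated with nonnegative integrals because square integrability of
    \<open>f - s n\<close> is not yet known; it is a consequence of this bound.\<close>
  have fatou: "(\<integral>\<^sup>+x. ennreal ((cmod (f x - s n x))\<^sup>2) \<partial>M) \<le> ennreal (tail n)" for n
  proof -
    have "(\<integral>\<^sup>+x. ennreal ((cmod (f x - s n x))\<^sup>2) \<partial>M) = (\<integral>\<^sup>+x. liminf (\<lambda>i. ennreal ((cmod (s (r i) x - s n x))\<^sup>2)) \<partial>M)"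
    proof (rule nn_integral_cong_AE)
      show "AE x in M. ennreal ((cmod (f x - s n x))\<^sup>2) = liminf (\<lambda>i. ennreal ((cmod (s (r i) x - s n x))\<^sup>2))"
        using lim
      proof eventually_elim
        case (elim x)
        have "(\<lambda>i. ennreal ((cmod (s (r i) x - s n x))\<^sup>2)) \<longlonglongrightarrow> ennreal ((cmod (f x - s n x))\<^sup>2)"
          by (intro tendsto_intros elim)
        then show ?case by (intro lim_imp_Liminf[symmetric]) auto
      qed
    qed
    also have "\<dots> \<le> liminf (\<lambda>i. \<integral>\<^sup>+x. ennreal ((cmod (s (r i) x - s n x))\<^sup>2) \<partial>M)"
      by (intro nn_integral_liminf) measurable
    also have "\<dots> \<le> limsup (\<lambda>i. \<integral>\<^sup>+x. ennreal ((cmod (s (r i) x - s n x))\<^sup>2) \<partial>M)"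
      by (intro Liminf_le_Limsup) auto
    also have "\<dots> \<le> ennreal (tail n)"
    proof (rule Limsup_bounded)
      show "\<forall>\<^sub>F i in sequentially. (\<integral>\<^sup>+x. ennreal ((cmod (s (r i) x - s n x))\<^sup>2) \<partial>M) \<le> ennreal (tail n)"
        using eventually_ge_at_top[of n]
      proof eventually_elim
        case (elim i)
        then have "n \<le> r i" using seq_suble[OF r, of i] by simp
        then have "ennreal (LINT x|M. (cmod (s (r i) x - s n x))\<^sup>2) \<le> ennreal (tail n)"
          by (intro ennreal_leI diff)
        also have "ennreal (LINT x|M. (cmod (s (r i) x - s n x))\<^sup>2) = (\<integral>\<^sup>+x. ennreal ((cmod (s (r i) x - s n x))\<^sup>2) \<partial>M)"
          using sq_int_diff[OF sq_s[of "r i"] sq_s[of n]]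
          by (intro nn_integral_eq_integral[symmetric]) (auto simp: sq_int_def)
        finally show ?case .
      qed
    qed
    finally show ?thesis .
  qed
  have sq_d: "sq_int L (\<lambda>x. f x - s n x)" for n
    unfolding sq_int_def
  proof
    show "(\<lambda>x. f x - s n x) \<in> borel_measurable M" by measurable
    show "integrable M (\<lambda>x. (cmod (f x - s n x))\<^sup>2)"
      by (rule integrableI_bounded) (use fatou[of n] in \<open>auto intro: le_less_trans\<close>)
  qed
  have d_le: "(LINT x|M. (cmod (f x - s n x))\<^sup>2) \<le> tail n" for n
  proof -
    have "ennreal (LINT x|M. (cmod (f x - s n x))\<^sup>2) \<le> ennreal (tail n)"
      using fatou[of n] sq_d[of n] by (subst nn_integral_eq_integral[symmetric]) (auto simp: sq_int_def)
    then show ?thesis using tail_pos by (simp add: ennreal_le_iff)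
  qed
  have f: "sq_int L f" using sq_int_add[OF sq_d[of 0] sq_s[of 0]] by simp
  have d0: "(\<lambda>n. LINT x|M. (cmod (f x - s n x))\<^sup>2) \<longlonglongrightarrow> 0"
    by (rule tendsto_sandwich[OF _ _ tendsto_const tail0])
       (auto intro!: always_eventually integral_nonneg_AE d_le)
  have "fcoef L f k = a k" for k
  proof -
    obtain n0 where n0: "k \<in> cube n0" using ex_cube by blast
    \<comment> \<open>Bessel's inequality for the single mode \<open>k\<close>, applied to
      \<open>f - s n\<close>: from \<open>n0\<close> on the coefficient of \<open>s n\<close> is
      exactly \<open>a k\<close>.\<close>
    have "(cmod (fcoef L f k - a k))\<^sup>2 \<le> (LINT x|M. (cmod (f x - s n x))\<^sup>2)" if "n \<ge> n0" for n
    proof -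
      have "k \<in> cube n" using n0 cube_mono[OF that] by blast
      then have "fcoef L (\<lambda>x. f x - s n x) k = fcoef L f k - a k"
        using f sq_s by (simp add: fcoef_diff s_def fcoef_psum sq_int_psum)
      then show ?thesis using bessel[OF sq_d[of n], of "{k}"] by simp
    qed
    then have "(cmod (fcoef L f k - a k))\<^sup>2 \<le> 0"
      by (intro LIMSEQ_le_const[OF d0]) auto
    then show ?thesis by simp
  qed
  then show ?thesis using that f d0 by (simp add: s_def)
qed

lemma fcoef_unique:
  assumes f: "integrable M f" and g: "integrable M g" and eq: "\<And>k. fcoef L f k = fcoef L g k"
  shows "AE x in M. f x = g x"
proof -
  have "annihilates (\<lambda>x. f x - g x)"
    unfolding annihilates_def
  proof (intro conjI allI)
    show "integrable M (\<lambda>x. f x - g x)" using f g by simp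
    fix k
    have "(LINT x|M. (f x - g x) * fmode L k x) = (LINT x|M. f x * cnj (fmode L (- k) x) - g x * cnj (fmode L (- k) x))"
      by (simp add: cnj_fmode left_diff_distrib)
    also have "\<dots> = fcoef L f (- k) - fcoef L g (- k)"
      unfolding fcoef_def
      by (intro Bochner_Integration.integral_diff integrable_mult_bounded f g continuous_intros continuous_fmode)
    finally show "(LINT x|M. (f x - g x) * fmode L k x) = 0" using eq by simp
  qed
  from fourier_complete[OF this] show ?thesis by eventually_elim simp
qed

text \<open>Riesz--Fischer provides some function with the coefficients of \<open>f\<close> whose
  series converges in the mean square; completeness identifies that function with
  \<open>f\<close>.\<close>

lemma fourier_l2_converges:
  assumes f: "sq_int L f"
  shows "(\<lambda>n. LINT x|M. (cmod (f x - psum L (cube n) (fcoef L f) x))\<^sup>2) \<longlonglongrightarrow> 0"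
proof -
  obtain g where g: "sq_int L g" "\<And>k. fcoef L g k = fcoef L f k"
    "(\<lambda>n. LINT x|M. (cmod (g x - psum L (cube n) (fcoef L f) x))\<^sup>2) \<longlonglongrightarrow> 0"
    using riesz_fischer[OF fcoef_square_summable[OF f]] by blast
  have ae: "AE x in M. g x = f x"
    by (intro fcoef_unique sq_int_integrable f g)
  have [measurable]: "g \<in> borel_measurable M" "f \<in> borel_measurable M" "psum L K a \<in> borel_measurable M" for K a
    using f g sq_int_psum by (auto simp: sq_int_def)
  have "(LINT x|M. (cmod (g x - psum L (cube n) (fcoef L f) x))\<^sup>2) = (LINT x|M. (cmod (f x - psum L (cube n) (fcoef L f) x))\<^sup>2)" for n
    by (rule integral_cong_AE, measurable) (use ae in eventually_elim, simp)
  with g(3) show ?thesis by simp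
qed

lemma parseval_norm:
  assumes f: "sq_int L f"
  shows "((\<lambda>k. (cmod (fcoef L f k))\<^sup>2) has_sum (LINT x|M. (cmod (f x))\<^sup>2)) UNIV"
proof -
  have s: "((\<lambda>k. (cmod (fcoef L f k))\<^sup>2) has_sum (\<Sum>\<^sub>\<infinity>k. (cmod (fcoef L f k))\<^sup>2)) UNIV"
    using fcoef_square_summable[OF f] by (simp add: has_sum_infsum)
  have "(\<lambda>n. (LINT x|M. (cmod (f x))\<^sup>2) - (\<Sum>k\<in>cube n. (cmod (fcoef L f k))\<^sup>2)) \<longlonglongrightarrow> 0"
    using fourier_l2_converges[OF f] by (simp add: bessel_identity f)
  then have "(\<lambda>n. (LINT x|M. (cmod (f x))\<^sup>2) - ((LINT x|M. (cmod (f x))\<^sup>2) - (\<Sum>k\<in>cube n. (cmod (fcoef L f k))\<^sup>2)))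
      \<longlonglongrightarrow> (LINT x|M. (cmod (f x))\<^sup>2) - 0"
    by (intro tendsto_intros)
  then have "(\<lambda>n. \<Sum>k\<in>cube n. (cmod (fcoef L f k))\<^sup>2) \<longlonglongrightarrow> (LINT x|M. (cmod (f x))\<^sup>2)" by simp
  from LIMSEQ_unique[OF has_sum_cube[OF s] this] s show ?thesis by (simp only:)
qed

theorem parseval:
  assumes f: "sq_int L f" and g: "sq_int L g"
  shows "((\<lambda>k. fcoef L f k * cnj (fcoef L g k)) has_sum (LINT x|M. f x * cnj (g x))) UNIV"
proof -
  have ig: "sq_int L (\<lambda>x. \<i> * g x)" by (intro sq_int_cmult g)
  note sq = sq_int_add[OF f g] sq_int_diff[OF f g] sq_int_add[OF f ig] sq_int_diff[OF f ig]
  let ?I = "\<lambda>h. complex_of_real (LINT x|M. (cmod (h x))\<^sup>2)"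
  have P: "((\<lambda>k. complex_of_real ((cmod (fcoef L h k))\<^sup>2)) has_sum ?I h) UNIV" if "sq_int L h" for h
    using parseval_norm[OF that] by (rule has_sum_of_real)
  have I: "integrable M (\<lambda>x. complex_of_real ((cmod (h x))\<^sup>2))" if "sq_int L h" for h
    using that unfolding sq_int_def by (intro integrable_of_real) simp
  have J: "?I h = (LINT x|M. complex_of_real ((cmod (h x))\<^sup>2))" for h
    by (rule integral_complex_of_real[symmetric])
  let ?Q = "\<lambda>p q r t. (p + (-1) * q + \<i> * r + (- \<i>) * t) * (1 / 4 :: complex)"
  let ?V = "?Q (?I (\<lambda>x. f x + g x)) (?I (\<lambda>x. f x - g x)) (?I (\<lambda>x. f x + \<i> * g x)) (?I (\<lambda>x. f x - \<i> * g x))"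
  have "((\<lambda>k. ?Q (of_real ((cmod (fcoef L (\<lambda>x. f x + g x) k))\<^sup>2)) (of_real ((cmod (fcoef L (\<lambda>x. f x - g x) k))\<^sup>2))
     (of_real ((cmod (fcoef L (\<lambda>x. f x + \<i> * g x) k))\<^sup>2)) (of_real ((cmod (fcoef L (\<lambda>x. f x - \<i> * g x) k))\<^sup>2)))
     has_sum ?V) UNIV"
    by (intro has_sum_cmult_left has_sum_cmult_right has_sum_add P sq)
  moreover have "?V = (LINT x|M. f x * cnj (g x))"
  proof -
    have "(LINT x|M. f x * cnj (g x)) = (LINT x|M. ?Q (of_real ((cmod (f x + g x))\<^sup>2)) (of_real ((cmod (f x - g x))\<^sup>2))
      (of_real ((cmod (f x + \<i> * g x))\<^sup>2)) (of_real ((cmod (f x - \<i> * g x))\<^sup>2)))"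
      by (simp only: polarisation)
    also have "\<dots> = ?V"
      unfolding J
      by (simp only: Bochner_Integration.integral_mult_left[OF Bochner_Integration.integrable_add[OF Bochner_Integration.integrable_add[OF Bochner_Integration.integrable_add[OF I[OF sq(1)] integrable_mult_right[OF I[OF sq(2)]]] integrable_mult_right[OF I[OF sq(3)]]] integrable_mult_right[OF I[OF sq(4)]]]]
        Bochner_Integration.integral_add[OF I[OF sq(1)] integrable_mult_right[OF I[OF sq(2)]]]
        Bochner_Integration.integral_add[OF Bochner_Integration.integrable_add[OF I[OF sq(1)] integrable_mult_right[OF I[OF sq(2)]]] integrable_mult_right[OF I[OF sq(3)]]]
        Bochner_Integration.integral_add[OF Bochner_Integration.integrable_add[OF Bochner_Integration.integrable_add[OF I[OF sq(1)] integrable_mult_right[OF I[OF sq(2)]]] integrable_mult_right[OF I[OF sq(3)]]] integrable_mult_right[OF I[OF sq(4)]]]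
        Bochner_Integration.integral_mult_right[OF I[OF sq(2)]] Bochner_Integration.integral_mult_right[OF I[OF sq(3)]]
        Bochner_Integration.integral_mult_right[OF I[OF sq(4)]])
    finally show ?thesis by (rule sym)
  qed
  ultimately show ?thesis
    unfolding polarisation by (simp only: fcoef_add[OF f g] fcoef_diff[OF f g] fcoef_add[OF f ig] fcoef_diff[OF f ig] fcoef_cmult)
qed

text \<open>This is Parseval's identity for \<open>f\<close> and
  \<open>h = fmode L k * cnj g\<close>: the coefficients of \<open>h\<close> are the reflected and
  shifted coefficients of \<open>g\<close>, up to the normalisation factor.\<close>

theorem fcoef_mult:
  assumes f: "sq_int L f" and g: "sq_int L g"
  shows "((\<lambda>j. fcoef L f j * fcoef L g (k - j) / of_real (sqrt (vol L))) has_sum fcoef L (\<lambda>x. f x * g x) k) UNIV"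
proof -
  define h where "h = (\<lambda>x. fmode L k x * cnj (g x))"
  have h: "sq_int L h" unfolding h_def by (intro sq_int_mult_fmode sq_int_cnj g)
  have hc: "cnj (fcoef L h j) = fcoef L g (k - j) / of_real (sqrt (vol L))" for j
  proof -
    have "cnj (fcoef L h j) = (LINT x|M. cnj (h x * cnj (fmode L j x)))"
      unfolding fcoef_def by (rule Bochner_Integration.integral_cnj[symmetric])
    also have "\<dots> = (LINT x|M. g x * cnj (fmode L (k - j) x) / of_real (sqrt (vol L)))"
    proof (intro Bochner_Integration.integral_cong refl)
      fix x
      have "cnj (h x * cnj (fmode L j x)) = g x * (fmode L (- k) x * fmode L j x)"
        by (simp add: h_def cnj_fmode)
      also have "fmode L (- k) x * fmode L j x = cnj (fmode L (k - j) x) / of_real (sqrt (vol L))"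
        by (simp add: fmode_mult cnj_fmode)
      finally show "cnj (h x * cnj (fmode L j x)) = g x * cnj (fmode L (k - j) x) / of_real (sqrt (vol L))"
        by simp
    qed
    also have "\<dots> = fcoef L g (k - j) / of_real (sqrt (vol L))"
      by (simp add: fcoef_def)
    finally show ?thesis .
  qed
  have "(LINT x|M. f x * cnj (h x)) = fcoef L (\<lambda>x. f x * g x) k"
    by (simp add: fcoef_def h_def mult_ac)
  with parseval[OF f h] show ?thesis by (simp add: hc)
qed

text \<open>All partial sums obey the bound pointwise, and a subsequence of them converges to
  \<open>f\<close> almost everywhere. With summable coefficients this gives the boundedness that
  makes the advection term square integrable.\<close>

lemma fourier_sup_bound:
  assumes f: "sq_int L f" and s: "(\<lambda>k. cmod (fcoef L f k)) summable_on UNIV"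
  shows "AE x in M. cmod (f x) \<le> (\<Sum>\<^sub>\<infinity>k. cmod (fcoef L f k)) / sqrt (vol L)"
proof -
  let ?s = "\<lambda>n. psum L (cube n) (fcoef L f)"
  have sq: "sq_int L (\<lambda>x. f x - ?s n x)" for n by (intro sq_int_diff f sq_int_psum)
  have up: "(\<lambda>n. sqrt (vol L * (LINT x|M. (cmod (f x - ?s n x))\<^sup>2))) \<longlonglongrightarrow> sqrt (vol L * 0)"
    by (intro tendsto_real_sqrt tendsto_mult tendsto_const fourier_l2_converges f)
  have "(\<lambda>n. LINT x|M. cmod (f x - ?s n x)) \<longlonglongrightarrow> 0"
  proof (rule tendsto_sandwich[OF _ _ tendsto_const up[simplified]])
    show "\<forall>\<^sub>F n in sequentially. 0 \<le> (LINT x|M. cmod (f x - ?s n x))"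
      by (intro always_eventually allI integral_nonneg_AE) auto
    show "\<forall>\<^sub>F n in sequentially. (LINT x|M. cmod (f x - ?s n x)) \<le> sqrt (vol L * (LINT x|M. (cmod (f x - ?s n x))\<^sup>2))"
      by (intro always_eventually allI real_le_rsqrt l1_le_l2 sq)
  qed
  then obtain r where r: "AE x in M. (\<lambda>n. f x - ?s (r n) x) \<longlonglongrightarrow> 0"
    using tendsto_L1_AE_subseq[of M "\<lambda>n x. f x - ?s n x", OF sq_int_integrable[OF sq]] by blast
  have bd: "cmod (?s n x) \<le> (\<Sum>\<^sub>\<infinity>k. cmod (fcoef L f k)) / sqrt (vol L)" for n x
  proof -
    have "cmod (?s n x) \<le> (\<Sum>k\<in>cube n. cmod (fcoef L f k * fmode L k x))"
      unfolding psum_def by (rule norm_sum)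
    also have "\<dots> = (\<Sum>k\<in>cube n. cmod (fcoef L f k)) / sqrt (vol L)"
      by (simp add: norm_mult norm_fmode sum_divide_distrib)
    also have "\<dots> \<le> (\<Sum>\<^sub>\<infinity>k. cmod (fcoef L f k)) / sqrt (vol L)"
      using s vol_pos by (intro divide_right_mono finite_sum_le_infsum) auto
    finally show ?thesis .
  qed
  from r show ?thesis
  proof eventually_elim
    case (elim x)
    have "(\<lambda>n. f x - (f x - ?s (r n) x)) \<longlonglongrightarrow> f x - 0" by (intro tendsto_intros elim)
    then have "(\<lambda>n. cmod (?s (r n) x)) \<longlonglongrightarrow> cmod (f x)" by (intro tendsto_norm) simp
    then show ?case by (rule LIMSEQ_le_const2) (use bd in auto)
  qed
qed

end

section \<open>Weak derivatives in terms of Fourier coefficients\<close>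

text \<open>Test functions in weak derivatives are real, so the real part is taken. For arbitrary
  complex coefficients these functions are closed under partial derivatives, and a single mode with
  a free factor \<open>c\<close> already tests both parts of a coefficient.\<close>

definition trig :: "real^3 \<Rightarrow> (int^3) set \<Rightarrow> (int^3 \<Rightarrow> complex) \<Rightarrow> real^3 \<Rightarrow> real" where
  "trig L K a x = Re (psum L K a x)"

definition dsym :: "real^3 \<Rightarrow> multi_index \<Rightarrow> int^3 \<Rightarrow> complex" where
  "dsym L \<beta> k = (\<Prod>i\<in>UNIV. (\<i> * of_real (wave L k $ i)) ^ \<beta> i)"

lemma has_sum_finite_sum:
  fixes f :: "'i \<Rightarrow> 'a \<Rightarrow> 'b::{comm_monoid_add,topological_comm_monoid_add}"
  assumes "finite I" "\<And>i. i \<in> I \<Longrightarrow> (f i has_sum s i) A"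
  shows "((\<lambda>k. \<Sum>i\<in>I. f i k) has_sum (\<Sum>i\<in>I. s i)) A"
  using assms by (induction I rule: finite_induct) (auto intro: has_sum_add)

section \<open>Partial derivatives of smooth periodic functions and of trigonometric
  polynomials\<close>

lemma axis_zero: "axis j (0::real) = 0"
  by (simp add: vec_eq_iff axis_def)

text \<open>\<open>partial\<close> differentiates at the parameter 0 only. Recentring at
  \<open>h0\<close> gives the derivative along a whole line, as the mean value theorem
  requires.\<close>

lemma partial_has_derivative:
  assumes "f differentiable (at (x + axis j h0))"
  shows "((\<lambda>h. f (x + axis j h)) has_real_derivative partial j f (x + axis j h0)) (at h0)"
proof -
  let ?y = "x + axis j h0"
  have "((\<lambda>h. ?y + h *\<^sub>R axis j 1) has_derivative (\<lambda>h. h *\<^sub>R axis j 1)) (at 0)"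
    by (auto intro!: derivative_eq_intros)
  moreover have "(\<lambda>h. ?y + axis j h) = (\<lambda>h. ?y + h *\<^sub>R axis j 1)"
    by (simp add: fun_eq_iff vec_eq_iff axis_def)
  ultimately have "(\<lambda>h. ?y + axis j h) differentiable (at 0)"
    by (simp only: differentiableI)
  moreover have "f differentiable (at (?y + axis j 0))"
    using assms by (simp add: axis_zero)
  ultimately have "(\<lambda>h. f (?y + axis j h)) differentiable (at 0)"
    using differentiable_chain_at[of "\<lambda>h. ?y + axis j h" 0 f] by (simp add: o_def)
  then have "((\<lambda>h. f (?y + axis j h)) has_real_derivative partial j f ?y) (at 0)"
    unfolding partial_def by (simp only: DERIV_deriv_iff_real_differentiable)
  moreover have "?y + axis j h = x + axis j (h + h0)" for h
    by (simp add: vec_eq_iff axis_def)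
  ultimately have "((\<lambda>h. f (x + axis j (h + h0))) has_real_derivative partial j f ?y) (at 0)"
    by (simp only:)
  then show ?thesis
    using DERIV_shift[of "\<lambda>h. f (x + axis j h)" "partial j f ?y" 0 h0] by (simp only: add_0)
qed

lemma partial_eqI:
  assumes "((\<lambda>h. f (x + axis j h)) has_real_derivative D) (at 0)"
  shows "partial j f x = D"
  unfolding partial_def by (rule DERIV_imp_deriv[OF assms])

lemma partial_has_derivative_0:
  assumes "f differentiable (at x)"
  shows "((\<lambda>h. f (x + axis j h)) has_real_derivative partial j f x) (at 0)"
  using partial_has_derivative[of f x j 0] assms by (simp add: axis_zero)

lemma partial_mult:
  assumes "f differentiable (at x)" "g differentiable (at x)"
  shows "partial j (\<lambda>x. f x * g x) x = partial j f x * g x + f x * partial j g x"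
proof (rule partial_eqI)
  show "((\<lambda>h. f (x + axis j h) * g (x + axis j h)) has_real_derivative
    partial j f x * g x + f x * partial j g x) (at 0)"
    using DERIV_mult[OF partial_has_derivative_0[OF assms(1)] partial_has_derivative_0[OF assms(2)], of j j]
    by (simp add: axis_zero algebra_simps)
qed

lemma smooth_differentiable: "smooth f \<Longrightarrow> f differentiable (at x)"
  unfolding smooth_def by (metis foldr.simps(1) id_apply)

lemma smooth_partial: "smooth f \<Longrightarrow> smooth (partial j f)"
  unfolding smooth_def
proof (intro allI)
  fix js x assume "\<forall>js x. foldr partial js f differentiable (at x)"
  then have "foldr partial (js @ [j]) f differentiable (at x)" by blast
  then show "foldr partial js (partial j f) differentiable (at x)" by simp
qed

lemma smooth_continuous: "smooth f \<Longrightarrow> continuous_on S f"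
  by (intro differentiable_imp_continuous_on differentiable_at_imp_differentiable_on smooth_differentiable)

lemma smooth_partial_iter: "smooth f \<Longrightarrow> smooth ((partial j ^^ n) f)"
  by (induction n) (auto intro: smooth_partial)

lemma periodic_partial: "periodic L f \<Longrightarrow> periodic L (partial j f)"
  unfolding periodic_def partial_def
proof (intro allI)
  fix i x assume "\<forall>i x. f (x + axis i (L $ i)) = f x"
  then have "f (x + axis i (L $ i) + axis j h) = f (x + axis j h)" for h
    by (metis add.assoc add.commute)
  then show "deriv (\<lambda>h. f (x + axis i (L $ i) + axis j h)) 0 = deriv (\<lambda>h. f (x + axis j h)) 0"
    by (simp only:)
qed

lemma periodic_partial_iter: "periodic L f \<Longrightarrow> periodic L ((partial j ^^ n) f)"
  by (induction n) (auto intro: periodic_partial)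

lemma fmode_has_derivative:
  "((\<lambda>h. fmode L k (x + axis j h)) has_vector_derivative \<i> * of_real (wave L k $ j) * fmode L k x) (at 0)"
proof -
  have 1: "fmode L k (x + axis j h) = cis (wave L k \<bullet> x + h * wave L k $ j) / of_real (sqrt (vol L))" for h
    by (simp add: fmode_def inner_add_right inner_axis mult.commute)
  have "((\<lambda>h. cis (wave L k \<bullet> x + h * wave L k $ j)) has_vector_derivative
      (wave L k $ j) *\<^sub>R (\<i> * cis (wave L k \<bullet> x + 0 * wave L k $ j))) (at 0)"
    unfolding has_vector_derivative_complex_iff
    by (auto intro!: derivative_eq_intros simp: mult.commute)
  then show ?thesis
    unfolding 1
    by (auto intro!: derivative_eq_intros simp: fmode_def scaleR_conv_of_real divide_inverse)
qed

lemma trig_differentiable: "trig L K a differentiable (at x)"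
proof -
  have eq: "trig L K a = (\<lambda>x. \<Sum>k\<in>K. (Re (a k) * cos (wave L k \<bullet> x) - Im (a k) * sin (wave L k \<bullet> x)) * (1 / sqrt (vol L)))"
    by (auto simp: trig_def psum_def fmode_def Re_divide_of_real)
  have cs: "(\<lambda>x. cos (w \<bullet> x)) differentiable (at x)" "(\<lambda>x. sin (w \<bullet> x)) differentiable (at x)" for w x :: "real^3"
    by (auto intro!: differentiableI derivative_eq_intros)
  show ?thesis
  proof (cases "finite K")
    case True
    then show ?thesis unfolding eq
      by (intro differentiable_sum ballI differentiable_mult differentiable_diff differentiable_const cs)
  next
    case False
    show ?thesis unfolding eq sum.infinite[OF False] by (rule differentiable_const)
  qed
qed

lemma partial_trig:
  "partial j (trig L K a) = trig L K (\<lambda>k. \<i> * of_real (wave L k $ j) * a k)"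
proof
  fix x
  show "partial j (trig L K a) x = trig L K (\<lambda>k. \<i> * of_real (wave L k $ j) * a k) x"
  proof (rule partial_eqI)
    have "((\<lambda>h. psum L K a (x + axis j h)) has_vector_derivative
       psum L K (\<lambda>k. \<i> * of_real (wave L k $ j) * a k) x) (at 0)"
      unfolding psum_def
    proof -
      have "((\<lambda>h. \<Sum>k\<in>K. a k * fmode L k (x + axis j h)) has_vector_derivative
          (\<Sum>k\<in>K. a k * (\<i> * of_real (wave L k $ j) * fmode L k x))) (at 0)"
        by (intro has_vector_derivative_sum has_vector_derivative_mult_right fmode_has_derivative)
      then show "((\<lambda>h. \<Sum>k\<in>K. a k * fmode L k (x + axis j h)) has_vector_derivative
          (\<Sum>k\<in>K. \<i> * of_real (wave L k $ j) * a k * fmode L k x)) (at 0)"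
        by (simp add: mult_ac)
    qed
    then show "((\<lambda>h. trig L K a (x + axis j h)) has_real_derivative
       trig L K (\<lambda>k. \<i> * of_real (wave L k $ j) * a k) x) (at 0)"
      unfolding trig_def by (simp add: has_vector_derivative_complex_iff)
  qed
qed

lemma smooth_trig: "smooth (trig L K a)"
proof -
  have ex: "\<exists>b. foldr partial js (trig L K a) = trig L K b" for js
  proof (induction js)
    case (Cons j js)
    then obtain b where "foldr partial js (trig L K a) = trig L K b" ..
    then have "foldr partial (j # js) (trig L K a) = trig L K (\<lambda>k. \<i> * of_real (wave L k $ j) * b k)"
      by (simp add: partial_trig)
    then show ?case by (intro exI)
  qed (auto intro: exI[of _ a])
  show ?thesis
    unfolding smooth_def
  proof (intro allI)
    fix js x
    from ex[of js] obtain b where b: "foldr partial js (trig L K a) = trig L K b" ..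
    show "foldr partial js (trig L K a) differentiable (at x)"
      unfolding b by (rule trig_differentiable)
  qed
qed

lemma partial_iter_trig:
  "(partial j ^^ n) (trig L K a) = trig L K (\<lambda>k. (\<i> * of_real (wave L k $ j)) ^ n * a k)"
  by (induction n) (simp_all add: partial_trig mult.assoc)

lemma dsym_3: "dsym L \<beta> k = (\<i> * of_real (wave L k $ 1)) ^ \<beta> 1 *
   ((\<i> * of_real (wave L k $ 2)) ^ \<beta> 2 * (\<i> * of_real (wave L k $ 3)) ^ \<beta> 3)"
proof -
  have "(\<Prod>i\<in>UNIV. f i) = f 1 * (f 2 * f 3)" for f :: "3 \<Rightarrow> complex"
    unfolding UNIV_3 by (simp add: ac_simps)
  then show ?thesis unfolding dsym_def .
qed

lemma classical_D_trig: "classical_D \<beta> (trig L K a) = trig L K (\<lambda>k. dsym L \<beta> k * a k)"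
  unfolding classical_D_def partial_iter_trig dsym_3 mult.assoc ..

lemma dsym_minus: "dsym L \<beta> (- k) = cnj (dsym L \<beta> k)"
  by (simp add: dsym_3 wave_minus)

lemma cnj_dsym: "cnj (dsym L \<beta> k) = (-1) ^ mi_order \<beta> * dsym L \<beta> k"
proof -
  have "cnj (dsym L \<beta> k) = (\<Prod>i\<in>UNIV. (-1) ^ \<beta> i * (\<i> * of_real (wave L k $ i)) ^ \<beta> i)"
    by (simp add: dsym_def flip: power_mult_distrib)
  also have "\<dots> = (-1) ^ mi_order \<beta> * dsym L \<beta> k"
    by (simp add: prod.distrib dsym_def mi_order_def power_sum)
  finally show ?thesis .
qed

context periodic_box
begin

lemma periodic_trig: "periodic L (trig L K a)"
  using periodic_fmode unfolding periodic_def trig_def psum_def by simp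

text \<open>Every difference quotient has integral zero because integrals of periodic functions are
  invariant under shifts. Dominated convergence carries this over to the derivative and so replaces
  the fundamental theorem and Fubini.\<close>

lemma integral_partial_zero:
  assumes d: "\<And>x. f differentiable (at x)" and c: "continuous_on UNIV (partial j f)" and per: "periodic L f"
  shows "(LINT x|M. partial j f x) = 0"
proof -
  have fc: "continuous_on UNIV f"
    by (intro differentiable_imp_continuous_on differentiable_at_imp_differentiable_on d)
  have fi: "integrable M f" by (rule integrable_continuous[OF fc])
  \<comment> \<open>With \<open>n + 2\<close> in the denominator every step is smaller than the
    period, also for \<open>n = 0\<close>, as \<open>integral_translate\<close> demands.\<close>
  define h where "h = (\<lambda>n. L $ j / (real n + 2))"
  have Lj: "L $ j > 0" by (rule side_pos)
  have h0: "h n > 0" for n using Lj by (simp add: h_def)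
  have h1: "h n < L $ j" for n using Lj by (simp add: h_def field_simps add_pos_nonneg)
  have hlim: "h \<longlonglongrightarrow> 0" unfolding h_def by real_asymp
  have hat: "filterlim h (at 0) sequentially"
    unfolding filterlim_at using hlim h0 by (auto simp: less_imp_neq[symmetric])
  define s where "s = (\<lambda>n x. (f (x + axis j (h n)) - f x) / h n)"
  have sc: "continuous_on UNIV (\<lambda>x. f (x + axis j c))" for c
    by (intro continuous_on_compose2[OF fc] continuous_intros) auto
  have s0: "(LINT x|M. s n x) = 0" for n
    unfolding s_def
    using integral_translate[OF fc per h0[of n] h1[of n]] integrable_continuous[OF sc, of "h n"] fi by simp
  \<comment> \<open>The intermediate points of the mean value theorem may leave the box, but by less
    than one period, so the doubled box contains them.\<close>
  have "compact (partial j f ` cbox 0 (2 *\<^sub>R L))"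
    by (intro compact_continuous_image continuous_on_subset[OF c]) auto
  then obtain B where B: "\<And>x. x \<in> cbox 0 (2 *\<^sub>R L) \<Longrightarrow> \<bar>partial j f x\<bar> \<le> B"
    using compact_imp_bounded by (force simp: bounded_iff)
  have "(\<lambda>n. LINT x|M. s n x) \<longlonglongrightarrow> (LINT x|M. partial j f x)"
  proof (rule integral_dominated_convergence)
    show "partial j f \<in> borel_measurable M" by (rule measurable_continuous[OF c])
    show "s n \<in> borel_measurable M" for n
      unfolding s_def divide_inverse by (intro measurable_continuous continuous_intros sc fc)
    show "integrable M (\<lambda>x. B)" by (intro integrable_continuous) auto
    show "AE x in M. (\<lambda>n. s n x) \<longlonglongrightarrow> partial j f x"
    proof (intro AE_I2)
      fix x
      have "((\<lambda>y. (f (x + axis j (0 + y)) - f (x + axis j 0)) / y) \<longlongrightarrow> partial j f x) (at 0)"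
        using partial_has_derivative_0[OF d, of x j] by (simp add: DERIV_def)
      from filterlim_compose[OF this hat] show "(\<lambda>n. s n x) \<longlonglongrightarrow> partial j f x"
        by (simp add: s_def axis_zero)
    qed
    show "AE x in M. norm (s n x) \<le> B" for n
    proof (intro AE_I2)
      fix x assume "x \<in> space M"
      then have x: "\<And>i. 0 < x $ i \<and> x $ i < L $ i" by (simp add: mem_box0)
      obtain z where z: "0 < z" "z < h n" "f (x + axis j (h n)) - f (x + axis j 0) = (h n - 0) * partial j f (x + axis j z)"
        using MVT2[of 0 "h n" "\<lambda>y. f (x + axis j y)" "\<lambda>y. partial j f (x + axis j y)"] h0[of n]
          partial_has_derivative[OF d] by blast
      have "x + axis j z \<in> cbox 0 (2 *\<^sub>R L)"
        unfolding mem_box_cart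
      proof (intro allI conjI)
        fix i
        show "0 $ i \<le> (x + axis j z) $ i" using x[of i] z by (simp add: axis_def)
        show "(x + axis j z) $ i \<le> (2 *\<^sub>R L) $ i" using x[of i] x[of j] z h1[of n] by (auto simp: axis_def)
      qed
      then have "\<bar>partial j f (x + axis j z)\<bar> \<le> B" by (rule B)
      moreover have "s n x = partial j f (x + axis j z)"
        using z(3) h0[of n] by (simp add: s_def axis_zero)
      ultimately show "norm (s n x) \<le> B" by simp
    qed
  qed
  then show ?thesis by (simp add: s0 LIMSEQ_const_iff)
qed

abbreviation "rcoef f \<equiv> fcoef L (\<lambda>x. complex_of_real (f x))"

lemma sq_int_smooth: "smooth f \<Longrightarrow> sq_int L (\<lambda>x. complex_of_real (f x))"
  by (intro sq_int_continuous continuous_intros smooth_continuous)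

text \<open>Real test functions see a complex coefficient only through real parts of its multiples;
  the factors 1 and i recover it.\<close>

lemma complex_eq_Re_mult:
  assumes "\<And>c. Re (c * z) = Re (c * w)" shows "z = w"
  using assms[of 1] assms[of "\<i>"] by (simp add: complex_eq_iff)

lemma integral_Re_cmult:
  assumes "sq_int L (\<lambda>x. complex_of_real (f x))"
  shows "(LINT x|M. f x * Re (c * fmode L k x)) = Re (c * cnj (rcoef f k))"
proof -
  have i: "integrable M (\<lambda>x. complex_of_real (f x) * fmode L k x)"
    by (intro sq_int_mult_integrable assms sq_int_fmode)
  have "cnj (rcoef f k) = (LINT x|M. cnj (complex_of_real (f x) * cnj (fmode L k x)))"
    unfolding fcoef_def by (rule Bochner_Integration.integral_cnj[symmetric])
  then have "c * cnj (rcoef f k) = (LINT x|M. c * (complex_of_real (f x) * fmode L k x))"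
    by simp
  also have "Re \<dots> = (LINT x|M. Re (c * (complex_of_real (f x) * fmode L k x)))"
    by (rule integral_Re[symmetric]) (intro integrable_mult_right i)
  also have "\<dots> = (LINT x|M. f x * Re (c * fmode L k x))"
    by (intro Bochner_Integration.integral_cong) (auto simp: algebra_simps)
  finally show ?thesis ..
qed

lemma Re_cmult_fmode: "Re (c * fmode L k x) = trig L {k} (\<lambda>_. c) x"
  by (simp add: trig_def psum_def)

text \<open>Integration by parts against the real test functions
  \<open>Re (c * fmode L k x)\<close>: the product with \<open>f\<close> is periodic, so its
  derivative integrates to zero.\<close>

lemma rcoef_partial:
  assumes f: "smooth f" and per: "periodic L f"
  shows "rcoef (partial j f) k = \<i> * of_real (wave L k $ j) * rcoef f k"
proof -
  have "Re (c * cnj (rcoef (partial j f) k)) = Re (c * cnj (\<i> * of_real (wave L k $ j) * rcoef f k))" for c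
  proof -
    let ?q = "trig L {k} (\<lambda>_. c)" and ?q' = "trig L {k} (\<lambda>_. \<i> * of_real (wave L k $ j) * c)"
    have q: "smooth ?q" "smooth ?q'" by (rule smooth_trig)+
    have q': "partial j ?q = ?q'" by (auto simp: partial_trig trig_def psum_def)
    have p: "partial j (\<lambda>x. f x * ?q x) = (\<lambda>x. partial j f x * ?q x + f x * ?q' x)"
      by (rule ext, subst partial_mult) (auto intro: smooth_differentiable f q simp: q')
    have "(LINT x|M. partial j (\<lambda>x. f x * ?q x) x) = 0"
    proof (rule integral_partial_zero)
      show "(\<lambda>x. f x * ?q x) differentiable (at x)" for x
        by (intro derivative_intros smooth_differentiable f q)
      show "continuous_on UNIV (partial j (\<lambda>x. f x * ?q x))"
        unfolding p by (intro continuous_intros smooth_continuous f q smooth_partial)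
      show "periodic L (\<lambda>x. f x * ?q x)"
        using per periodic_trig by (simp add: periodic_def)
    qed
    then have "0 = (LINT x|M. partial j f x * ?q x + f x * ?q' x)" by (simp add: p)
    also have "\<dots> = (LINT x|M. partial j f x * ?q x) + (LINT x|M. f x * ?q' x)"
      by (intro Bochner_Integration.integral_add integrable_continuous continuous_intros smooth_continuous f q smooth_partial)
    finally have "(LINT x|M. partial j f x * ?q x) = - (LINT x|M. f x * ?q' x)" by simp
    then have "Re (c * cnj (rcoef (partial j f) k)) = - Re (\<i> * of_real (wave L k $ j) * c * cnj (rcoef f k))"
      unfolding Re_cmult_fmode[symmetric] by (simp only: integral_Re_cmult sq_int_smooth f smooth_partial)
    then show ?thesis by (simp add: algebra_simps)
  qed
  then have "cnj (rcoef (partial j f) k) = cnj (\<i> * of_real (wave L k $ j) * rcoef f k)"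
    by (rule complex_eq_Re_mult)
  then show ?thesis by (simp only: complex_cnj_cancel_iff)
qed

lemma rcoef_partial_iter:
  assumes f: "smooth f" "periodic L f"
  shows "rcoef ((partial j ^^ n) f) k = (\<i> * of_real (wave L k $ j)) ^ n * rcoef f k"
proof (induction n)
  case (Suc n)
  have "rcoef ((partial j ^^ Suc n) f) k = rcoef (partial j ((partial j ^^ n) f)) k" by simp
  also have "\<dots> = \<i> * of_real (wave L k $ j) * rcoef ((partial j ^^ n) f) k"
    by (intro rcoef_partial smooth_partial_iter periodic_partial_iter f)
  finally show ?case using Suc by simp
qed simp

lemma smooth_classical_D: "smooth f \<Longrightarrow> smooth (classical_D \<beta> f)"
  unfolding classical_D_def by (intro smooth_partial_iter)

lemma rcoef_classical_D:
  assumes f: "smooth f" "periodic L f"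
  shows "rcoef (classical_D \<beta> f) k = dsym L \<beta> k * rcoef f k"
  unfolding classical_D_def dsym_3
  by (simp add: rcoef_partial_iter smooth_partial_iter periodic_partial_iter f mult.assoc)

end

section \<open>Coefficients of vector fields and the multiplier form of weak derivatives\<close>

definition vcoef :: "real^3 \<Rightarrow> vector_field \<Rightarrow> int^3 \<Rightarrow> complex^3" where
  "vcoef L u k = (\<chi> i. fcoef L (\<lambda>x. complex_of_real (u x $ i)) k)"

lemma norm_smult: "norm (c *s (v :: complex^3)) = cmod c * norm v"
proof -
  have "(norm (c *s v))\<^sup>2 = (cmod c * norm v)\<^sup>2"
    unfolding power2_norm_eq_inner power_mult_distrib
    by (simp add: inner_vec_def norm_mult power_mult_distrib sum_distrib_left flip: power2_norm_eq_inner)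
  then show ?thesis by (simp add: power2_eq_iff_nonneg)
qed

context periodic_box
begin

lemma square_integrable_iff:
  "square_integrable L u \<longleftrightarrow> (\<forall>i. sq_int L (\<lambda>x. complex_of_real (u x $ i)))"
proof
  assume u: "square_integrable L u"
  show "\<forall>i. sq_int L (\<lambda>x. complex_of_real (u x $ i))"
  proof
    fix i
    have [measurable]: "u \<in> borel_measurable M" using u by (simp add: square_integrable_def)
    have [measurable]: "(\<lambda>x. u x $ i) \<in> borel_measurable M"
      by (rule borel_measurable_continuous_on[OF continuous_on_component]) (auto intro: continuous_on_id)
    show "sq_int L (\<lambda>x. complex_of_real (u x $ i))"
      unfolding sq_int_def
    proof
      show "(\<lambda>x. complex_of_real (u x $ i)) \<in> borel_measurable M" by measurable
      show "integrable M (\<lambda>x. (cmod (complex_of_real (u x $ i)))\<^sup>2)"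
      proof (rule Bochner_Integration.integrable_bound)
        show "integrable M (\<lambda>x. (norm (u x))\<^sup>2)" using u by (simp add: square_integrable_def)
        show "(\<lambda>x. (cmod (complex_of_real (u x $ i)))\<^sup>2) \<in> borel_measurable M" by measurable
        show "AE x in M. norm ((cmod (complex_of_real (u x $ i)))\<^sup>2) \<le> norm ((norm (u x))\<^sup>2)"
          using component_le_norm_cart[of _ i] by (intro AE_I2) (simp add: abs_le_square_iff[symmetric])
      qed
    qed
  qed
next
  assume u: "\<forall>i. sq_int L (\<lambda>x. complex_of_real (u x $ i))"
  have m: "(\<lambda>x. u x $ i) \<in> borel_measurable M" for i
  proof -
    have [measurable]: "(\<lambda>x. complex_of_real (u x $ i)) \<in> borel_measurable M"
      using u by (simp add: sq_int_def)
    have "(\<lambda>x. Re (complex_of_real (u x $ i))) \<in> borel_measurable M" by measurable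
    then show ?thesis by simp
  qed
  show "square_integrable L u"
    unfolding square_integrable_def
  proof
    show "u \<in> borel_measurable M"
    proof (rule iffD2[OF borel_measurable_euclidean_space], rule ballI)
      fix b :: "real^3" assume "b \<in> Basis"
      then obtain i where "b = axis i 1" by (auto simp: Basis_vec_def)
      then show "(\<lambda>x. u x \<bullet> b) \<in> borel_measurable M" using m[of i] by (simp add: inner_axis)
    qed
    have "(norm (u x))\<^sup>2 = (\<Sum>i\<in>UNIV. u x $ i * u x $ i)" for x
      by (simp only: power2_norm_eq_inner inner_vec_def inner_real_def)
    then have "(norm (u x))\<^sup>2 = (\<Sum>i\<in>UNIV. (cmod (complex_of_real (u x $ i)))\<^sup>2)" for x
      by (simp add: power2_eq_square)
    moreover have "integrable M (\<lambda>x. \<Sum>i\<in>UNIV. (cmod (complex_of_real (u x $ i)))\<^sup>2)"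
      using u by (intro Bochner_Integration.integrable_sum) (auto simp: sq_int_def)
    ultimately show "integrable M (\<lambda>x. (norm (u x))\<^sup>2)"
      by (simp only:)
  qed
qed

lemma sq_int_component: "square_integrable L u \<Longrightarrow> sq_int L (\<lambda>x. complex_of_real (u x $ i))"
  by (simp add: square_integrable_iff)

lemma square_integrable_lin:
  assumes "square_integrable L u" "square_integrable L v"
  shows "square_integrable L (\<lambda>x. a *\<^sub>R u x + b *\<^sub>R v x)"
  unfolding square_integrable_iff using assms
  by (auto intro!: sq_int_add sq_int_cmult sq_int_component)

lemma square_integrable_diff:
  assumes "square_integrable L u" "square_integrable L v"
  shows "square_integrable L (\<lambda>x. u x - v x)"
  using square_integrable_lin[OF assms, of 1 "-1"] by simp

lemma vcoef_lin:
  assumes "square_integrable L u" "square_integrable L v"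
  shows "vcoef L (\<lambda>x. a *\<^sub>R u x + b *\<^sub>R v x) k = a *\<^sub>R vcoef L u k + b *\<^sub>R vcoef L v k"
  using assms
  by (simp add: vcoef_def vec_eq_iff fcoef_add fcoef_cmult sq_int_cmult sq_int_component scaleR_conv_of_real[where 'a=complex])

lemma vcoef_diff:
  assumes "square_integrable L u" "square_integrable L v"
  shows "vcoef L (\<lambda>x. u x - v x) k = vcoef L u k - vcoef L v k"
  using vcoef_lin[OF assms, of 1 "-1" k] by simp

lemma vcoef_minus_index: "vcoef L u (- k) $ i = cnj (vcoef L u k $ i)"
  using fcoef_cnj[of "\<lambda>x. complex_of_real (u x $ i)" "- k"] by (simp add: vcoef_def)

lemma vcoef_AE_cong:
  assumes "square_integrable L u" "square_integrable L v" "AE x in M. u x = v x"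
  shows "vcoef L u k = vcoef L v k"
  unfolding vcoef_def vec_eq_iff vec_lambda_beta
proof
  fix i
  show "rcoef (\<lambda>x. u x $ i) k = rcoef (\<lambda>x. v x $ i) k"
    by (rule fcoef_AE_cong)
      (use assms sq_int_component[of u i] sq_int_component[of v i] in \<open>auto simp: sq_int_def\<close>)
qed

lemma vcoef_unique:
  assumes u: "square_integrable L u" and v: "square_integrable L v" and eq: "\<And>k. vcoef L u k = vcoef L v k"
  shows "AE x in M. u x = v x"
proof -
  have "AE x in M. complex_of_real (u x $ i) = complex_of_real (v x $ i)" for i
    using eq by (intro fcoef_unique sq_int_integrable sq_int_component u v) (simp add: vcoef_def vec_eq_iff)
  then have "AE x in M. \<forall>i\<in>UNIV. complex_of_real (u x $ i) = complex_of_real (v x $ i)"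
    by (intro AE_finite_allI) auto
  then show ?thesis by eventually_elim (simp add: vec_eq_iff)
qed

lemma vparseval:
  assumes u: "square_integrable L u" and v: "square_integrable L v"
  shows "((\<lambda>k. vcoef L u k \<bullet> vcoef L v k) has_sum l2_inner L u v) UNIV"
proof -
  have s: "((\<lambda>k. vcoef L u k $ i \<bullet> vcoef L v k $ i) has_sum (LINT x|M. u x $ i * v x $ i)) UNIV" for i
  proof -
    let ?f = "\<lambda>x. complex_of_real (u x $ i)" and ?g = "\<lambda>x. complex_of_real (v x $ i)"
    have "((\<lambda>k. Re (fcoef L ?f k * cnj (fcoef L ?g k))) has_sum Re (LINT x|M. ?f x * cnj (?g x))) UNIV"
      by (intro has_sum_Re parseval sq_int_component u v)
    moreover have "(LINT x|M. ?f x * cnj (?g x)) = complex_of_real (LINT x|M. u x $ i * v x $ i)"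
      unfolding integral_complex_of_real[symmetric] by simp
    ultimately show ?thesis by (simp add: vcoef_def inner_complex_def)
  qed
  have i: "integrable M (\<lambda>x. u x $ i * v x $ i)" for i
  proof -
    have "integrable M (\<lambda>x. Re (complex_of_real (u x $ i) * complex_of_real (v x $ i)))"
      by (intro integrable_Re sq_int_mult_integrable sq_int_component u v)
    then show ?thesis by simp
  qed
  have "l2_inner L u v = (\<Sum>i\<in>UNIV. LINT x|M. u x $ i * v x $ i)"
    unfolding l2_inner_def inner_vec_def using i by simp
  moreover have "((\<lambda>k. \<Sum>i\<in>UNIV. vcoef L u k $ i \<bullet> vcoef L v k $ i) has_sum (\<Sum>i\<in>UNIV. LINT x|M. u x $ i * v x $ i)) UNIV"
    by (intro has_sum_finite_sum s) auto
  ultimately show ?thesis by (simp add: inner_vec_def)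
qed

lemma l2_norm_inner: "(l2_norm L u)\<^sup>2 = l2_inner L u u"
proof -
  have "0 \<le> (LINT x|M. (norm (u x))\<^sup>2)" by (intro integral_nonneg_AE) auto
  then show ?thesis by (simp add: l2_norm_def l2_inner_def power2_norm_eq_inner)
qed

lemma vparseval_norm:
  assumes "square_integrable L u"
  shows "((\<lambda>k. (norm (vcoef L u k))\<^sup>2) has_sum (l2_norm L u)\<^sup>2) UNIV"
  using vparseval[OF assms assms] by (simp add: l2_norm_inner power2_norm_eq_inner)

text \<open>The symmetry \<open>r\<close> says that the function produced by Riesz--Fischer and its
  conjugate have the same coefficients. By uniqueness it is real almost everywhere, so passing to
  its real part changes it on a null set only.\<close>

lemma vector_synthesis:
  fixes a :: "int^3 \<Rightarrow> complex^3"
  assumes s: "(\<lambda>k. (norm (a k))\<^sup>2) summable_on UNIV" and r: "\<And>k i. a (- k) $ i = cnj (a k $ i)"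
  obtains u where "square_integrable L u" "\<And>k. vcoef L u k = a k"
proof -
  have "\<exists>f. sq_int L (\<lambda>x. complex_of_real (f x)) \<and> (\<forall>k. rcoef f k = a k $ i)" for i
  proof -
    have "(\<lambda>k. (cmod (a k $ i))\<^sup>2) summable_on UNIV"
      by (rule summable_on_comparison_test[OF s]) (auto intro!: power_mono simp: Finite_Cartesian_Product.norm_nth_le)
    then obtain g where g: "sq_int L g" "\<And>k. fcoef L g k = a k $ i"
      using riesz_fischer[of "\<lambda>k. a k $ i"] by blast
    have "AE x in M. cnj (g x) = g x"
      by (intro fcoef_unique sq_int_integrable sq_int_cnj g) (simp add: fcoef_cnj g r)
    then have ae: "AE x in M. g x = complex_of_real (Re (g x))"
      by eventually_elim (simp add: complex_eq_iff)
    have m: "g \<in> borel_measurable M" "(\<lambda>x. complex_of_real (Re (g x))) \<in> borel_measurable M"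
      using g by (auto simp: sq_int_def)
    have "sq_int L (\<lambda>x. complex_of_real (Re (g x)))" by (rule sq_int_AE_cong[OF g(1) m(2) ae])
    moreover have "rcoef (\<lambda>x. Re (g x)) k = a k $ i" for k
      using fcoef_AE_cong[OF m ae] g(2) by simp
    ultimately show ?thesis by (intro exI[of _ "\<lambda>x. Re (g x)"]) blast
  qed
  then obtain f where f: "\<And>i. sq_int L (\<lambda>x. complex_of_real (f i x))" "\<And>i k. rcoef (f i) k = a k $ i"
    by metis
  show ?thesis
  proof (rule that[of "\<lambda>x. \<chi> i. f i x"])
    show "square_integrable L (\<lambda>x. \<chi> i. f i x)" using f(1) by (simp add: square_integrable_iff)
    show "vcoef L (\<lambda>x. \<chi> i. f i x) k = a k" for k using f(2) by (simp add: vcoef_def vec_eq_iff)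
  qed
qed

text \<open>Testing with a single mode extracts each coefficient, since \<open>classical_D\<close>
  only multiplies it by the symbol. Conversely, Parseval sums the coefficient identities against
  those of an arbitrary smooth periodic function. The sign in the definition is the one produced by
  conjugating the symbol. From here on weak derivatives are handled as multipliers, whichever
  representative was chosen.\<close>

lemma has_weak_D_iff:
  assumes u: "square_integrable L u"
  shows "has_weak_D L \<beta> u g \<longleftrightarrow> square_integrable L g \<and> (\<forall>k. vcoef L g k = dsym L \<beta> k *s vcoef L u k)"
proof -
  have comp: "(LINT x|M. f x *\<^sub>R v x) $ i = (LINT x|M. f x * v x $ i)"
    if f: "smooth f" and v: "square_integrable L v" for f and v :: vector_field and i
  proof -
    have "integrable M (\<lambda>x. f x * v x $ i)" for i
    proof -
      have "integrable M (\<lambda>x. Re (complex_of_real (f x) * complex_of_real (v x $ i)))"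
        by (intro integrable_Re sq_int_mult_integrable sq_int_component v sq_int_smooth f)
      then show ?thesis by simp
    qed
    note I = this
    have sum: "f x *\<^sub>R v x = (\<Sum>i\<in>UNIV. (f x * v x $ i) *\<^sub>R axis i 1)" for x
      by (simp add: vec_eq_iff axis_def if_distrib cong: if_cong)
    have "(LINT x|M. f x *\<^sub>R v x) = (\<Sum>i\<in>UNIV. (LINT x|M. f x * v x $ i) *\<^sub>R axis i 1)"
      unfolding sum using I by (subst Bochner_Integration.integral_sum) auto
    then show ?thesis by (simp add: axis_def if_distrib cong: if_cong)
  qed
  show ?thesis
  proof
    assume w: "has_weak_D L \<beta> u g"
    then have g: "square_integrable L g" by (simp add: has_weak_D_def)
    have "cnj (vcoef L g k $ i) = cnj ((dsym L \<beta> k *s vcoef L u k) $ i)" for k i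
    proof (rule complex_eq_Re_mult)
      fix c
      let ?q = "trig L {k} (\<lambda>_. c)"
      have D: "classical_D \<beta> ?q = trig L {k} (\<lambda>_. dsym L \<beta> k * c)"
        by (auto simp: classical_D_trig trig_def psum_def)
      have "(LINT x|M. classical_D \<beta> ?q x *\<^sub>R u x) $ i = ((-1) ^ mi_order \<beta> *\<^sub>R (LINT x|M. ?q x *\<^sub>R g x)) $ i"
        using w smooth_trig periodic_trig by (simp add: has_weak_D_def)
      then have "(LINT x|M. u x $ i * Re (dsym L \<beta> k * c * fmode L k x)) = (-1) ^ mi_order \<beta> * (LINT x|M. g x $ i * Re (c * fmode L k x))"
        using comp[OF smooth_trig[of L "{k}" "\<lambda>_. dsym L \<beta> k * c"] u, of i] comp[OF smooth_trig[of L "{k}" "\<lambda>_. c"] g, of i]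
        unfolding D Re_cmult_fmode by (simp add: mult.commute)
      then have "Re (dsym L \<beta> k * c * cnj (vcoef L u k $ i)) = (-1) ^ mi_order \<beta> * Re (c * cnj (vcoef L g k $ i))"
        by (simp only: integral_Re_cmult[OF sq_int_component[OF u]] integral_Re_cmult[OF sq_int_component[OF g]] vcoef_def vec_lambda_beta)
      then have "Re (c * cnj (vcoef L g k $ i)) = (-1) ^ mi_order \<beta> * Re (dsym L \<beta> k * c * cnj (vcoef L u k $ i))"
        by (simp add: power_mult_distrib[symmetric] flip: mult.assoc)
      also have "\<dots> = Re (c * ((-1) ^ mi_order \<beta> * dsym L \<beta> k * cnj (vcoef L u k $ i)))"
        by (cases "even (mi_order \<beta>)") (simp_all add: algebra_simps)
      finally show "Re (c * cnj (vcoef L g k $ i)) = Re (c * cnj ((dsym L \<beta> k *s vcoef L u k) $ i))"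
        by (simp add: cnj_dsym)
    qed
    then have "vcoef L g k = dsym L \<beta> k *s vcoef L u k" for k
      unfolding vec_eq_iff complex_cnj_cancel_iff by blast
    with g show "square_integrable L g \<and> (\<forall>k. vcoef L g k = dsym L \<beta> k *s vcoef L u k)" by blast
  next
    assume *: "square_integrable L g \<and> (\<forall>k. vcoef L g k = dsym L \<beta> k *s vcoef L u k)"
    then have g: "square_integrable L g" and eq: "\<And>k. vcoef L g k = dsym L \<beta> k *s vcoef L u k" by auto
    show "has_weak_D L \<beta> u g"
      unfolding has_weak_D_def
    proof (intro conjI allI impI g)
      fix \<phi> :: scalar_field assume \<phi>: "smooth \<phi> \<and> periodic L \<phi>"
      show "(LINT x|M. classical_D \<beta> \<phi> x *\<^sub>R u x) = (-1) ^ mi_order \<beta> *\<^sub>R (LINT x|M. \<phi> x *\<^sub>R g x)"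
        unfolding vec_eq_iff
      proof
        fix i
        have P: "((\<lambda>k. rcoef f k * cnj (vcoef L v k $ i)) has_sum complex_of_real (LINT x|M. f x * v x $ i)) UNIV"
          if "smooth f" "square_integrable L v" for f v
        proof -
          have "((\<lambda>k. rcoef f k * cnj (vcoef L v k $ i)) has_sum (LINT x|M. complex_of_real (f x) * cnj (complex_of_real (v x $ i)))) UNIV"
            unfolding vcoef_def vec_lambda_beta by (intro parseval sq_int_smooth sq_int_component that)
          then show ?thesis unfolding integral_complex_of_real[symmetric] by simp
        qed
        have "rcoef (classical_D \<beta> \<phi>) k * cnj (vcoef L u k $ i) = (-1) ^ mi_order \<beta> * (rcoef \<phi> k * cnj (vcoef L g k $ i))" for k
        proof -
          have "cnj (vcoef L g k $ i) = (-1) ^ mi_order \<beta> * dsym L \<beta> k * cnj (vcoef L u k $ i)"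
            by (simp add: eq cnj_dsym)
          then show ?thesis using \<phi>
            by (simp add: rcoef_classical_D power_mult_distrib[symmetric] mult_ac flip: power_add)
        qed
        then have "((\<lambda>k. (-1) ^ mi_order \<beta> * (rcoef \<phi> k * cnj (vcoef L g k $ i))) has_sum complex_of_real (LINT x|M. classical_D \<beta> \<phi> x * u x $ i)) UNIV"
          using P[OF smooth_classical_D u, of \<phi> \<beta>] \<phi> by simp
        moreover have "((\<lambda>k. (-1) ^ mi_order \<beta> * (rcoef \<phi> k * cnj (vcoef L g k $ i))) has_sum (-1) ^ mi_order \<beta> * complex_of_real (LINT x|M. \<phi> x * g x $ i)) UNIV"
          by (intro has_sum_cmult_right P g) (use \<phi> in auto)
        ultimately have "complex_of_real (LINT x|M. classical_D \<beta> \<phi> x * u x $ i) = (-1) ^ mi_order \<beta> * complex_of_real (LINT x|M. \<phi> x * g x $ i)"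
          by (rule has_sum_unique)
        also have "\<dots> = complex_of_real ((-1) ^ mi_order \<beta> * (LINT x|M. \<phi> x * g x $ i))" by simp
        finally have "(LINT x|M. classical_D \<beta> \<phi> x * u x $ i) = (-1) ^ mi_order \<beta> * (LINT x|M. \<phi> x * g x $ i)"
          by (simp only: of_real_eq_iff)
        then show "(LINT x|M. classical_D \<beta> \<phi> x *\<^sub>R u x) $ i = ((-1) ^ mi_order \<beta> *\<^sub>R (LINT x|M. \<phi> x *\<^sub>R g x)) $ i"
          using comp[OF smooth_classical_D u, of \<phi> \<beta> i] comp[OF _ g, of \<phi> i] \<phi> by simp
      qed
    qed
  qed
qed

end

section \<open>Divergence-free Sobolev spaces and the Leray projection\<close>

text \<open>The weight of the squared H^1 norm; its powers are comparable to the exact weights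
  \<open>hw\<close> and easier to estimate.\<close>

definition wt :: "real^3 \<Rightarrow> int^3 \<Rightarrow> real" where
  "wt L k = 1 + (norm (wave L k))\<^sup>2"

definition cdot :: "real^3 \<Rightarrow> complex^3 \<Rightarrow> complex" where
  "cdot \<kappa> z = (\<Sum>i\<in>UNIV. of_real (\<kappa> $ i) * z $ i)"

text \<open>The Leray projector at one frequency. At \<open>\<kappa> = 0\<close> the quotient is 0
  by convention and \<open>pr\<close> is the identity, so the mean value has to be removed
  separately.\<close>

definition pr :: "real^3 \<Rightarrow> complex^3 \<Rightarrow> complex^3" where
  "pr \<kappa> z = z - (cdot \<kappa> z / of_real ((norm \<kappa>)\<^sup>2)) *s (\<chi> i. of_real (\<kappa> $ i))"

definition hw :: "real^3 \<Rightarrow> nat \<Rightarrow> int^3 \<Rightarrow> real" where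
  "hw L m k = (\<Sum>\<beta> | mi_order \<beta> \<le> m. (cmod (dsym L \<beta> k))\<^sup>2)"

lemma wt_ge_1: "wt L k \<ge> 1"
  by (simp add: wt_def)

lemma norm_sq_vec3: "(norm (x :: real^3))\<^sup>2 = (\<Sum>i\<in>UNIV. (x $ i)\<^sup>2)"
  unfolding power2_norm_eq_inner inner_vec_def by (simp add: power2_eq_square)

lemma cdot_add: "cdot \<kappa> (x + y) = cdot \<kappa> x + cdot \<kappa> y"
  by (simp add: cdot_def distrib_left sum.distrib)

lemma cdot_diff: "cdot \<kappa> (x - y) = cdot \<kappa> x - cdot \<kappa> y"
  by (simp add: cdot_def right_diff_distrib sum_subtractf)

lemma cdot_smult: "cdot \<kappa> (c *s x) = c * cdot \<kappa> x"
  by (simp add: cdot_def sum_distrib_left mult_ac)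

lemma cdot_left_diff: "cdot (\<kappa> - \<kappa>') x = cdot \<kappa> x - cdot \<kappa>' x"
  by (simp add: cdot_def left_diff_distrib sum_subtractf)

lemma cdot_left_minus: "cdot (- \<kappa>) x = - cdot \<kappa> x"
  by (simp add: cdot_def sum_negf)

lemma cdot_zero [simp]: "cdot 0 x = 0" "cdot \<kappa> 0 = 0"
  by (simp_all add: cdot_def)

lemma cdot_self: "cdot \<kappa> (\<chi> i. of_real (\<kappa> $ i)) = of_real ((norm \<kappa>)\<^sup>2)"
  unfolding norm_sq_vec3 by (simp add: cdot_def power2_eq_square)

lemma norm_cdot_le: "cmod (cdot \<kappa> x) \<le> norm \<kappa> * norm x"
proof -
  have "cmod (cdot \<kappa> x) \<le> (\<Sum>i\<in>UNIV. \<bar>\<kappa> $ i\<bar> * \<bar>cmod (x $ i)\<bar>)"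
    unfolding cdot_def by (rule order_trans[OF norm_sum]) (simp add: norm_mult)
  also have "\<dots> \<le> L2_set (\<lambda>i. \<kappa> $ i) UNIV * L2_set (\<lambda>i. cmod (x $ i)) UNIV"
    by (rule L2_set_mult_ineq)
  also have "L2_set (\<lambda>i. \<kappa> $ i) UNIV = norm \<kappa>"
    by (simp add: norm_vec_def L2_set_def)
  also have "L2_set (\<lambda>i. cmod (x $ i)) UNIV = norm x"
    by (simp add: norm_vec_def)
  finally show ?thesis .
qed

lemma bounded_linear_cdot: "bounded_linear (cdot \<kappa>)"
proof (rule bounded_linear_intro[where K = "norm \<kappa>"])
  show "cdot \<kappa> (x + y) = cdot \<kappa> x + cdot \<kappa> y" for x y by (rule cdot_add)
  show "cdot \<kappa> (r *\<^sub>R x) = r *\<^sub>R cdot \<kappa> x" for r x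
    by (simp add: cdot_def scaleR_sum_right)
  show "norm (cdot \<kappa> x) \<le> norm x * norm \<kappa>" for x
    using norm_cdot_le[of \<kappa> x] by (simp add: mult.commute)
qed

lemma cdot_pr: "\<kappa> \<noteq> 0 \<Longrightarrow> cdot \<kappa> (pr \<kappa> z) = 0"
  by (simp add: pr_def cdot_diff cdot_smult cdot_self)

lemma inner_smult_real_vec: "(c *s (\<chi> i. of_real (\<kappa> $ i))) \<bullet> w = Re (c * cnj (cdot \<kappa> w))"
  by (simp add: inner_vec_def inner_complex_def cdot_def sum_distrib_left algebra_simps sum.distrib)

text \<open>What the projection removes is parallel to \<open>\<kappa>\<close>, hence orthogonal to
  every \<open>w\<close> with \<open>cdot \<kappa> w = 0\<close>. This is how projections disappear
  when tested with solenoidal fields.\<close>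

lemma pr_inner: "cdot \<kappa> w = 0 \<Longrightarrow> pr \<kappa> z \<bullet> w = z \<bullet> w"
  by (simp add: pr_def inner_diff_left inner_smult_real_vec)

lemma norm_pr_le: "norm (pr \<kappa> z) \<le> norm z"
proof (cases "\<kappa> = 0")
  case True
  then show ?thesis by (simp add: pr_def)
next
  case False
  have "(norm (pr \<kappa> z))\<^sup>2 = z \<bullet> pr \<kappa> z"
    using pr_inner[OF cdot_pr[OF False]] by (simp add: power2_norm_eq_inner)
  also have "\<dots> \<le> norm z * norm (pr \<kappa> z)" by (rule norm_cauchy_schwarz)
  finally have "norm (pr \<kappa> z) * norm (pr \<kappa> z) \<le> norm z * norm (pr \<kappa> z)"
    by (simp add: power2_eq_square)
  then show ?thesis
    by (cases "norm (pr \<kappa> z) = 0") (simp_all add: mult_le_cancel_right)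
qed

lemma pr_minus_cnj:
  assumes "\<And>i. w $ i = cnj (z $ i)" shows "pr (- \<kappa>) w $ i = cnj (pr \<kappa> z $ i)"
proof -
  have "cdot (- \<kappa>) w = - cnj (cdot \<kappa> z)" using assms by (simp add: cdot_def sum_negf)
  then show ?thesis using assms by (simp add: pr_def)
qed

lemma finite_multi_index [simp]: "finite {\<beta>. mi_order \<beta> \<le> m}"
proof -
  have "\<beta> i \<le> m" if "mi_order \<beta> \<le> m" for \<beta> :: multi_index and i
    using member_le_sum[of i UNIV \<beta>] that by (simp add: mi_order_def)
  then have "{\<beta>. mi_order \<beta> \<le> m} \<subseteq> PiE UNIV (\<lambda>_. {..m})"
    by (simp add: subset_iff PiE_UNIV_domain)
  then show ?thesis by (rule finite_subset) (intro finite_PiE; simp)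
qed

lemma dsym_le: "(cmod (dsym L \<beta> k))\<^sup>2 \<le> wt L k ^ mi_order \<beta>"
proof -
  have c: "(wave L k $ i)\<^sup>2 \<le> wt L k" for i
  proof -
    have "(wave L k $ i)\<^sup>2 \<le> (norm (wave L k))\<^sup>2"
      unfolding norm_sq_vec3 by (rule member_le_sum) auto
    then show ?thesis by (simp add: wt_def)
  qed
  have "(cmod (dsym L \<beta> k))\<^sup>2 = (\<Prod>i\<in>UNIV. ((wave L k $ i)\<^sup>2) ^ \<beta> i)"
  proof -
    have "(cmod ((\<i> * of_real (wave L k $ i)) ^ \<beta> i))\<^sup>2 = ((wave L k $ i)\<^sup>2) ^ \<beta> i" for i
      by (metis norm_power norm_mult norm_ii norm_of_real mult_1 power_mult mult.commute power2_abs)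
    then show ?thesis by (simp only: dsym_def prod_norm[symmetric] prod_power_distrib)
  qed
  also have "\<dots> \<le> (\<Prod>i\<in>UNIV. wt L k ^ \<beta> i)"
    by (intro prod_mono) (auto intro!: power_mono c)
  also have "\<dots> = wt L k ^ mi_order \<beta>" by (simp add: mi_order_def power_sum)
  finally show ?thesis .
qed

lemma hw_le: "hw L m k \<le> card {\<beta>. mi_order \<beta> \<le> m} * wt L k ^ m"
proof -
  have "hw L m k \<le> (\<Sum>\<beta> | mi_order \<beta> \<le> m. wt L k ^ m)"
    unfolding hw_def
  proof (rule sum_mono)
    fix \<beta> assume "\<beta> \<in> {\<beta>. mi_order \<beta> \<le> m}"
    then have "wt L k ^ mi_order \<beta> \<le> wt L k ^ m" using wt_ge_1 by (intro power_increasing) auto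
    then show "(cmod (dsym L \<beta> k))\<^sup>2 \<le> wt L k ^ m" using dsym_le order_trans by blast
  qed
  then show ?thesis by simp
qed

lemma hw_nonneg: "hw L m k \<ge> 0"
  unfolding hw_def by (intro sum_nonneg) auto

lemma dsym_zero: "dsym L (\<lambda>_. 0) k = 1"
  by (simp add: dsym_def)

lemma dsym_power_unit: "dsym L (\<lambda>i. n * unit_index j i) k = (\<i> * of_real (wave L k $ j)) ^ n"
proof -
  have "dsym L (\<lambda>i. n * unit_index j i) k = (\<Prod>i\<in>UNIV. if i = j then (\<i> * of_real (wave L k $ j)) ^ n else 1)"
    unfolding dsym_def by (intro prod.cong) (auto simp: unit_index_def)
  then show ?thesis by simp
qed

lemma dsym_unit: "dsym L (unit_index j) k = \<i> * of_real (wave L k $ j)"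
  using dsym_power_unit[of L 1 j k] by simp

lemma mi_order_unit: "mi_order (\<lambda>i. n * unit_index j i) = n"
  by (simp add: mi_order_def unit_index_def if_distrib cong: if_cong)

lemma hw_ge_1: "hw L m k \<ge> 1"
proof -
  have "(cmod (dsym L (\<lambda>_. 0) k))\<^sup>2 \<le> hw L m k"
    unfolding hw_def by (rule member_le_sum[OF _ _ finite_multi_index]) (auto simp: mi_order_def)
  then show ?thesis by (simp add: dsym_zero)
qed

text \<open>Only the zero index and the three unit indices are kept. This direction of the
  comparison converts a hypothesis on \<open>H_norm L 1\<close> into a bound on weighted coefficient
  sums with constant 1, so the argument of the arctangent is not enlarged.\<close>

lemma wt_le_hw1: "wt L k \<le> hw L 1 k"
proof -
  let ?I = "insert (\<lambda>_. 0) (range unit_index) :: multi_index set"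
  have inj: "inj (unit_index :: 3 \<Rightarrow> multi_index)"
    unfolding inj_def unit_index_def fun_eq_iff by (metis zero_neq_one)
  have ne: "(\<lambda>_. 0) \<notin> range unit_index"
    by (auto simp: unit_index_def fun_eq_iff) (metis zero_neq_one)
  have "wt L k = (\<Sum>\<beta>\<in>?I. (cmod (dsym L \<beta> k))\<^sup>2)"
    using ne by (simp add: sum.reindex[OF inj] dsym_zero dsym_unit wt_def norm_sq_vec3 norm_mult)
  also have "\<dots> \<le> hw L 1 k"
    unfolding hw_def
    by (rule sum_mono2[OF finite_multi_index]) (auto simp: mi_order_def unit_index_def)
  finally show ?thesis .
qed

section \<open>Sobolev spaces, the spaces \<open>V L m\<close> and the projection in terms of
  coefficients\<close>

context periodic_box
begin

lemma weak_D_coef: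
  assumes u: "square_integrable L u" and ex: "\<exists>g. has_weak_D L \<beta> u g"
  shows "square_integrable L (weak_D L \<beta> u)" "vcoef L (weak_D L \<beta> u) k = dsym L \<beta> k *s vcoef L u k"
proof -
  have "has_weak_D L \<beta> u (weak_D L \<beta> u)" unfolding weak_D_def using ex by (rule someI_ex)
  then show "square_integrable L (weak_D L \<beta> u)" "vcoef L (weak_D L \<beta> u) k = dsym L \<beta> k *s vcoef L u k"
    by (simp_all add: has_weak_D_iff[OF u])
qed

lemma H_perD:
  assumes u: "u \<in> H_per L m" 
  shows "square_integrable L u"
    and "mi_order \<beta> \<le> m \<Longrightarrow> square_integrable L (weak_D L \<beta> u)"
    and "mi_order \<beta> \<le> m \<Longrightarrow> vcoef L (weak_D L \<beta> u) k = dsym L \<beta> k *s vcoef L u k"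
  using assms weak_D_coef[of u \<beta>] by (auto simp: H_per_def)

lemma H_perI:
  assumes u: "square_integrable L u" and s: "(\<lambda>k. wt L k ^ m * (norm (vcoef L u k))\<^sup>2) summable_on UNIV"
  shows "u \<in> H_per L m"
proof -
  have "\<exists>g. has_weak_D L \<beta> u g" if \<beta>: "mi_order \<beta> \<le> m" for \<beta>
  proof -
    have "(\<lambda>k. (norm (dsym L \<beta> k *s vcoef L u k))\<^sup>2) summable_on UNIV"
    proof (rule summable_on_comparison_test[OF s])
      fix k
      have "(cmod (dsym L \<beta> k))\<^sup>2 \<le> wt L k ^ m"
        using dsym_le[of L \<beta> k] power_increasing[OF \<beta> wt_ge_1[of L k]] by linarith
      then show "(norm (dsym L \<beta> k *s vcoef L u k))\<^sup>2 \<le> wt L k ^ m * (norm (vcoef L u k))\<^sup>2"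
        by (simp add: norm_smult power_mult_distrib mult_right_mono)
    qed auto
    then obtain g where "square_integrable L g" "\<And>k. vcoef L g k = dsym L \<beta> k *s vcoef L u k"
      using vector_synthesis[of "\<lambda>k. dsym L \<beta> k *s vcoef L u k"]
      by (auto simp: dsym_minus vcoef_minus_index)
    then show ?thesis using has_weak_D_iff[OF u] by blast
  qed
  then show ?thesis using u by (simp add: H_per_def)
qed

lemma H_norm_has_sum:
  assumes u: "u \<in> H_per L m"
  shows "((\<lambda>k. hw L m k * (norm (vcoef L u k))\<^sup>2) has_sum (H_norm L m u)\<^sup>2) UNIV"
proof -
  have "((\<lambda>k. \<Sum>\<beta> | mi_order \<beta> \<le> m. (norm (vcoef L (weak_D L \<beta> u) k))\<^sup>2) has_sum
     (\<Sum>\<beta> | mi_order \<beta> \<le> m. (l2_norm L (weak_D L \<beta> u))\<^sup>2)) UNIV"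
    by (intro has_sum_finite_sum vparseval_norm H_perD(2)[OF u]) auto
  moreover have "(\<Sum>\<beta> | mi_order \<beta> \<le> m. (norm (vcoef L (weak_D L \<beta> u) k))\<^sup>2) = hw L m k * (norm (vcoef L u k))\<^sup>2" for k
    by (simp add: hw_def sum_distrib_right H_perD(3)[OF u] norm_smult power_mult_distrib)
  ultimately show ?thesis by (simp add: H_norm_def sum_nonneg)
qed

lemma H_inner_has_sum:
  assumes u: "u \<in> H_per L m" and v: "v \<in> H_per L m"
  shows "((\<lambda>k. \<Sum>\<beta> | mi_order \<beta> \<le> m. (dsym L \<beta> k *s vcoef L u k) \<bullet> (dsym L \<beta> k *s vcoef L v k)) has_sum H_inner L m u v) UNIV"
proof -
  have "((\<lambda>k. \<Sum>\<beta> | mi_order \<beta> \<le> m. vcoef L (weak_D L \<beta> u) k \<bullet> vcoef L (weak_D L \<beta> v) k) has_sum H_inner L m u v) UNIV"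
    unfolding H_inner_def
    by (intro has_sum_finite_sum vparseval H_perD(2)[OF u] H_perD(2)[OF v]) auto
  moreover have "(\<Sum>\<beta> | mi_order \<beta> \<le> m. vcoef L (weak_D L \<beta> u) k \<bullet> vcoef L (weak_D L \<beta> v) k) =
     (\<Sum>\<beta> | mi_order \<beta> \<le> m. (dsym L \<beta> k *s vcoef L u k) \<bullet> (dsym L \<beta> k *s vcoef L v k))" for k
    by (intro sum.cong) (auto simp: H_perD(3)[OF u] H_perD(3)[OF v])
  ultimately show ?thesis by simp
qed

lemma test_field_H_per:
  assumes "\<And>i. smooth (\<lambda>x. \<phi> x $ i)" "periodic L \<phi>"
  shows "square_integrable L \<phi>" "\<phi> \<in> H_per L m"
proof -
  show sq: "square_integrable L \<phi>"
    unfolding square_integrable_iff using assms sq_int_smooth by blast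
  have per: "periodic L (\<lambda>x. \<phi> x $ i)" for i using assms(2) by (simp add: periodic_def)
  have "has_weak_D L \<beta> \<phi> (\<lambda>x. \<chi> i. classical_D \<beta> (\<lambda>y. \<phi> y $ i) x)" for \<beta>
    unfolding has_weak_D_iff[OF sq] square_integrable_iff
    by (auto simp: vcoef_def vec_eq_iff intro!: sq_int_smooth smooth_classical_D assms rcoef_classical_D per)
  then show "\<phi> \<in> H_per L m" using sq by (auto simp: H_per_def)
qed

lemma H_per_diff:
  assumes u: "u \<in> H_per L m" and v: "v \<in> H_per L m"
  shows "(\<lambda>x. u x - v x) \<in> H_per L m"
proof -
  note sq = H_perD(1)[OF u] H_perD(1)[OF v]
  have "has_weak_D L \<beta> (\<lambda>x. u x - v x) (\<lambda>x. weak_D L \<beta> u x - weak_D L \<beta> v x)" if \<beta>: "mi_order \<beta> \<le> m" for \<beta>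
    unfolding has_weak_D_iff[OF square_integrable_diff[OF sq]]
    using H_perD(2,3)[OF u \<beta>] H_perD(2,3)[OF v \<beta>]
    by (auto simp: square_integrable_diff vcoef_diff sq vec_eq_iff right_diff_distrib)
  then show ?thesis using square_integrable_diff[OF sq] by (auto simp: H_per_def)
qed

lemma fcoef_0: "fcoef L f 0 = (LINT x|M. f x) / of_real (sqrt (vol L))"
  by (simp add: fcoef_def fmode_0)

lemma fcoef_sum:
  assumes "finite I" "\<And>i. i \<in> I \<Longrightarrow> sq_int L (f i)"
  shows "sq_int L (\<lambda>x. \<Sum>i\<in>I. f i x) \<and> fcoef L (\<lambda>x. \<Sum>i\<in>I. f i x) k = (\<Sum>i\<in>I. fcoef L (f i) k)"
  using assms
  by (induction I rule: finite_induct) (auto simp: sq_int_const fcoef_add sq_int_add, simp add: fcoef_def)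

lemma test_field_coef:
  assumes \<phi>: "\<phi> \<in> div_free_test_fields L"
  shows "vcoef L \<phi> 0 = 0" "cdot (wave L k) (vcoef L \<phi> k) = 0"
proof -
  have sm: "smooth (\<lambda>x. \<phi> x $ i)" for i using \<phi> by (simp add: div_free_test_fields_def)
  have per: "periodic L \<phi>" using \<phi> by (simp add: div_free_test_fields_def)
  have per_i: "periodic L (\<lambda>x. \<phi> x $ i)" for i using per by (simp add: periodic_def)
  have cont: "continuous_on UNIV \<phi>"
    using continuous_on_vec_lambda[of UNIV "\<lambda>i x. \<phi> x $ i"] smooth_continuous[OF sm] by simp
  have "(LINT x|M. \<phi> x $ i) = 0" for i
  proof -
    have "(LINT x|M. \<phi> x $ i) = (LINT x|M. \<phi> x \<bullet> axis i 1)" by (simp add: inner_axis)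
    also have "\<dots> = (LINT x|M. \<phi> x) \<bullet> axis i 1" by (intro integral_inner_left) (auto intro: integrable_continuous[OF cont])
    also have "\<dots> = 0" using \<phi> by (simp add: div_free_test_fields_def)
    finally show ?thesis .
  qed
  then show "vcoef L \<phi> 0 = 0"
    by (simp add: vcoef_def vec_eq_iff fcoef_0)
  have "0 = fcoef L (\<lambda>x. \<Sum>i\<in>UNIV. complex_of_real (partial i (\<lambda>y. \<phi> y $ i) x)) k"
    using \<phi> by (simp add: div_free_test_fields_def fcoef_def flip: of_real_sum)
  also have "\<dots> = (\<Sum>i\<in>UNIV. rcoef (partial i (\<lambda>y. \<phi> y $ i)) k)"
    using fcoef_sum[of UNIV "\<lambda>i x. complex_of_real (partial i (\<lambda>y. \<phi> y $ i) x)" k] sq_int_smooth smooth_partial[OF sm] by simp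
  also have "\<dots> = \<i> * cdot (wave L k) (vcoef L \<phi> k)"
    by (simp add: rcoef_partial[OF sm per_i] cdot_def vcoef_def sum_distrib_left mult.assoc)
  finally show "cdot (wave L k) (vcoef L \<phi> k) = 0" by simp
qed

lemma coef_le_H_norm:
  assumes u: "u \<in> H_per L m" shows "norm (vcoef L u k) \<le> H_norm L m u"
proof -
  have "(norm (vcoef L u k))\<^sup>2 \<le> hw L m k * (norm (vcoef L u k))\<^sup>2"
    using hw_ge_1[of L m k] mult_right_mono[of 1 "hw L m k" "(norm (vcoef L u k))\<^sup>2"] by simp
  also have "\<dots> = (\<Sum>k\<in>{k}. hw L m k * (norm (vcoef L u k))\<^sup>2)" by simp
  also have "\<dots> \<le> (H_norm L m u)\<^sup>2"
    using H_norm_has_sum[OF u] by (intro finite_sum_le_has_sum) (auto simp: hw_nonneg)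
  finally show ?thesis by (rule power2_le_imp_le) (simp add: H_norm_def sum_nonneg)
qed

text \<open>Zero mean and solenoidality are conditions on individual coefficients, and each
  coefficient is continuous in the H^m norm. Hence they pass from test fields to the
  closure.\<close>

lemma V_D:
  assumes u: "u \<in> V L m"
  shows "u \<in> H_per L m" "square_integrable L u" "vcoef L u 0 = 0" "cdot (wave L k) (vcoef L u k) = 0"
proof -
  show uH: "u \<in> H_per L m" using u by (simp add: V_def)
  then show "square_integrable L u" by (rule H_perD)
  obtain \<phi> where \<phi>: "\<And>n. \<phi> n \<in> div_free_test_fields L"
    and lim: "(\<lambda>n. H_norm L m (\<lambda>x. \<phi> n x - u x)) \<longlonglongrightarrow> 0"
    using u by (auto simp: V_def)
  have \<phi>H: "\<phi> n \<in> H_per L m" for n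
    using \<phi>[of n] by (intro test_field_H_per) (auto simp: div_free_test_fields_def)
  have conv: "(\<lambda>n. vcoef L (\<phi> n) k) \<longlonglongrightarrow> vcoef L u k" for k
  proof (rule Lim_null[THEN iffD2], rule Lim_null_comparison[OF _ lim], intro always_eventually allI)
    fix n
    have "vcoef L (\<phi> n) k - vcoef L u k = vcoef L (\<lambda>x. \<phi> n x - u x) k"
      by (simp add: vcoef_diff H_perD(1)[OF uH] H_perD(1)[OF \<phi>H])
    then show "norm (vcoef L (\<phi> n) k - vcoef L u k) \<le> H_norm L m (\<lambda>x. \<phi> n x - u x)"
      using coef_le_H_norm[OF H_per_diff[OF \<phi>H uH]] by simp
  qed
  show "vcoef L u 0 = 0"
    using conv[of 0] test_field_coef(1)[OF \<phi>] by (simp add: LIMSEQ_const_iff)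
  have "(\<lambda>n. cdot (wave L k) (vcoef L (\<phi> n) k)) \<longlonglongrightarrow> cdot (wave L k) (vcoef L u k)"
    by (intro bounded_linear.tendsto[OF bounded_linear_cdot] conv)
  then show "cdot (wave L k) (vcoef L u k) = 0"
    using test_field_coef(2)[OF \<phi>] by (simp add: LIMSEQ_const_iff)
qed

lemma of_real_trig:
  assumes "\<And>k. a (- k) = cnj (a k)"
  shows "complex_of_real (trig L (cube n) a x) = psum L (cube n) a x"
proof -
  have "cnj (psum L (cube n) a x) = (\<Sum>k\<in>cube n. a (- k) * fmode L (- k) x)"
    by (simp add: cnj_psum cnj_fmode assms)
  also have "\<dots> = psum L (cube n) a x"
    unfolding psum_def
    by (rule sum.reindex_bij_witness[of _ uminus uminus]) auto
  finally show ?thesis by (simp add: trig_def complex_eq_iff)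
qed

text \<open>Truncating the series to a cube yields a real solenoidal trigonometric polynomial, which
  is a test field. Its squared distance from \<open>u\<close> is the tail of the weighted series of
  \<open>u\<close>.\<close>

lemma V_I:
  assumes u: "square_integrable L u" and s: "(\<lambda>k. wt L k ^ m * (norm (vcoef L u k))\<^sup>2) summable_on UNIV"
    and z: "vcoef L u 0 = 0" and d: "\<And>k. cdot (wave L k) (vcoef L u k) = 0"
  shows "u \<in> V L m"
proof -
  have uH: "u \<in> H_per L m" by (rule H_perI[OF u s])
  define \<phi> where "\<phi> = (\<lambda>n x. \<chi> i. trig L (cube n) (\<lambda>k. vcoef L u k $ i) x)"
  have sm: "smooth (\<lambda>x. \<phi> n x $ i)" for n i by (simp add: \<phi>_def smooth_trig)
  have per: "periodic L (\<phi> n)" for n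
    using periodic_trig by (simp add: periodic_def \<phi>_def vec_eq_iff)
  have coef: "vcoef L (\<phi> n) k = (if k \<in> cube n then vcoef L u k else 0)" for n k
    unfolding vcoef_def[of _ "\<phi> n"]
    by (simp add: \<phi>_def of_real_trig vcoef_minus_index fcoef_psum[unfolded eta_contract_eq] vec_eq_iff)
  have \<phi>H: "\<phi> n \<in> H_per L m" "square_integrable L (\<phi> n)" for n
    by (intro test_field_H_per sm per)+
  have tf: "\<phi> n \<in> div_free_test_fields L" for n
    unfolding div_free_test_fields_def
  proof (intro CollectI conjI allI per sm)
    fix x
    have "(\<Sum>i\<in>UNIV. partial i (\<lambda>y. \<phi> n y $ i) x) = (\<Sum>i\<in>UNIV. \<Sum>k\<in>cube n. Re (\<i> * of_real (wave L k $ i) * vcoef L u k $ i * fmode L k x))"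
    proof -
      have "(\<lambda>y. \<phi> n y $ i) = trig L (cube n) (\<lambda>k. vcoef L u k $ i)" for i
        by (simp add: \<phi>_def fun_eq_iff)
      then show ?thesis by (simp only: partial_trig trig_def psum_def Re_sum)
    qed
    also have "\<dots> = (\<Sum>k\<in>cube n. Re (\<i> * cdot (wave L k) (vcoef L u k) * fmode L k x))"
      by (subst sum.swap) (simp only: cdot_def sum_distrib_left sum_distrib_right Re_sum mult.assoc)
    finally show "(\<Sum>i\<in>UNIV. partial i (\<lambda>y. \<phi> n y $ i) x) = 0" by (simp add: d)
  next
    have cont: "continuous_on UNIV (\<phi> n)"
      using continuous_on_vec_lambda[of UNIV "\<lambda>i x. \<phi> n x $ i"] smooth_continuous[OF sm] by simp
    have "(LINT x|M. \<phi> n x) $ i = 0" for i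
    proof -
      have "complex_of_real (LINT x|M. \<phi> n x $ i) / of_real (sqrt (vol L)) = vcoef L (\<phi> n) 0 $ i"
        by (simp add: vcoef_def fcoef_0)
      then have "(LINT x|M. \<phi> n x $ i) = 0" using vol_pos z by (simp add: coef)
      moreover have "(LINT x|M. \<phi> n x) $ i = (LINT x|M. \<phi> n x) \<bullet> axis i 1" by (simp add: inner_axis)
      moreover have "(LINT x|M. \<phi> n x) \<bullet> axis i 1 = (LINT x|M. \<phi> n x \<bullet> axis i 1)"
        by (intro integral_inner_left[symmetric]) (auto intro: integrable_continuous[OF cont])
      ultimately show ?thesis by (simp add: inner_axis)
    qed
    then show "(LINT x|M. \<phi> n x) = 0" by (simp add: vec_eq_iff)
  qed
  define c where "c = (\<lambda>k. hw L m k * (norm (vcoef L u k))\<^sup>2)"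
  have H2: "(H_norm L m (\<lambda>x. \<phi> n x - u x))\<^sup>2 = (H_norm L m u)\<^sup>2 - sum c (cube n)" for n
  proof -
    have 1: "((\<lambda>k. hw L m k * (norm (vcoef L (\<lambda>x. \<phi> n x - u x) k))\<^sup>2) has_sum (H_norm L m (\<lambda>x. \<phi> n x - u x))\<^sup>2) UNIV"
      by (intro H_norm_has_sum H_per_diff \<phi>H uH)
    have 2: "((\<lambda>k. if k \<in> cube n then c k else 0) has_sum sum c (cube n)) UNIV"
      by (rule has_sum_finite_neutralI[of "cube n"]) auto
    have "((\<lambda>k. c k) has_sum (H_norm L m (\<lambda>x. \<phi> n x - u x))\<^sup>2 + sum c (cube n)) UNIV"
      by (rule has_sum_cong[THEN iffD1, OF _ has_sum_add[OF 1 2]])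
        (simp add: vcoef_diff \<phi>H u coef c_def)
    moreover have "((\<lambda>k. c k) has_sum (H_norm L m u)\<^sup>2) UNIV"
      unfolding c_def by (rule H_norm_has_sum[OF uH])
    ultimately have "(H_norm L m (\<lambda>x. \<phi> n x - u x))\<^sup>2 + sum c (cube n) = (H_norm L m u)\<^sup>2"
      by (rule has_sum_unique)
    then show ?thesis by simp
  qed
  have "(\<lambda>n. sum c (cube n)) \<longlonglongrightarrow> (H_norm L m u)\<^sup>2"
    unfolding c_def by (intro has_sum_cube H_norm_has_sum uH)
  then have "(\<lambda>n. sqrt ((H_norm L m u)\<^sup>2 - sum c (cube n))) \<longlonglongrightarrow> sqrt ((H_norm L m u)\<^sup>2 - (H_norm L m u)\<^sup>2)"
    by (intro tendsto_real_sqrt tendsto_diff tendsto_const)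
  moreover have "sqrt ((H_norm L m u)\<^sup>2 - sum c (cube n)) = H_norm L m (\<lambda>x. \<phi> n x - u x)" for n
    unfolding H2[symmetric] by (simp add: H_norm_def sum_nonneg)
  ultimately have "(\<lambda>n. H_norm L m (\<lambda>x. \<phi> n x - u x)) \<longlonglongrightarrow> 0" by simp
  then show ?thesis using uH tf by (auto simp: V_def)
qed

text \<open>Projecting each nonzero mode and dropping the mean makes the difference orthogonal to
  \<open>V L 0\<close> mode by mode. Existence is what turns the chosen representative
  \<open>leray L f\<close> into a field with the defining property.\<close>

lemma leray_ex:
  assumes f: "square_integrable L f"
  shows "\<exists>g. g \<in> V L 0 \<and> (\<forall>v\<in>V L 0. l2_inner L (\<lambda>x. f x - g x) v = 0)"
proof -
  define a where "a = (\<lambda>k. if k = 0 then 0 else pr (wave L k) (vcoef L f k))"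
  have fs: "(\<lambda>k. (norm (vcoef L f k))\<^sup>2) summable_on UNIV"
    using vparseval_norm[OF f] by (rule has_sum_imp_summable)
  have s: "(\<lambda>k. (norm (a k))\<^sup>2) summable_on UNIV"
    by (rule summable_on_comparison_test[OF fs]) (auto simp: a_def intro!: power_mono norm_pr_le)
  have r: "a (- k) $ i = cnj (a k $ i)" for k i
    by (simp add: a_def wave_minus pr_minus_cnj vcoef_minus_index)
  obtain g where g: "square_integrable L g" "\<And>k. vcoef L g k = a k"
    using vector_synthesis[OF s r] by blast
  have d: "cdot (wave L k) (a k) = 0" for k
  proof (cases "k = 0 \<or> wave L k = 0")
    case False then show ?thesis by (simp add: a_def cdot_pr)
  qed (auto simp: a_def)
  have gV: "g \<in> V L 0"
    by (rule V_I) (use g s d in \<open>auto simp: a_def\<close>)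
  have "l2_inner L (\<lambda>x. f x - g x) v = 0" if v: "v \<in> V L 0" for v
  proof -
    have "((\<lambda>k. vcoef L (\<lambda>x. f x - g x) k \<bullet> vcoef L v k) has_sum l2_inner L (\<lambda>x. f x - g x) v) UNIV"
      by (intro vparseval square_integrable_diff f g V_D(2)[OF v])
    moreover have "vcoef L (\<lambda>x. f x - g x) k \<bullet> vcoef L v k = 0" for k
      by (cases "k = 0") (simp_all add: vcoef_diff f g a_def inner_diff_left pr_inner V_D(3,4)[OF v])
    ultimately have "((\<lambda>k::int^3. 0) has_sum l2_inner L (\<lambda>x. f x - g x) v) UNIV" by simp
    from has_sum_unique[OF this has_sum_0_simp] show ?thesis .
  qed
  then show ?thesis using gV by blast
qed

lemma leray:
  assumes f: "square_integrable L f"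
  shows "leray L f \<in> V L 0" "v \<in> V L 0 \<Longrightarrow> l2_inner L (leray L f) v = l2_inner L f v"
proof -
  have *: "leray L f \<in> V L 0 \<and> (\<forall>v\<in>V L 0. l2_inner L (\<lambda>x. f x - leray L f x) v = 0)"
    unfolding leray_def by (rule someI_ex[OF leray_ex[OF f]])
  then show l: "leray L f \<in> V L 0" by blast
  assume v: "v \<in> V L 0"
  have 1: "((\<lambda>k. vcoef L (\<lambda>x. f x - leray L f x) k \<bullet> vcoef L v k) has_sum 0) UNIV"
    using vparseval[OF square_integrable_diff[OF f V_D(2)[OF l]] V_D(2)[OF v]] * v by simp
  have 2: "((\<lambda>k. vcoef L (leray L f) k \<bullet> vcoef L v k) has_sum l2_inner L (leray L f) v) UNIV"
    by (rule vparseval[OF V_D(2)[OF l] V_D(2)[OF v]])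
  have "((\<lambda>k. vcoef L f k \<bullet> vcoef L v k) has_sum 0 + l2_inner L (leray L f) v) UNIV"
    by (rule has_sum_cong[THEN iffD1, OF _ has_sum_add[OF 1 2]])
      (simp add: vcoef_diff f V_D(2)[OF l] inner_diff_left)
  then show "l2_inner L (leray L f) v = l2_inner L f v"
    using has_sum_unique[OF vparseval[OF f V_D(2)[OF v]]] by force
qed

end

section \<open>Laplacian and advection\<close>

context periodic_box
begin

lemma vcoef_sum:
  assumes "finite I" "\<And>j. j \<in> I \<Longrightarrow> square_integrable L (w j)"
  shows "square_integrable L (\<lambda>x. \<Sum>j\<in>I. w j x)" "vcoef L (\<lambda>x. \<Sum>j\<in>I. w j x) k = (\<Sum>j\<in>I. vcoef L (w j) k)"
  using fcoef_sum[of I "\<lambda>j x. complex_of_real (w j x $ i)" k for i] assms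
  by (simp_all add: square_integrable_iff vcoef_def vec_eq_iff)

lemma laplacian_coef:
  assumes u: "u \<in> H_per L 2"
  shows "square_integrable L (laplacian L u)"
    and "vcoef L (laplacian L u) k = - ((norm (wave L k))\<^sup>2) *\<^sub>R vcoef L u k"
proof -
  have eq: "laplacian L u = (\<lambda>x. \<Sum>j\<in>UNIV. weak_D L (\<lambda>i. 2 * unit_index j i) u x)"
    by (simp add: laplacian_def fun_eq_iff)
  note w = H_perD(2,3)[OF u, of "\<lambda>i. 2 * unit_index j i" for j, unfolded mi_order_unit, OF order_refl]
  show "square_integrable L (laplacian L u)" unfolding eq by (intro vcoef_sum w) auto
  have "vcoef L (laplacian L u) k = (\<Sum>j\<in>UNIV. (\<i> * of_real (wave L k $ j))\<^sup>2 *s vcoef L u k)"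
    unfolding eq by (subst vcoef_sum) (simp_all only: w finite dsym_power_unit)
  also have "\<dots> = - ((norm (wave L k))\<^sup>2) *\<^sub>R vcoef L u k"
    by (simp add: vec_eq_iff norm_sq_vec3 power_mult_distrib sum_negf sum_distrib_right scaleR_conv_of_real[where 'a=complex])
  finally show "vcoef L (laplacian L u) k = - ((norm (wave L k))\<^sup>2) *\<^sub>R vcoef L u k" .
qed

text \<open>Summable coefficients make \<open>u\<close> bounded, so each product of a component with
  a derivative is square integrable and the convolution theorem applies. The norm estimate is the
  supremum bound times the gradient norm.\<close>

lemma advection_coef:
  assumes u: "u \<in> H_per L 1" and s: "(\<lambda>k. norm (vcoef L u k)) summable_on UNIV"
  shows "square_integrable L (advection L u)"
    and "((\<lambda>j. ((\<i> / of_real (sqrt (vol L)) * cdot (wave L (k - j)) (vcoef L u j)) *s vcoef L u (k - j)) $ i)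
      has_sum vcoef L (advection L u) k $ i) UNIV"
    and "(l2_norm L (advection L u))\<^sup>2 \<le> 3 / vol L * (\<Sum>\<^sub>\<infinity>k. norm (vcoef L u k))\<^sup>2 *
       (\<Sum>\<^sub>\<infinity>k. (norm (wave L k))\<^sup>2 * (norm (vcoef L u k))\<^sup>2)"
proof -
  define S where "S = (\<Sum>\<^sub>\<infinity>k. norm (vcoef L u k))"
  define B where "B = S / sqrt (vol L)"
  have S0: "S \<ge> 0" unfolding S_def by (intro infsum_nonneg) auto
  have B0: "B \<ge> 0" using S0 vol_pos by (simp add: B_def)
  have usq: "square_integrable L u" by (rule H_perD[OF u])
  define w where "w = (\<lambda>j. weak_D L (unit_index j) u)"
  have mu: "mi_order (unit_index j) \<le> 1" for j using mi_order_unit[of 1 j] by simp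
  have w: "square_integrable L (w j)" "vcoef L (w j) k = (\<i> * of_real (wave L k $ j)) *s vcoef L u k" for j k
    unfolding w_def using H_perD(2,3)[OF u mu[of j]] by (simp_all add: dsym_unit)
  let ?u = "\<lambda>j x. complex_of_real (u x $ j)" and ?w = "\<lambda>j i x. complex_of_real (w j x $ i)"
  have bd: "AE x in M. cmod (?u j x) \<le> B" for j
  proof -
    have cs: "(\<lambda>k. cmod (fcoef L (?u j) k)) summable_on UNIV"
      by (rule summable_on_comparison_test[OF s])
        (auto simp: vcoef_def intro: order_trans[OF _ Finite_Cartesian_Product.norm_nth_le[of "vcoef L u k" j for k, unfolded vcoef_def vec_lambda_beta]])
    have "(\<Sum>\<^sub>\<infinity>k. cmod (fcoef L (?u j) k)) \<le> S"
      unfolding S_def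
    proof (rule infsum_mono[OF cs s])
      show "cmod (fcoef L (?u j) k) \<le> norm (vcoef L u k)" for k
        using Finite_Cartesian_Product.norm_nth_le[of "vcoef L u k" j] by (simp add: vcoef_def)
    qed
    then have "(\<Sum>\<^sub>\<infinity>k. cmod (fcoef L (?u j) k)) / sqrt (vol L) \<le> B"
      unfolding B_def using vol_pos by (intro divide_right_mono) auto
    with fourier_sup_bound[OF sq_int_component[OF usq] cs] show ?thesis
      by (auto elim!: eventually_mono)
  qed
  have adv: "complex_of_real (advection L u x $ i) = (\<Sum>j\<in>UNIV. ?u j x * ?w j i x)" for x i
    by (simp add: advection_def w_def)
  have sq: "sq_int L (\<lambda>x. ?u j x * ?w j i x)" for i j
    by (rule sq_int_bounded_mult[OF sq_int_component[OF w(1)] sq_int_measurable[OF sq_int_component[OF usq]] bd])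
  show advsq: "square_integrable L (advection L u)"
    unfolding square_integrable_iff adv using fcoef_sum[of UNIV "\<lambda>j x. ?u j x * ?w j i x" for i] sq by simp
  have "((\<lambda>l. \<Sum>j\<in>UNIV. fcoef L (?u j) l * fcoef L (?w j i) (k - l) / of_real (sqrt (vol L)))
      has_sum (\<Sum>j\<in>UNIV. fcoef L (\<lambda>x. ?u j x * ?w j i x) k)) UNIV"
    by (intro has_sum_finite_sum fcoef_mult sq_int_component usq w) auto
  moreover have "(\<Sum>j\<in>UNIV. fcoef L (\<lambda>x. ?u j x * ?w j i x) k) = vcoef L (advection L u) k $ i"
    unfolding vcoef_def vec_lambda_beta adv
    using fcoef_sum[of UNIV "\<lambda>j x. ?u j x * ?w j i x" k] sq by simp
  moreover have "(\<Sum>j\<in>UNIV. fcoef L (?u j) l * fcoef L (?w j i) (k - l) / of_real (sqrt (vol L))) =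
     ((\<i> / of_real (sqrt (vol L)) * cdot (wave L (k - l)) (vcoef L u l)) *s vcoef L u (k - l)) $ i" for l
  proof -
    have "fcoef L (?w j i) (k - l) = \<i> * of_real (wave L (k - l) $ j) * vcoef L u (k - l) $ i" for j
      using w(2)[of j "k - l"] by (simp add: vcoef_def vec_eq_iff)
    moreover have "fcoef L (?u j) l = vcoef L u l $ j" for j by (simp add: vcoef_def)
    ultimately show ?thesis
      by (simp only: cdot_def) (simp add: sum_distrib_left sum_distrib_right sum_divide_distrib mult_ac)
  qed
  ultimately show "((\<lambda>j. ((\<i> / of_real (sqrt (vol L)) * cdot (wave L (k - j)) (vcoef L u j)) *s vcoef L u (k - j)) $ i)
      has_sum vcoef L (advection L u) k $ i) UNIV"
    by simp
  have wi: "integrable M (\<lambda>x. (norm (w j x))\<^sup>2)" for j using w(1)[of j] by (simp add: square_integrable_def)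
  have "(l2_norm L (advection L u))\<^sup>2 = (LINT x|M. (norm (advection L u x))\<^sup>2)"
    unfolding l2_norm_def by (intro real_sqrt_pow2 integral_nonneg_AE) auto
  also have "\<dots> \<le> (LINT x|M. (\<Sum>j\<in>UNIV. (3 * B\<^sup>2) * (norm (w j x))\<^sup>2))"
  proof (rule integral_mono_AE)
    show "integrable M (\<lambda>x. (norm (advection L u x))\<^sup>2)" using advsq by (simp add: square_integrable_def)
    show "integrable M (\<lambda>x. \<Sum>j\<in>UNIV. (3 * B\<^sup>2) * (norm (w j x))\<^sup>2)"
      using wi by (intro Bochner_Integration.integrable_sum) auto
    have "AE x in M. \<forall>j\<in>UNIV. cmod (?u j x) \<le> B" by (intro AE_finite_allI bd) auto
    then show "AE x in M. (norm (advection L u x))\<^sup>2 \<le> (\<Sum>j\<in>UNIV. (3 * B\<^sup>2) * (norm (w j x))\<^sup>2)"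
    proof eventually_elim
      case (elim x)
      have "norm (advection L u x) \<le> (\<Sum>j\<in>UNIV. norm (u x $ j *\<^sub>R w j x))"
        unfolding advection_def w_def by (rule norm_sum)
      also have "\<dots> \<le> (\<Sum>j\<in>UNIV. B * norm (w j x))"
        using elim by (intro sum_mono) (auto intro!: mult_right_mono)
      finally have "(norm (advection L u x))\<^sup>2 \<le> (\<Sum>j\<in>UNIV. B * norm (w j x))\<^sup>2"
        by (intro power_mono) auto
      \<comment> \<open>The three directions of differentiation give the factor 3 of the final
        estimate.\<close>
      also have "\<dots> \<le> (\<Sum>j\<in>UNIV. (B * norm (w j x))\<^sup>2) * of_nat (card (UNIV :: 3 set))"
        by (rule sum_squared_le_sum_of_squares)
      also have "\<dots> = (\<Sum>j\<in>UNIV. (3 * B\<^sup>2) * (norm (w j x))\<^sup>2)"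
        by (simp add: sum_distrib_left power_mult_distrib mult_ac)
      finally show ?case .
    qed
  qed
  also have "\<dots> = (\<Sum>j\<in>UNIV. (3 * B\<^sup>2) * (LINT x|M. (norm (w j x))\<^sup>2))"
    using wi by (subst Bochner_Integration.integral_sum) auto
  also have "\<dots> = 3 * B\<^sup>2 * (\<Sum>j\<in>UNIV. (l2_norm L (w j))\<^sup>2)"
  proof -
    have "(l2_norm L (w j))\<^sup>2 = (LINT x|M. (norm (w j x))\<^sup>2)" for j
      unfolding l2_norm_def by (intro real_sqrt_pow2 integral_nonneg_AE) auto
    then show ?thesis by (simp add: sum_distrib_left)
  qed
  also have "(\<Sum>j\<in>UNIV. (l2_norm L (w j))\<^sup>2) = (\<Sum>\<^sub>\<infinity>k. (norm (wave L k))\<^sup>2 * (norm (vcoef L u k))\<^sup>2)"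
  proof -
    have "((\<lambda>k. \<Sum>j\<in>UNIV. (norm (vcoef L (w j) k))\<^sup>2) has_sum (\<Sum>j\<in>UNIV. (l2_norm L (w j))\<^sup>2)) UNIV"
      by (intro has_sum_finite_sum vparseval_norm w) auto
    moreover have "(\<Sum>j\<in>UNIV. (norm (vcoef L (w j) k))\<^sup>2) = (norm (wave L k))\<^sup>2 * (norm (vcoef L u k))\<^sup>2" for k
      by (simp add: w(2) norm_smult norm_mult power_mult_distrib norm_sq_vec3 sum_distrib_right)
    ultimately show ?thesis by (simp add: infsumI)
  qed
  also have "3 * B\<^sup>2 = 3 / vol L * S\<^sup>2"
    using vol_pos by (simp add: B_def power_divide)
  finally show "(l2_norm L (advection L u))\<^sup>2 \<le> 3 / vol L * (\<Sum>\<^sub>\<infinity>k. norm (vcoef L u k))\<^sup>2 *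
       (\<Sum>\<^sub>\<infinity>k. (norm (wave L k))\<^sup>2 * (norm (vcoef L u k))\<^sup>2)"
    by (simp only: S_def)
qed

end

section \<open>Ordinary differential equations\<close>

lemma nonincreasing_on_interval:
  fixes f :: "real \<Rightarrow> real"
  assumes d: "\<And>t. t \<in> {0..T} \<Longrightarrow> (f has_real_derivative f' t) (at t within {0..T})"
    and n: "\<And>t. t \<in> {0..T} \<Longrightarrow> f' t \<le> 0" and t: "t \<in> {0..T}"
  shows "f t \<le> f 0"
proof -
  have "\<exists>s\<in>{0..t}. f t - f 0 = (\<lambda>h. h * f' s) (t - 0)"
  proof (rule mvt_very_simple)
    show "0 \<le> t" using t by simp
    fix s assume "0 \<le> s" "s \<le> t"
    then have "s \<in> {0..T}" "{0..t} \<subseteq> {0..T}" using t by auto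
    then show "(f has_derivative (\<lambda>h. h * f' s)) (at s within {0..t})"
      using has_field_derivative_subset[OF d] by (simp add: has_field_derivative_def mult_commute_abs)
  qed
  then obtain s where s: "s \<in> {0..t}" "f t - f 0 = (t - 0) * f' s" by auto
  have "(t - 0) * f' s \<le> 0"
    using s(1) t n[of s] by (intro mult_nonneg_nonpos) auto
  with s(2) show ?thesis by linarith
qed

text \<open>The integrating factor \<open>exp (- c t)\<close> makes \<open>g\<close> nonincreasing
  from 0. Zero mean, solenoidality and reality of the Galerkin solutions are all propagated from the
  initial time by this.\<close>

lemma gronwall_zero:
  fixes g :: "real \<Rightarrow> real"
  assumes d: "\<And>t. t \<in> {0..T} \<Longrightarrow> (g has_real_derivative g' t) (at t within {0..T})"
    and n: "\<And>t. t \<in> {0..T} \<Longrightarrow> g' t \<le> c * g t"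
    and z: "g 0 = 0" and p: "g t \<ge> 0" and t: "t \<in> {0..T}"
  shows "g t = 0"
proof -
  have "exp (- c * t) * g t \<le> exp (- c * 0) * g 0"
  proof (rule nonincreasing_on_interval[OF _ _ t])
    fix s assume s: "s \<in> {0..T}"
    show "((\<lambda>s. exp (- c * s) * g s) has_real_derivative exp (- c * s) * (g' s - c * g s)) (at s within {0..T})"
      by (rule derivative_eq_intros d[OF s] refl | simp add: algebra_simps)+
    show "exp (- c * s) * (g' s - c * g s) \<le> 0"
      using n[OF s] by (intro mult_nonneg_nonpos) auto
  qed
  then have "exp (- c * t) * g t \<le> 0" by (simp add: z)
  then have "g t \<le> 0" by (simp add: mult_le_0_iff)
  with p show ?thesis by simp
qed

lemma lipschitz_continuous_on:
  fixes F :: "('i \<Rightarrow> 'b::real_normed_vector) \<Rightarrow> 'i \<Rightarrow> 'b"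
  assumes fin: "finite I"
    and lip: "\<And>x y. (\<Sum>i\<in>I. norm (F x i - F y i)) \<le> C * (\<Sum>i\<in>I. norm (x i - y i))"
    and x: "\<And>j. j \<in> I \<Longrightarrow> continuous_on S (\<lambda>s. x s j)" and i: "i \<in> I"
  shows "continuous_on S (\<lambda>s. F (x s) i)"
  unfolding continuous_on_def
proof
  fix s0 assume s0: "s0 \<in> S"
  have "((\<lambda>s. C * (\<Sum>j\<in>I. norm (x s j - x s0 j))) \<longlongrightarrow> C * (\<Sum>j\<in>I. norm (x s0 j - x s0 j))) (at s0 within S)"
    using x s0 unfolding continuous_on_def
    by (intro tendsto_mult tendsto_const tendsto_sum tendsto_norm tendsto_diff) auto
  then have g: "((\<lambda>s. C * (\<Sum>j\<in>I. norm (x s j - x s0 j))) \<longlongrightarrow> 0) (at s0 within S)" by simp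
  show "((\<lambda>s. F (x s) i) \<longlongrightarrow> F (x s0) i) (at s0 within S)"
  proof (rule Lim_null[THEN iffD2], rule Lim_null_comparison[OF _ g], intro always_eventually allI)
    fix s
    have "norm (F (x s) i - F (x s0) i) \<le> (\<Sum>j\<in>I. norm (F (x s) j - F (x s0) j))"
      using fin i by (intro member_le_sum) auto
    then show "norm (F (x s) i - F (x s0) i) \<le> C * (\<Sum>j\<in>I. norm (x s j - x s0 j))"
      using lip[of "x s" "x s0"] by linarith
  qed
qed

text \<open>With a global Lipschitz constant the iterates converge on all of \<open>[0, T]\<close>
  at once, so no continuation argument is involved. The state space is the set of functions on
  \<open>I\<close>, measured by the sum of norms.\<close>

lemma picard_lindelof:
  fixes F :: "('i \<Rightarrow> 'b::euclidean_space) \<Rightarrow> 'i \<Rightarrow> 'b" and x0 :: "'i \<Rightarrow> 'b"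
  assumes fin: "finite I" and C: "C > 0" and T: "T > 0"
    and lip: "\<And>x y. (\<Sum>i\<in>I. norm (F x i - F y i)) \<le> C * (\<Sum>i\<in>I. norm (x i - y i))"
  obtains x :: "real \<Rightarrow> 'i \<Rightarrow> 'b" where "\<And>i. i \<in> I \<Longrightarrow> x 0 i = x0 i" "\<And>t i. i \<notin> I \<Longrightarrow> x t i = 0"
    "\<And>i t. i \<in> I \<Longrightarrow> t \<in> {0..T} \<Longrightarrow> ((\<lambda>t. x t i) has_vector_derivative F (x t) i) (at t within {0..T})"
proof -
  define X where "X = rec_nat (\<lambda>(t::real) i. x0 i) (\<lambda>n Y t i. x0 i + integral {0..t} (\<lambda>s. F (Y s) i))"
  have X0: "X 0 = (\<lambda>t i. x0 i)" and XS: "X (Suc n) = (\<lambda>t i. x0 i + integral {0..t} (\<lambda>s. F (X n s) i))" for n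
    by (simp_all add: X_def)
  have Xc: "\<forall>i\<in>I. continuous_on {0..T} (\<lambda>t. X n t i)" for n
  proof (induction n)
    case (Suc n)
    have "continuous_on {0..T} (\<lambda>s. F (X n s) i)" if "i \<in> I" for i
      by (rule lipschitz_continuous_on[OF fin lip _ that]) (use Suc in auto)
    then show ?case
      unfolding XS by (intro ballI continuous_intros indefinite_integral_continuous_1 integrable_continuous_real)
  qed (simp add: X0)
  have Fc: "continuous_on {0..T} (\<lambda>s. F (X n s) i)" if "i \<in> I" for i n
    by (rule lipschitz_continuous_on[OF fin lip _ that]) (use Xc in auto)
  define M where "M = T * (\<Sum>i\<in>I. norm (F x0 i))"
  define D where "D = (\<lambda>n t. \<Sum>i\<in>I. norm (X (Suc n) t i - X n t i))"
  \<comment> \<open>The weight \<open>exp (2 C t)\<close> makes the integral operator a contraction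
    by 1/2: integrating \<open>C exp (2 C s)\<close> from 0 to \<open>t\<close> gives at most half
    of \<open>exp (2 C t)\<close>.\<close>
  have D: "D n t \<le> M * (1/2)^n * exp (2 * C * t)" if "t \<in> {0..T}" for n t
    using that
  proof (induction n arbitrary: t)
    case 0
    have "D 0 t = t * (\<Sum>i\<in>I. norm (F x0 i))"
      using 0 by (simp add: D_def XS X0 sum_distrib_left)
    also have "\<dots> \<le> M * 1"
      using 0 unfolding M_def mult_1_right by (intro mult_right_mono) (auto simp: sum_nonneg)
    also have "\<dots> \<le> M * exp (2 * C * t)"
      using 0 C T by (intro mult_left_mono) (auto simp: M_def sum_nonneg)
    finally show ?case by simp
  next
    case (Suc n)
    have sub: "{0..t} \<subseteq> {0..T}" using Suc.prems by auto
    have c: "continuous_on {0..t} (\<lambda>s. F (X (Suc n) s) i)" "continuous_on {0..t} (\<lambda>s. F (X n s) i)" if "i \<in> I" for i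
      using Fc[OF that] continuous_on_subset[OF _ sub] by blast+
    have cn: "continuous_on {0..t} (\<lambda>s. norm (F (X (Suc n) s) i - F (X n s) i))" if "i \<in> I" for i
      by (intro continuous_intros c that)
    have "norm (X (Suc (Suc n)) t i - X (Suc n) t i) \<le> integral {0..t} (\<lambda>s. norm (F (X (Suc n) s) i - F (X n s) i))" if "i \<in> I" for i
    proof -
      have "X (Suc (Suc n)) t i - X (Suc n) t i = integral {0..t} (\<lambda>s. F (X (Suc n) s) i - F (X n s) i)"
        unfolding XS[of "Suc n"] using c[OF that]
        by (subst Henstock_Kurzweil_Integration.integral_diff) (auto intro!: integrable_continuous_real simp: XS)
      then show ?thesis
        using c[OF that] by (auto intro!: integral_norm_bound_integral integrable_continuous_real continuous_intros)
    qed
    then have "D (Suc n) t \<le> (\<Sum>i\<in>I. integral {0..t} (\<lambda>s. norm (F (X (Suc n) s) i - F (X n s) i)))"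
      unfolding D_def by (rule sum_mono)
    also have "\<dots> = integral {0..t} (\<lambda>s. \<Sum>i\<in>I. norm (F (X (Suc n) s) i - F (X n s) i))"
      using fin by (intro Henstock_Kurzweil_Integration.integral_sum[symmetric] integrable_continuous_real cn)
    also have "\<dots> \<le> integral {0..t} (\<lambda>s. C * M * (1/2)^n * exp (2 * C * s))"
    proof (rule integral_le)
      show "(\<lambda>s. \<Sum>i\<in>I. norm (F (X (Suc n) s) i - F (X n s) i)) integrable_on {0..t}"
        by (intro integrable_continuous_real continuous_on_sum cn)
      show "(\<lambda>s. C * M * (1/2)^n * exp (2 * C * s)) integrable_on {0..t}"
        by (intro integrable_continuous_real continuous_intros)
      fix s assume "s \<in> {0..t}"
      then have "C * D n s \<le> C * (M * (1/2)^n * exp (2 * C * s))"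
        using Suc.IH[of s] sub C by (intro mult_left_mono) auto
      then show "(\<Sum>i\<in>I. norm (F (X (Suc n) s) i - F (X n s) i)) \<le> C * M * (1/2)^n * exp (2 * C * s)"
        using lip[of "X (Suc n) s" "X n s"] by (simp add: D_def mult.assoc)
    qed
    also have "\<dots> = M * (1/2)^Suc n * exp (2 * C * t) - M * (1/2)^Suc n * exp (2 * C * 0)"
    proof (rule integral_unique, rule fundamental_theorem_of_calculus)
      show "0 \<le> t" using Suc.prems by simp
      fix s
      show "((\<lambda>s. M * (1/2)^Suc n * exp (2 * C * s)) has_vector_derivative C * M * (1/2)^n * exp (2 * C * s)) (at s within {0..t})"
        unfolding has_real_derivative_iff_has_vector_derivative[symmetric]
        by (auto intro!: derivative_eq_intros)
    qed
    also have "\<dots> \<le> M * (1/2)^Suc n * exp (2 * C * t)"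
      using T by (simp add: M_def sum_nonneg)
    finally show ?case .
  qed
  have step: "norm (X (Suc n) t i - X n t i) \<le> M * exp (2 * C * T) * (1/2)^n" if "i \<in> I" "t \<in> {0..T}" for n t i
  proof -
    have "norm (X (Suc n) t i - X n t i) \<le> D n t"
      unfolding D_def using fin that by (intro member_le_sum) auto
    also have "\<dots> \<le> M * (1/2)^n * exp (2 * C * t)" by (rule D[OF that(2)])
    also have "\<dots> \<le> M * (1/2)^n * exp (2 * C * T)"
      using that C T by (intro mult_left_mono) (auto simp: M_def sum_nonneg)
    finally show ?thesis by (simp add: mult_ac)
  qed
  \<comment> \<open>The limit is written as a telescoping series so that the M-test with the
    geometric majorant of \<open>step\<close> gives uniform convergence.\<close>
  define x where "x = (\<lambda>t i. if i \<in> I then x0 i + (\<Sum>n. X (Suc n) t i - X n t i) else 0)"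
  have ul: "uniform_limit {0..T} (\<lambda>n t. X n t i) (\<lambda>t. x t i) sequentially" if i: "i \<in> I" for i
  proof -
    have "uniform_limit {0..T} (\<lambda>n t. \<Sum>m<n. X (Suc m) t i - X m t i) (\<lambda>t. \<Sum>m. X (Suc m) t i - X m t i) sequentially"
    proof (rule Weierstrass_m_test)
      show "norm (X (Suc n) t i - X n t i) \<le> M * exp (2 * C * T) * (1/2)^n" if "t \<in> {0..T}" for n t
        by (rule step[OF i that])
      show "summable (\<lambda>n. M * exp (2 * C * T) * (1 / 2) ^ n)"
        by (intro summable_mult summable_geometric) auto
    qed
    from uniform_limit_add[OF uniform_limit_const this, of "\<lambda>_. x0 i"]
    show ?thesis
      using i sum_lessThan_telescope[of "\<lambda>m. X m t i" for t] by (simp add: x_def X0)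
  qed
  have xc: "continuous_on {0..T} (\<lambda>t. x t i)" if "i \<in> I" for i
    by (rule uniform_limit_theorem[OF _ ul[OF that]]) (use Xc that in auto)
  have Fxc: "continuous_on {0..T} (\<lambda>s. F (x s) i)" if "i \<in> I" for i
    by (rule lipschitz_continuous_on[OF fin lip xc that])
  have eq: "x t i = x0 i + integral {0..t} (\<lambda>s. F (x s) i)" if i: "i \<in> I" and t: "t \<in> {0..T}" for t i
  proof -
    have sub: "{0..t} \<subseteq> {0..T}" using t by auto
    have "(\<lambda>n. integral {0..t} (\<lambda>s. F (X n s) i)) \<longlonglongrightarrow> integral {0..t} (\<lambda>s. F (x s) i)"
    proof (rule LIMSEQ_I)
      fix e :: real assume e: "e > 0"
      \<comment> \<open>The summand 1 keeps \<open>K\<close> positive for empty \<open>I\<close> and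
        makes the final inequality strict.\<close>
      define K where "K = C * real (card I) * T + 1"
      have K: "K > 0" unfolding K_def using C T by (intro add_nonneg_pos) auto
      define d where "d = e / K"
      have d: "d > 0" using e K by (simp add: d_def)
      have "\<forall>\<^sub>F n in sequentially. \<forall>j\<in>I. \<forall>s\<in>{0..T}. dist (X n s j) (x s j) < d"
        using fin ul d unfolding uniform_limit_iff by (intro eventually_ball_finite) auto
      then obtain n0 where n0: "\<And>n j s. n \<ge> n0 \<Longrightarrow> j \<in> I \<Longrightarrow> s \<in> {0..T} \<Longrightarrow> dist (X n s j) (x s j) < d"
        unfolding eventually_sequentially by blast
      have "norm (integral {0..t} (\<lambda>s. F (X n s) i) - integral {0..t} (\<lambda>s. F (x s) i)) < e" if n: "n \<ge> n0" for n
      proof -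
        have c: "continuous_on {0..t} (\<lambda>s. F (X n s) i)" "continuous_on {0..t} (\<lambda>s. F (x s) i)"
          using Fc[OF i] Fxc[OF i] continuous_on_subset[OF _ sub] by blast+
        have "norm (integral {0..t} (\<lambda>s. F (X n s) i) - integral {0..t} (\<lambda>s. F (x s) i)) =
            norm (integral {0..t} (\<lambda>s. F (X n s) i - F (x s) i))"
          using c by (subst Henstock_Kurzweil_Integration.integral_diff) (auto intro!: integrable_continuous_real)
        also have "\<dots> \<le> (C * (real (card I) * d)) * (t - 0)"
        proof (rule integral_bound)
          show "0 \<le> t" using t by simp
          show "continuous_on {0..t} (\<lambda>s. F (X n s) i - F (x s) i)" by (intro continuous_intros c)
          fix s assume "s \<in> {0..t}"
          then have s: "s \<in> {0..T}" using sub by blast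
          have "norm (F (X n s) i - F (x s) i) \<le> (\<Sum>j\<in>I. norm (F (X n s) j - F (x s) j))"
            using fin i by (intro member_le_sum) auto
          also have "\<dots> \<le> C * (\<Sum>j\<in>I. norm (X n s j - x s j))" by (rule lip)
          also have "\<dots> \<le> C * (\<Sum>j\<in>I. d)"
            using n0[OF n _ s] C by (intro mult_left_mono sum_mono) (auto simp: dist_norm less_imp_le)
          finally show "norm (F (X n s) i - F (x s) i) \<le> C * (real (card I) * d)" by simp
        qed
        also have "\<dots> \<le> (C * (real (card I) * d)) * T"
          using t C d by (intro mult_left_mono) auto
        also have "\<dots> < K * d" using d by (simp add: K_def algebra_simps)
        also have "\<dots> = e" using K by (simp add: d_def)
        finally show ?thesis .
      qed
      then show "\<exists>no. \<forall>n\<ge>no. norm (integral {0..t} (\<lambda>s. F (X n s) i) - integral {0..t} (\<lambda>s. F (x s) i)) < e"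
        by blast
    qed
    then have "(\<lambda>n. X (Suc n) t i) \<longlonglongrightarrow> x0 i + integral {0..t} (\<lambda>s. F (x s) i)"
      unfolding XS by (intro tendsto_add tendsto_const)
    moreover have "(\<lambda>n. X (Suc n) t i) \<longlonglongrightarrow> x t i"
      by (rule LIMSEQ_Suc, rule tendsto_uniform_limitI[OF ul[OF i] t])
    ultimately show ?thesis by (rule LIMSEQ_unique[symmetric])
  qed
  show ?thesis
  proof (rule that[of x])
    show "x 0 i = x0 i" if "i \<in> I" for i using eq[OF that, of 0] T by simp
    show "x t i = 0" if "i \<notin> I" for t i using that by (simp add: x_def)
    fix i t assume i: "i \<in> I" and t: "t \<in> {0..T}"
    have "((\<lambda>t. x0 i + integral {0..t} (\<lambda>s. F (x s) i)) has_vector_derivative 0 + F (x t) i) (at t within {0..T})"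
      by (intro has_vector_derivative_add has_vector_derivative_const integral_has_vector_derivative Fxc i t)
    then show "((\<lambda>t. x t i) has_vector_derivative F (x t) i) (at t within {0..T})"
      by (intro has_vector_derivative_transform[OF t eq[OF i]]) auto
  qed
qed

section \<open>The convolution form of the nonlinearity\<close>

lemma card_cube: "card (cube n) = (2 * n + 1) ^ 3"
proof -
  have "cube n = (\<lambda>f. \<chi> i. f i) ` (PiE UNIV (\<lambda>_. {- int n..int n}))"
  proof (intro equalityI subsetI)
    fix k assume "k \<in> cube n"
    then have "vec_nth k \<in> PiE UNIV (\<lambda>_. {- int n..int n})" "k = (\<chi> i. vec_nth k i)"
      by (auto simp: cube_def abs_le_iff minus_le_iff)
    then show "k \<in> (\<lambda>f. \<chi> i. f i) ` (PiE UNIV (\<lambda>_. {- int n..int n}))" by blast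
  qed (auto simp: cube_def abs_le_iff minus_le_iff PiE_UNIV_domain Pi_iff)
  then have "card (cube n) = card (PiE UNIV (\<lambda>_ :: 3. {- int n..int n}))"
    by (simp add: card_image inj_on_def vec_eq_iff fun_eq_iff)
  also have "\<dots> = (2 * n + 1) ^ 3"
  proof -
    have "nat (2 * int n + 1) = Suc (2 * n)" by linarith
    then show ?thesis by (subst card_PiE) auto
  qed
  finally show ?thesis .
qed

text \<open>The projected convolution for \<open>u\<close> dot grad \<open>v\<close>, with
  \<open>wave L k\<close> in place of \<open>wave L (k - j)\<close>; the two agree when
  \<open>cdot (wave L j) (x j) = 0\<close>. In this form the value is solenoidal and vanishes at
  \<open>k = 0\<close> for arbitrary arguments, so the ordinary differential equation preserves both
  constraints before anything is known about its solution.\<close>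

definition bil :: "real^3 \<Rightarrow> (int^3) set \<Rightarrow> (int^3 \<Rightarrow> complex^3) \<Rightarrow> (int^3 \<Rightarrow> complex^3) \<Rightarrow> int^3 \<Rightarrow> complex^3" where
  "bil L K x y k = (\<Sum>j | j \<in> K \<and> k - j \<in> K. (\<i> * cdot (wave L k) (x j)) *s pr (wave L k) (y (k - j)))"

definition hdot :: "complex^3 \<Rightarrow> complex^3 \<Rightarrow> complex" where
  "hdot z w = (\<Sum>i\<in>UNIV. z $ i * cnj (w $ i))"

definition cvec :: "complex^3 \<Rightarrow> complex^3" where
  "cvec z = (\<chi> i. cnj (z $ i))"

lemma smult_inner: "(c *s z) \<bullet> w = Re (c * hdot z w)"
  by (simp add: inner_vec_def inner_complex_def hdot_def sum_distrib_left algebra_simps sum.distrib)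

lemma norm_cvec: "norm (cvec z) = norm z"
  by (simp add: cvec_def norm_vec_def)

lemma bounded_linear_cvec: "bounded_linear cvec"
proof (rule bounded_linear_intro[where K = 1])
  show "cvec (x + y) = cvec x + cvec y" for x y by (simp add: cvec_def vec_eq_iff)
  show "cvec (r *\<^sub>R x) = r *\<^sub>R cvec x" for r x by (simp add: cvec_def vec_eq_iff)
  show "norm (cvec x) \<le> norm x * 1" for x by (simp add: norm_cvec)
qed

lemma pr_diff: "pr \<kappa> (x - y) = pr \<kappa> x - pr \<kappa> y"
  by (simp add: pr_def cdot_diff vec_eq_iff diff_divide_distrib left_diff_distrib)

lemma pr_scaleR: "pr \<kappa> (r *\<^sub>R x) = r *\<^sub>R pr \<kappa> x"
proof -
  have "r *\<^sub>R x = of_real r *s x" for x :: "complex^3"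
    by (simp add: vec_eq_iff scaleR_conv_of_real[where 'a=complex])
  note e = this
  show ?thesis unfolding e by (simp add: pr_def cdot_smult vec_eq_iff right_diff_distrib)
qed

lemma cdot_scaleR: "cdot \<kappa> (r *\<^sub>R x) = r *\<^sub>R cdot \<kappa> x"
  by (rule linear_cmul[OF bounded_linear.linear[OF bounded_linear_cdot]])

lemma bil_diff:
  assumes "finite K"
  shows "bil L K x x k - bil L K y y k = bil L K (\<lambda>j. x j - y j) x k + bil L K y (\<lambda>j. x j - y j) k"
  unfolding bil_def sum_subtractf[symmetric] sum.distrib[symmetric]
  by (intro sum.cong refl) (simp add: cdot_diff pr_diff vec_eq_iff algebra_simps)

lemma bil_scaleR: "bil L K (\<lambda>j. c *\<^sub>R x j) (\<lambda>j. c *\<^sub>R x j) k = c\<^sup>2 *\<^sub>R bil L K x x k"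
  unfolding bil_def scaleR_sum_right
  by (intro sum.cong refl)
     (simp add: cdot_scaleR pr_scaleR vec_eq_iff scaleR_conv_of_real[where 'a=complex] power2_eq_square mult_ac)

lemma cdot_bil: "cdot (wave L k) (bil L K x y k) = 0"
proof -
  have "cdot (wave L k) ((\<i> * cdot (wave L k) u) *s pr (wave L k) v) = 0" for u v
    by (cases "wave L k = 0") (simp_all add: cdot_smult cdot_pr)
  then show ?thesis
    unfolding bil_def
    by (simp add: linear_sum[OF bounded_linear.linear[OF bounded_linear_cdot]])
qed

lemma bil_0: "bil L K x y 0 = 0"
  by (simp add: bil_def vec_eq_iff)

lemma norm_bil_le:
  assumes K: "finite K"
  shows "norm (bil L K x y k) \<le> norm (wave L k) * (\<Sum>j\<in>K. norm (x j)) * (\<Sum>j\<in>K. norm (y j))"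
proof -
  have "norm (bil L K x y k) \<le> (\<Sum>j | j \<in> K \<and> k - j \<in> K. norm (wave L k) * norm (x j) * (\<Sum>j\<in>K. norm (y j)))"
    unfolding bil_def
  proof (rule sum_norm_le)
    fix j assume j: "j \<in> {j. j \<in> K \<and> k - j \<in> K}"
    have 1: "norm (pr (wave L k) (y (k - j))) \<le> (\<Sum>j\<in>K. norm (y j))"
      using j K by (intro order_trans[OF norm_pr_le] member_le_sum) auto
    show "norm ((\<i> * cdot (wave L k) (x j)) *s pr (wave L k) (y (k - j))) \<le> norm (wave L k) * norm (x j) * (\<Sum>j\<in>K. norm (y j))"
    proof -
      have "norm (\<i> * cdot (wave L k) (x j)) \<le> norm (wave L k) * norm (x j)"
        using norm_cdot_le[of "wave L k" "x j"] by (simp add: norm_mult)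
      then show ?thesis unfolding norm_smult by (rule mult_mono[OF _ 1]) auto
    qed
  qed
  also have "\<dots> \<le> (\<Sum>j\<in>K. norm (wave L k) * norm (x j) * (\<Sum>j\<in>K. norm (y j)))"
    using K by (intro sum_mono2) (auto intro!: mult_nonneg_nonneg sum_nonneg)
  finally show ?thesis by (simp only: sum_distrib_left[symmetric] sum_distrib_right[symmetric])
qed

text \<open>Conjugation turns i into -i, and reflection turns \<open>wave L k\<close> into its
  negative; the two signs cancel. So the equation commutes with the symmetry that characterises real
  fields.\<close>

lemma bil_cvec:
  assumes "\<And>k. - k \<in> K \<longleftrightarrow> k \<in> K"
  shows "bil L K (\<lambda>j. cvec (x (- j))) (\<lambda>j. cvec (x (- j))) k = cvec (bil L K x x (- k))"
proof -
  have "cvec (bil L K x x (- k)) = (\<Sum>j | j \<in> K \<and> - k - j \<in> K. cvec ((\<i> * cdot (wave L (- k)) (x j)) *s pr (wave L (- k)) (x (- k - j))))"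
    unfolding bil_def by (rule linear_sum[OF bounded_linear.linear[OF bounded_linear_cvec]])
  also have "\<dots> = (\<Sum>j | j \<in> K \<and> k - j \<in> K. (\<i> * cdot (wave L k) (cvec (x (- j)))) *s pr (wave L k) (cvec (x (- (k - j)))))"
  proof (rule sum.reindex_bij_witness[of _ uminus uminus])
    fix j assume "j \<in> {j. j \<in> K \<and> k - j \<in> K}"
    then have "- j \<in> K" "- (k - j) \<in> K" unfolding assms by blast+
    then show "- j \<in> {j. j \<in> K \<and> - k - j \<in> K}" by simp
  next
    fix j assume "j \<in> {j. j \<in> K \<and> - k - j \<in> K}"
    then have "- j \<in> K" "- (- k - j) \<in> K" unfolding assms by blast+
    then show "- j \<in> {j. j \<in> K \<and> k - j \<in> K}" by (simp add: add.commute)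
  next
    fix j
    have c: "cdot (wave L k) (cvec z) = cnj (cdot (wave L k) z)" for z
      by (simp add: cdot_def cvec_def)
    have p: "pr (wave L k) (cvec z) = cvec (pr (- wave L k) z)" for z
      using pr_minus_cnj[of "cvec z" z "- wave L k"] by (simp add: cvec_def vec_eq_iff)
    show "(\<i> * cdot (wave L k) (cvec (x (- (- j))))) *s pr (wave L k) (cvec (x (- (k - (- j))))) =
      cvec ((\<i> * cdot (wave L (- k)) (x j)) *s pr (wave L (- k)) (x (- k - j)))"
      by (simp add: c p wave_minus cdot_left_minus) (simp add: cvec_def vec_eq_iff)
  qed auto
  finally have e: "cvec (bil L K x x (- k)) = (\<Sum>j | j \<in> K \<and> k - j \<in> K. (\<i> * cdot (wave L k) (cvec (x (- j)))) *s pr (wave L k) (cvec (x (- (k - j)))))" .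
  show ?thesis unfolding e by (simp only: bil_def)
qed

text \<open>For each fixed \<open>j\<close> the summands cancel in pairs under the involution \<open>k \<mapsto> j - k\<close>.\<close>

lemma energy_cancellation:
  assumes K: "finite K" "\<And>k. - k \<in> K \<longleftrightarrow> k \<in> K"
    and div: "\<And>k. cdot (wave L k) (x k) = 0" and re: "\<And>k. x (- k) = cvec (x k)"
  shows "(\<Sum>k\<in>K. x k \<bullet> bil L K x x k) = 0"
proof -
  define h where "h = (\<lambda>j k. Re (\<i> * cdot (wave L k) (x j) * hdot (x (k - j)) (x k)))"
  have 1: "x k \<bullet> bil L K x x k = (\<Sum>j | j \<in> K \<and> k - j \<in> K. h j k)" for k
  proof -
    have "x k \<bullet> bil L K x x k = (\<Sum>j | j \<in> K \<and> k - j \<in> K. ((\<i> * cdot (wave L k) (x j)) *s pr (wave L k) (x (k - j))) \<bullet> x k)"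
      unfolding bil_def inner_sum_right by (simp only: inner_commute)
    also have "\<dots> = (\<Sum>j | j \<in> K \<and> k - j \<in> K. h j k)"
    proof (rule sum.cong[OF refl])
      fix j
      have "(c *s pr (wave L k) z) \<bullet> x k = (c *s z) \<bullet> x k" for c z
      proof -
        have "c *s pr (wave L k) z = pr (wave L k) (c *s z)"
          by (simp add: pr_def cdot_smult vec_eq_iff right_diff_distrib mult_ac)
        then show ?thesis using pr_inner[OF div] by simp
      qed
      then show "((\<i> * cdot (wave L k) (x j)) *s pr (wave L k) (x (k - j))) \<bullet> x k = h j k"
        by (simp only: smult_inner h_def)
    qed
    finally show ?thesis .
  qed
  have 2: "(\<Sum>k | k \<in> K \<and> k - j \<in> K. h j k) = 0" for j
  proof -
    \<comment> \<open>Solenoidality of \<open>x j\<close> turns the frequency \<open>j - k\<close>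
      into \<open>- k\<close>, which gives the sign, while reality of \<open>x\<close> leaves the
      Hermitian product unchanged.\<close>
    have flip: "h j (j - k) = - h j k" for k
    proof -
      have "cdot (wave L (j - k)) (x j) = - cdot (wave L k) (x j)"
        by (simp add: wave_diff cdot_left_diff div)
      moreover have "hdot (x (j - k - j)) (x (j - k)) = hdot (x (k - j)) (x k)"
      proof -
        have "x (j - k - j) = cvec (x k)" using re[of k] by simp
        moreover have "x (j - k) = cvec (x (k - j))" using re[of "k - j"] by simp
        ultimately show ?thesis by (simp add: hdot_def cvec_def mult.commute)
      qed
      ultimately show ?thesis by (simp add: h_def)
    qed
    have "(\<Sum>k | k \<in> K \<and> k - j \<in> K. h j k) = (\<Sum>k | k \<in> K \<and> k - j \<in> K. h j (j - k))"
    proof (rule sum.reindex_bij_witness[of _ "\<lambda>k. j - k" "\<lambda>k. j - k"])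
      fix k assume "k \<in> {k. k \<in> K \<and> k - j \<in> K}"
      then have "- (k - j) \<in> K" "- k \<in> K" unfolding K(2) by blast+
      then show "j - k \<in> {k. k \<in> K \<and> k - j \<in> K}" by simp
      then show "j - k \<in> {k. k \<in> K \<and> k - j \<in> K}" .
    qed auto
    also have "\<dots> = - (\<Sum>k | k \<in> K \<and> k - j \<in> K. h j k)" by (simp add: flip sum_negf)
    finally show ?thesis by simp
  qed
  have "(\<Sum>k\<in>K. x k \<bullet> bil L K x x k) = (\<Sum>k\<in>K. \<Sum>j | j \<in> K \<and> k - j \<in> K. h j k)"
    by (simp add: 1)
  also have "\<dots> = (\<Sum>j\<in>K. \<Sum>k | k \<in> K \<and> k - j \<in> K. h j k)"
    by (rule sum.swap_restrict[OF K(1) K(1)])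
  finally show ?thesis by (simp add: 2)
qed

section \<open>Lattice sums and an Agmon inequality for coefficients\<close>

context periodic_box
begin

text \<open>A frequency gap valid in every direction: each side is at most the sum of the sides, so
  every \<open>2 * pi / L $ i\<close> is at least this number.\<close>

definition del :: real where "del = 2 * pi / (\<Sum>i\<in>UNIV. L $ i)"

lemma del_pos: "del > 0"
  unfolding del_def using side_pos by (intro divide_pos_pos sum_pos) auto

lemma norm_wave_ge:
  assumes "int m \<le> \<bar>k $ i\<bar>" shows "del * m \<le> norm (wave L k)"
proof -
  have le: "L $ i \<le> (\<Sum>i\<in>UNIV. L $ i)"
    using side_pos by (intro member_le_sum) (auto intro: less_imp_le)
  have "del * m \<le> del * \<bar>of_int (k $ i)\<bar>"
    using assms del_pos by (intro mult_left_mono) linarith+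
  also have "\<dots> \<le> 2 * pi / L $ i * \<bar>of_int (k $ i)\<bar>"
    unfolding del_def using le side_pos[of i] by (intro mult_right_mono divide_left_mono) auto
  also have "\<dots> = \<bar>wave L k $ i\<bar>"
    using side_pos[of i] by (simp add: wave_def abs_mult)
  also have "\<dots> \<le> norm (wave L k)" by (rule component_le_norm_cart)
  finally show ?thesis .
qed

lemma wave_nonzero: "k \<noteq> 0 \<Longrightarrow> wave L k \<noteq> 0"
  using side_pos by (auto simp: wave_def vec_eq_iff) (metis less_irrefl)

text \<open>Shells \<open>max \<bar>k\<^sub>i\<bar> = m\<close> contain at most \<open>26 m\<^sup>2\<close> points, and the resulting sum over \<open>m\<close> is
  compared with a telescoping sum of arc tangents.\<close>

lemma lattice_sum:
  assumes s: "s > 0"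
  shows "(\<Sum>k\<in>cube N - {0}. 1 / ((norm (wave L k))\<^sup>2 * (1 + s * (norm (wave L k))\<^sup>2)))
    \<le> 26 / (del ^ 3 * sqrt s) * arctan (sqrt s * del * N)"
proof (induction N)
  case 0
  have e: "cube 0 - {0} = {}" by (auto simp: cube_def vec_eq_iff)
  show ?case unfolding e by simp
next
  case (Suc n)
  let ?f = "\<lambda>k. 1 / ((norm (wave L k))\<^sup>2 * (1 + s * (norm (wave L k))\<^sup>2))"
  let ?m = "real (Suc n)"
  define a where "a = sqrt s * del"
  have a: "a > 0" using s del_pos by (simp add: a_def)
  have sd: "s * del\<^sup>2 = a\<^sup>2" using s by (simp add: a_def power_mult_distrib)
  have sub: "cube n \<subseteq> cube (Suc n)" by (rule cube_mono) simp
  have "cube (Suc n) - {0} = (cube n - {0}) \<union> (cube (Suc n) - cube n)" using sub by auto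
  then have "sum ?f (cube (Suc n) - {0}) = sum ?f (cube n - {0}) + sum ?f (cube (Suc n) - cube n)"
    by (simp only:) (rule sum.union_disjoint, auto)
  moreover have "sum ?f (cube (Suc n) - cube n) \<le> of_nat (card (cube (Suc n) - cube n)) * (1 / ((del * ?m)\<^sup>2 * (1 + s * (del * ?m)\<^sup>2)))"
  proof (rule sum_bounded_above)
    fix k assume "k \<in> cube (Suc n) - cube n"
    then obtain i where "\<bar>k $ i\<bar> > int n" by (auto simp: cube_def not_le)
    then have "del * ?m \<le> norm (wave L k)" by (intro norm_wave_ge[of "Suc n" k i]) simp
    then have le: "(del * ?m)\<^sup>2 \<le> (norm (wave L k))\<^sup>2" using del_pos by (intro power_mono) auto
    have p: "(del * ?m)\<^sup>2 > 0" using del_pos by simp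
    show "?f k \<le> 1 / ((del * ?m)\<^sup>2 * (1 + s * (del * ?m)\<^sup>2))"
      using le p s by (intro divide_left_mono mult_mono mult_pos_pos add_left_mono mult_left_mono)
        (auto intro!: add_pos_nonneg mult_pos_pos less_le_trans[OF p le])
  qed
  moreover have "of_nat (card (cube (Suc n) - cube n)) * (1 / ((del * ?m)\<^sup>2 * (1 + s * (del * ?m)\<^sup>2)))
      \<le> 26 / (del ^ 3 * sqrt s) * (arctan (a * ?m) - arctan (a * n))"
  proof -
    have "card (cube (Suc n) - cube n) = (2 * Suc n + 1) ^ 3 - (2 * n + 1) ^ 3"
      using sub by (simp add: card_Diff_subset card_cube)
    \<comment> \<open>The shell count is \<open>24 n\<^sup>2 + 48 n + 26\<close>, against
      \<open>26 n\<^sup>2 + 52 n + 26\<close> on the right.\<close>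
    also have "\<dots> \<le> 26 * (Suc n)\<^sup>2"
      by (simp add: power2_eq_square power3_eq_cube algebra_simps)
    finally have "real (card (cube (Suc n) - cube n)) \<le> 26 * ?m\<^sup>2"
      by (metis of_nat_mono of_nat_mult of_nat_numeral of_nat_power)
    then have "of_nat (card (cube (Suc n) - cube n)) * (1 / ((del * ?m)\<^sup>2 * (1 + s * (del * ?m)\<^sup>2)))
       \<le> 26 * ?m\<^sup>2 * (1 / ((del * ?m)\<^sup>2 * (1 + s * (del * ?m)\<^sup>2)))"
      using s by (intro mult_right_mono) auto
    also have "\<dots> = 26 / del\<^sup>2 * (1 / (1 + (a * ?m)\<^sup>2))"
      using del_pos by (simp add: power_mult_distrib sd[symmetric] mult.assoc)
    also have "\<dots> \<le> 26 / del\<^sup>2 * ((arctan (a * ?m) - arctan (a * n)) / a)"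
    proof -
      \<comment> \<open>The derivative of the arctangent decreases on the positive axis, so the term
        at the right end of the interval is at most the mean value over an interval of length
        \<open>a\<close>.\<close>
      obtain z where z: "a * n < z" "z < a * ?m" "arctan (a * ?m) - arctan (a * n) = (a * ?m - a * n) * inverse (1 + z\<^sup>2)"
        using MVT2[of "a * n" "a * ?m" arctan "\<lambda>z. inverse (1 + z\<^sup>2)"] a DERIV_arctan by auto
      have "0 \<le> a * n" using a by simp
      then have "z\<^sup>2 \<le> (a * ?m)\<^sup>2" using z by (intro power_mono) linarith+
      then have "1 / (1 + (a * ?m)\<^sup>2) \<le> inverse (1 + z\<^sup>2)"
        by (simp add: inverse_eq_divide divide_left_mono add_pos_nonneg)
      also have "inverse (1 + z\<^sup>2) = (arctan (a * ?m) - arctan (a * n)) / a"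
        using z(3) a by (simp add: algebra_simps)
      finally show ?thesis using del_pos by (intro mult_left_mono) auto
    qed
    also have "\<dots> = 26 / (del ^ 3 * sqrt s) * (arctan (a * ?m) - arctan (a * n))"
      using del_pos s by (simp add: a_def power3_eq_cube power2_eq_square mult_ac)
    finally show ?thesis .
  qed
  ultimately have "sum ?f (cube (Suc n) - {0}) \<le> 26 / (del ^ 3 * sqrt s) * arctan (a * n)
     + 26 / (del ^ 3 * sqrt s) * (arctan (a * ?m) - arctan (a * n))"
    using Suc.IH unfolding a_def by linarith
  also have "\<dots> = 26 / (del ^ 3 * sqrt s) * arctan (a * ?m)" by (simp add: right_diff_distrib)
  finally show ?case by (simp only: a_def)
qed

text \<open>The shell constant 26 times the bound \<open>pi / 2\<close> of the arctangent, over the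
  cube of the frequency gap.\<close>

definition agmon :: real where "agmon = 13 * pi / del ^ 3"

lemma agmon_pos: "agmon > 0"
  using del_pos by (simp add: agmon_def)

text \<open>Cauchy--Schwarz with the weight \<open>q\<close>, whose reciprocals are summed by
  \<open>lattice_sum\<close>. The parameter \<open>s\<close> stays free: it balances the two
  quadratic sums, and their ratio varies with time.\<close>

lemma l1_coef_bound:
  fixes x :: "int^3 \<Rightarrow> complex^3"
  assumes s: "s > 0" and x0: "x 0 = 0"
  shows "(\<Sum>k\<in>cube N. norm (x k))\<^sup>2 \<le> agmon / sqrt s *
    ((\<Sum>k\<in>cube N. (norm (wave L k))\<^sup>2 * (norm (x k))\<^sup>2) + s * (\<Sum>k\<in>cube N. (norm (wave L k)) ^ 4 * (norm (x k))\<^sup>2))"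
proof -
  define q where "q = (\<lambda>k. (norm (wave L k))\<^sup>2 * (1 + s * (norm (wave L k))\<^sup>2))"
  have q: "q k > 0" if "k \<noteq> 0" for k
    using wave_nonzero[OF that] s unfolding q_def by (intro mult_pos_pos add_pos_nonneg) auto
  have "(\<Sum>k\<in>cube N. norm (x k)) = (\<Sum>k\<in>cube N - {0}. norm (x k))"
    by (rule sum.mono_neutral_right) (auto simp: x0)
  also have "\<dots> = (\<Sum>k\<in>cube N - {0}. (1 / sqrt (q k)) * (sqrt (q k) * norm (x k)))"
    by (rule sum.cong[OF refl]) (use q in \<open>auto simp: less_imp_neq[symmetric]\<close>)
  finally have "(\<Sum>k\<in>cube N. norm (x k))\<^sup>2 \<le> (\<Sum>k\<in>cube N - {0}. (1 / sqrt (q k))\<^sup>2) * (\<Sum>k\<in>cube N - {0}. (sqrt (q k) * norm (x k))\<^sup>2)"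
    by (simp only: Cauchy_Schwarz_ineq_sum)
  also have "(\<Sum>k\<in>cube N - {0}. (1 / sqrt (q k))\<^sup>2) = (\<Sum>k\<in>cube N - {0}. 1 / q k)"
    by (rule sum.cong[OF refl]) (use q in \<open>auto simp: power_divide less_imp_le\<close>)
  also have "(\<Sum>k\<in>cube N - {0}. (sqrt (q k) * norm (x k))\<^sup>2) = (\<Sum>k\<in>cube N - {0}. q k * (norm (x k))\<^sup>2)"
    by (rule sum.cong[OF refl]) (use q in \<open>auto simp: power_mult_distrib less_imp_le\<close>)
  also have "\<dots> = (\<Sum>k\<in>cube N. q k * (norm (x k))\<^sup>2)"
    by (rule sum.mono_neutral_left) (auto simp: x0)
  also have "\<dots> = (\<Sum>k\<in>cube N. (norm (wave L k))\<^sup>2 * (norm (x k))\<^sup>2) + s * (\<Sum>k\<in>cube N. (norm (wave L k)) ^ 4 * (norm (x k))\<^sup>2)"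
    unfolding sum_distrib_left sum.distrib[symmetric] q_def
    by (rule sum.cong[OF refl]) (simp add: algebra_simps power4_eq_xxxx power2_eq_square)
  also have "(\<Sum>k\<in>cube N - {0}. 1 / q k) * \<dots> \<le> agmon / sqrt s * \<dots>"
  proof (rule mult_right_mono)
    have "(\<Sum>k\<in>cube N - {0}. 1 / q k) \<le> 26 / (del ^ 3 * sqrt s) * arctan (sqrt s * del * N)"
      unfolding q_def by (rule lattice_sum[OF s])
    also have "\<dots> \<le> 26 / (del ^ 3 * sqrt s) * (pi / 2)"
      using del_pos s arctan_ubound[of "sqrt s * del * N"] by (intro mult_left_mono) auto
    also have "\<dots> = agmon / sqrt s" by (simp add: agmon_def)
    finally show "(\<Sum>k\<in>cube N - {0}. 1 / q k) \<le> agmon / sqrt s" .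
    show "0 \<le> (\<Sum>k\<in>cube N. (norm (wave L k))\<^sup>2 * (norm (x k))\<^sup>2) + s * (\<Sum>k\<in>cube N. (norm (wave L k)) ^ 4 * (norm (x k))\<^sup>2)"
      using s by (intro add_nonneg_nonneg sum_nonneg mult_nonneg_nonneg) auto
  qed
  finally show ?thesis .
qed

end

section \<open>Galerkin approximations\<close>

lemma norm2_has_derivative:
  fixes z :: "real \<Rightarrow> 'a::real_inner"
  assumes "(z has_vector_derivative z') (at t within S)"
  shows "((\<lambda>t. (norm (z t))\<^sup>2) has_real_derivative 2 * (z t \<bullet> z')) (at t within S)"
proof -
  have "((\<lambda>t. z t \<bullet> z t) has_vector_derivative z t \<bullet> z' + z' \<bullet> z t) (at t within S)"
    by (rule bounded_bilinear.has_vector_derivative[OF bounded_bilinear_inner assms assms])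
  then show ?thesis
    by (simp add: power2_norm_eq_inner inner_commute has_real_derivative_iff_has_vector_derivative)
qed

lemma sum_mult_le:
  fixes a b :: "'i \<Rightarrow> real"
  assumes "finite I" "\<And>i. i \<in> I \<Longrightarrow> a i \<ge> 0" "\<And>i. i \<in> I \<Longrightarrow> b i \<ge> 0"
  shows "(\<Sum>i\<in>I. a i * b i) \<le> (\<Sum>i\<in>I. a i) * (\<Sum>i\<in>I. b i)"
  unfolding sum_distrib_right
  using assms by (intro sum_mono mult_left_mono member_le_sum) auto

text \<open>The radial retraction onto the ball of radius \<open>R\<close> in the sum norm. A
  quadratic field composed with it is globally Lipschitz and is unchanged inside the ball.\<close>

lemma retraction_lipschitz:
  fixes x y :: "'i \<Rightarrow> 'b::real_normed_vector"
  assumes K: "finite K" and R: "R > 0"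
  defines "Nm \<equiv> \<lambda>x :: 'i \<Rightarrow> 'b. \<Sum>k\<in>K. norm (x k)"
  defines "c \<equiv> \<lambda>x. R / max R (Nm x)"
  shows "(\<Sum>k\<in>K. norm (c x *\<^sub>R x k - c y *\<^sub>R y k)) \<le> 2 * (\<Sum>k\<in>K. norm (x k - y k))"
    and "(\<Sum>k\<in>K. norm (c x *\<^sub>R x k)) \<le> R"
proof -
  define m where "m = (\<lambda>x. max R (Nm x))"
  have m: "m x \<ge> R" "m x > 0" "Nm x \<le> m x" "Nm x \<ge> 0" for x
    using R by (auto simp: m_def Nm_def sum_nonneg)
  have c: "c x = R / m x" "c x \<ge> 0" "c x \<le> 1" for x
    using R m[of x] by (auto simp: c_def m_def)
  let ?d = "\<Sum>k\<in>K. norm (x k - y k)"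
  have "\<bar>Nm x - Nm y\<bar> \<le> ?d"
    unfolding Nm_def sum_subtractf[symmetric]
    by (rule order_trans[OF sum_abs sum_mono]) (rule norm_triangle_ineq3)
  then have md: "\<bar>m y - m x\<bar> \<le> ?d" by (auto simp: m_def max_def abs_if split: if_splits)
  \<comment> \<open>Over the common denominator the difference of the factors contains
    \<open>1 / m y\<close>, which absorbs \<open>Nm y\<close>; the size of \<open>y\<close> thus
    drops out.\<close>
  have cd: "\<bar>c x - c y\<bar> * Nm y \<le> ?d"
  proof -
    have "c x - c y = c x * ((m y - m x) / m y)"
      using m(2)[of x] m(2)[of y] by (simp add: c(1) field_simps)
    then have "\<bar>c x - c y\<bar> * Nm y = c x * (\<bar>m y - m x\<bar> * (Nm y / m y))"
      using m(2)[of y] c(2)[of x] by (simp add: abs_mult)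
    also have "\<dots> \<le> 1 * (\<bar>m y - m x\<bar> * 1)"
      using m[of y] c[of x] by (intro mult_mono mult_nonneg_nonneg) auto
    finally show ?thesis using md by simp
  qed
  have "(\<Sum>k\<in>K. norm (c x *\<^sub>R x k - c y *\<^sub>R y k)) \<le> (\<Sum>k\<in>K. norm (x k - y k) + \<bar>c x - c y\<bar> * norm (y k))"
  proof (rule sum_mono)
    fix k
    have "c x *\<^sub>R x k - c y *\<^sub>R y k = c x *\<^sub>R (x k - y k) + (c x - c y) *\<^sub>R y k"
      by (simp add: algebra_simps)
    then have "norm (c x *\<^sub>R x k - c y *\<^sub>R y k) \<le> norm (c x *\<^sub>R (x k - y k)) + norm ((c x - c y) *\<^sub>R y k)"
      by (simp only: norm_triangle_ineq)
    also have "\<dots> \<le> norm (x k - y k) + \<bar>c x - c y\<bar> * norm (y k)"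
      using c(2,3)[of x] by (intro add_mono) (simp_all add: mult_left_le_one_le)
    finally show "norm (c x *\<^sub>R x k - c y *\<^sub>R y k) \<le> norm (x k - y k) + \<bar>c x - c y\<bar> * norm (y k)" .
  qed
  also have "\<dots> = ?d + \<bar>c x - c y\<bar> * Nm y" by (simp add: sum.distrib sum_distrib_left Nm_def)
  finally show "(\<Sum>k\<in>K. norm (c x *\<^sub>R x k - c y *\<^sub>R y k)) \<le> 2 * ?d" using cd by linarith
  have "(\<Sum>k\<in>K. norm (c x *\<^sub>R x k)) = c x * Nm x"
    using c(2)[of x] by (simp add: Nm_def sum_distrib_left)
  also have "\<dots> = R * (Nm x / m x)" by (simp add: c(1))
  also have "\<dots> \<le> R * 1" using m[of x] R by (intro mult_left_mono) auto
  finally show "(\<Sum>k\<in>K. norm (c x *\<^sub>R x k)) \<le> R" by simp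
qed

text \<open>\<open>b\<close> is the normalisation factor of the convolution theorem, kept abstract
  until it is set to \<open>1 / sqrt (vol L)\<close>. The constraints are part of the definition
  because the energy cancellation depends on them.\<close>

definition galerkin :: "real^3 \<Rightarrow> real \<Rightarrow> real \<Rightarrow> nat \<Rightarrow> real \<Rightarrow> (int^3 \<Rightarrow> complex^3) \<Rightarrow> (real \<Rightarrow> int^3 \<Rightarrow> complex^3) \<Rightarrow> bool" where
  "galerkin L \<nu> b N T a0 x \<longleftrightarrow>
    (\<forall>k\<in>cube N. x 0 k = a0 k) \<and> (\<forall>t k. k \<notin> cube N \<longrightarrow> x t k = 0) \<and>
    (\<forall>t\<in>{0..T}. \<forall>k\<in>cube N. ((\<lambda>t. x t k) has_vector_derivative
        - (\<nu> * (norm (wave L k))\<^sup>2) *\<^sub>R x t k - b *\<^sub>R bil L (cube N) (x t) (x t) k) (at t within {0..T})) \<and>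
    (\<forall>t\<in>{0..T}. x t 0 = 0 \<and> (\<forall>k. cdot (wave L k) (x t k) = 0 \<and> x t (- k) = cvec (x t k)))"

context periodic_box
begin

text \<open>The retracted system has a global solution. Retraction only rescales the nonlinear term,
  so the energy still cannot grow; the solution therefore stays in the ball where the retraction is
  the identity and solves the original system.\<close>

lemma galerkin_exists:
  assumes \<nu>: "\<nu> > 0" and T: "T > 0" and a0: "a0 0 = 0" "\<And>k. cdot (wave L k) (a0 k) = 0" "\<And>k. a0 (- k) = cvec (a0 k)"
  obtains x where "galerkin L \<nu> b N T a0 x"
proof -
  define K where "K = cube N"
  have K: "finite K" "\<And>k. - k \<in> K \<longleftrightarrow> k \<in> K" by (auto simp: K_def)
  define E0 where "E0 = (\<Sum>k\<in>K. (norm (a0 k))\<^sup>2)"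
  have E0: "E0 \<ge> 0" by (simp add: E0_def sum_nonneg)
  \<comment> \<open>By Cauchy--Schwarz the sum norm of a state of energy at most \<open>E0\<close>
    is at most \<open>sqrt (card K * E0)\<close>; adding 1 makes the radius positive.\<close>
  define R where "R = sqrt (card K * E0) + 1"
  have R: "R > 0" unfolding R_def using E0 by (intro add_nonneg_pos) auto
  define Nm where "Nm = (\<lambda>x :: int^3 \<Rightarrow> complex^3. \<Sum>k\<in>K. norm (x k))"
  define c where "c = (\<lambda>x. R / max R (Nm x))"
  define \<rho> where "\<rho> = (\<lambda>x k. c x *\<^sub>R x k)"
  define F where "F = (\<lambda>x k. if k \<in> K then - (\<nu> * (norm (wave L k))\<^sup>2) *\<^sub>R x k - b *\<^sub>R bil L K (\<rho> x) (\<rho> x) k else 0)"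
  have ret: "(\<Sum>k\<in>K. norm (\<rho> x k - \<rho> y k)) \<le> 2 * (\<Sum>k\<in>K. norm (x k - y k))" "(\<Sum>k\<in>K. norm (\<rho> x k)) \<le> R" for x y
    unfolding \<rho>_def c_def Nm_def by (rule retraction_lipschitz[OF K(1) R])+
  define W1 where "W1 = (\<Sum>k\<in>K. norm (wave L k))"
  define W2 where "W2 = (\<Sum>k\<in>K. (norm (wave L k))\<^sup>2)"
  have W: "W1 \<ge> 0" "W2 \<ge> 0" by (auto simp: W1_def W2_def sum_nonneg)
  \<comment> \<open>The 4 is the product of the two terms of a difference of quadratic expressions
    and the Lipschitz constant 2 of the retraction.\<close>
  define C where "C = \<nu> * W2 + 4 * \<bar>b\<bar> * R * W1 + 1"
  have C: "C > 0" unfolding C_def using \<nu> W R by (intro add_nonneg_pos add_nonneg_nonneg mult_nonneg_nonneg) auto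
  have lip: "(\<Sum>k\<in>K. norm (F x k - F y k)) \<le> C * (\<Sum>k\<in>K. norm (x k - y k))" for x y
  proof -
    let ?d = "\<Sum>k\<in>K. norm (x k - y k)"
    have d: "?d \<ge> 0" by (intro sum_nonneg) auto
    have "norm (F x k - F y k) \<le> \<nu> * (norm (wave L k))\<^sup>2 * ?d + 4 * \<bar>b\<bar> * R * norm (wave L k) * ?d" if k: "k \<in> K" for k
    proof -
      have 1: "norm (bil L K (\<rho> x) (\<rho> x) k - bil L K (\<rho> y) (\<rho> y) k) \<le> 4 * R * norm (wave L k) * ?d"
      proof -
        have "norm (bil L K (\<rho> x) (\<rho> x) k - bil L K (\<rho> y) (\<rho> y) k) \<le>
            norm (bil L K (\<lambda>j. \<rho> x j - \<rho> y j) (\<rho> x) k) + norm (bil L K (\<rho> y) (\<lambda>j. \<rho> x j - \<rho> y j) k)"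
          unfolding bil_diff[OF K(1)] by (rule norm_triangle_ineq)
        also have "\<dots> \<le> norm (wave L k) * (2 * ?d) * R + norm (wave L k) * R * (2 * ?d)"
          by (intro add_mono order_trans[OF norm_bil_le[OF K(1)]] mult_mono mult_nonneg_nonneg ret order_refl sum_nonneg norm_ge_zero d)
             (use R d in auto)
        finally show ?thesis by (simp add: mult_ac)
      qed
      have 2: "norm (x k - y k) \<le> ?d" using K k by (intro member_le_sum) auto
      have "F x k - F y k = - (\<nu> * (norm (wave L k))\<^sup>2) *\<^sub>R (x k - y k) - b *\<^sub>R (bil L K (\<rho> x) (\<rho> x) k - bil L K (\<rho> y) (\<rho> y) k)"
        using k by (simp add: F_def algebra_simps)
      then have "norm (F x k - F y k) \<le> norm (- (\<nu> * (norm (wave L k))\<^sup>2) *\<^sub>R (x k - y k)) + norm (b *\<^sub>R (bil L K (\<rho> x) (\<rho> x) k - bil L K (\<rho> y) (\<rho> y) k))"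
        by (simp only: norm_triangle_ineq4)
      also have "\<dots> = \<nu> * (norm (wave L k))\<^sup>2 * norm (x k - y k) + \<bar>b\<bar> * norm (bil L K (\<rho> x) (\<rho> x) k - bil L K (\<rho> y) (\<rho> y) k)"
        using \<nu> by (simp add: abs_mult)
      also have "\<dots> \<le> \<nu> * (norm (wave L k))\<^sup>2 * ?d + \<bar>b\<bar> * (4 * R * norm (wave L k) * ?d)"
        using \<nu> by (intro add_mono mult_left_mono 1 2) auto
      finally show ?thesis by (simp add: mult_ac)
    qed
    then have "(\<Sum>k\<in>K. norm (F x k - F y k)) \<le> (\<Sum>k\<in>K. \<nu> * (norm (wave L k))\<^sup>2 * ?d + 4 * \<bar>b\<bar> * R * norm (wave L k) * ?d)"
      by (rule sum_mono)
    also have "\<dots> = (\<nu> * W2 + 4 * \<bar>b\<bar> * R * W1) * ?d"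
      by (simp only: W1_def W2_def sum.distrib sum_distrib_right[symmetric] sum_distrib_left[symmetric] distrib_right)
    also have "\<dots> \<le> C * ?d" using d by (intro mult_right_mono) (auto simp: C_def)
    finally show ?thesis .
  qed
  obtain x where x0: "\<And>k. k \<in> K \<Longrightarrow> x 0 k = a0 k" and xout: "\<And>t k. k \<notin> K \<Longrightarrow> x t k = 0"
    and der: "\<And>k t. k \<in> K \<Longrightarrow> t \<in> {0..T} \<Longrightarrow> ((\<lambda>t. x t k) has_vector_derivative F (x t) k) (at t within {0..T})"
    using picard_lindelof[where F = F and ?x0.0 = a0, OF K(1) C T lip] by blast
  \<comment> \<open>\<open>bil\<close> is quadratic, so the retraction enters as one scalar factor
    \<open>(c y)\<^sup>2\<close> common to all modes. Hence the cancellation and all constraints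
    survive it.\<close>
  have Fx: "F y k = - (\<nu> * (norm (wave L k))\<^sup>2) *\<^sub>R y k - (b * (c y)\<^sup>2) *\<^sub>R bil L K y y k" if "k \<in> K" for y k
    using that by (simp add: F_def \<rho>_def bil_scaleR)
  have zero: "x t 0 = 0" if t: "t \<in> {0..T}" for t
  proof -
    have 0: "0 \<in> K" by (simp add: K_def)
    have "(norm (x t 0))\<^sup>2 = 0"
    proof (rule gronwall_zero[where c = 0, OF _ _ _ _ t])
      fix s assume "s \<in> {0..T}"
      then show "((\<lambda>t. (norm (x t 0))\<^sup>2) has_real_derivative 2 * (x s 0 \<bullet> F (x s) 0)) (at s within {0..T})"
        by (intro norm2_has_derivative der 0)
      show "2 * (x s 0 \<bullet> F (x s) 0) \<le> 0 * (norm (x s 0))\<^sup>2" by (simp add: Fx[OF 0] bil_0)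
    qed (auto simp: x0[OF 0] a0)
    then show ?thesis by simp
  qed
  \<comment> \<open>Since \<open>bil\<close> is solenoidal, the divergence of each mode obeys a
    linear decay equation with zero initial value.\<close>
  have div: "cdot (wave L k) (x t k) = 0" if t: "t \<in> {0..T}" for t k
  proof (cases "k \<in> K")
    case k: True
    let ?z = "\<lambda>t. cdot (wave L k) (x t k)"
    have "(norm (?z t))\<^sup>2 = 0"
    proof (rule gronwall_zero[where c = 0, OF _ _ _ _ t])
      fix s assume s: "s \<in> {0..T}"
      have e: "cdot (wave L k) (F (x s) k) = - (\<nu> * (norm (wave L k))\<^sup>2) *\<^sub>R ?z s"
        by (simp add: Fx[OF k] cdot_diff cdot_scaleR cdot_bil del: scaleR_minus_left)
      show "((\<lambda>t. (norm (?z t))\<^sup>2) has_real_derivative 2 * (?z s \<bullet> cdot (wave L k) (F (x s) k))) (at s within {0..T})"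
        by (intro norm2_has_derivative bounded_linear.has_vector_derivative[OF bounded_linear_cdot] der k s)
      show "2 * (?z s \<bullet> cdot (wave L k) (F (x s) k)) \<le> 0 * (norm (?z s))\<^sup>2"
        using \<nu> unfolding e inner_scaleR_right by (simp add: mult_nonneg_nonneg)
    qed (auto simp: x0[OF k] a0)
    then show ?thesis by simp
  qed (simp add: xout)
  have re: "x t (- k) = cvec (x t k)" if t: "t \<in> {0..T}" for t k
  proof -
    \<comment> \<open>The reflected conjugate solves the same system with the same initial value;
      comparing it with \<open>x\<close> by Gronwall gives reality.\<close>
    define y where "y = (\<lambda>t k. cvec (x t (- k)))"
    have Fy: "F (y t) k = cvec (F (x t) (- k))" if k: "k \<in> K" for t k
    proof -
      have "Nm (y t) = Nm (x t)"
        unfolding Nm_def y_def norm_cvec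
        by (rule sum.reindex_bij_witness[of _ uminus uminus]) (auto simp: K)
      then have cc: "c (y t) = c (x t)" by (simp add: c_def)
      have k': "- k \<in> K" using k K by simp
      note l = bounded_linear.linear[OF bounded_linear_cvec]
      show ?thesis
        unfolding Fx[OF k] Fx[OF k'] cc linear_diff[OF l] linear_cmul[OF l]
        by (simp only: y_def bil_cvec[OF K(2)] wave_minus norm_minus_cancel)
    qed
    let ?g = "\<lambda>t. \<Sum>k\<in>K. (norm (x t k - y t k))\<^sup>2"
    have "?g t = 0"
    proof (rule gronwall_zero[where c = "2 * C * card K", OF _ _ _ _ t])
      fix s assume s: "s \<in> {0..T}"
      show "(?g has_real_derivative (\<Sum>k\<in>K. 2 * ((x s k - y s k) \<bullet> (F (x s) k - F (y s) k)))) (at s within {0..T})"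
      proof (rule DERIV_sum)
        fix k assume k: "k \<in> K"
        then have k': "- k \<in> K" using K by simp
        show "((\<lambda>t. (norm (x t k - y t k))\<^sup>2) has_real_derivative 2 * ((x s k - y s k) \<bullet> (F (x s) k - F (y s) k))) (at s within {0..T})"
          unfolding Fy[OF k] unfolding y_def
          by (intro norm2_has_derivative has_vector_derivative_diff der k s
             bounded_linear.has_vector_derivative[OF bounded_linear_cvec] k')
      qed
      have "(\<Sum>k\<in>K. 2 * ((x s k - y s k) \<bullet> (F (x s) k - F (y s) k))) \<le> (\<Sum>k\<in>K. 2 * (norm (x s k - y s k) * norm (F (x s) k - F (y s) k)))"
        by (intro sum_mono mult_left_mono norm_cauchy_schwarz) auto
      also have "\<dots> = 2 * (\<Sum>k\<in>K. norm (x s k - y s k) * norm (F (x s) k - F (y s) k))"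
        by (simp only: sum_distrib_left)
      also have "\<dots> \<le> 2 * ((\<Sum>k\<in>K. norm (x s k - y s k)) * (\<Sum>k\<in>K. norm (F (x s) k - F (y s) k)))"
        using K by (intro mult_left_mono sum_mult_le) auto
      also have "\<dots> \<le> 2 * ((\<Sum>k\<in>K. norm (x s k - y s k)) * (C * (\<Sum>k\<in>K. norm (x s k - y s k))))"
        by (intro mult_left_mono lip) (auto intro: sum_nonneg)
      also have "\<dots> = 2 * C * (\<Sum>k\<in>K. norm (x s k - y s k))\<^sup>2" by (simp add: power2_eq_square mult_ac)
      also have "\<dots> \<le> 2 * C * (?g s * card K)"
        using C by (intro mult_left_mono sum_squared_le_sum_of_squares) auto
      finally show "(\<Sum>k\<in>K. 2 * ((x s k - y s k) \<bullet> (F (x s) k - F (y s) k))) \<le> 2 * C * card K * ?g s"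
        by (simp add: mult_ac)
    next
      have "x 0 k = y 0 k" if "k \<in> K" for k
        using that K(2)[of k] a0(3)[of "- k"] by (simp add: y_def x0)
      then show "?g 0 = 0" by simp
      show "0 \<le> ?g t" by (intro sum_nonneg) auto
    qed
    then have "x t k = y t k" if "k \<in> K" for k
      using that K by (simp add: sum_nonneg_eq_0_iff)
    moreover have "x t k = y t k" if "k \<notin> K" for k
      using that K(2)[of k] by (simp add: y_def xout cvec_def vec_eq_iff)
    ultimately have "x t (- k) = y t (- k)" by blast
    then show ?thesis by (simp add: y_def)
  qed
  define E where "E = (\<lambda>t. \<Sum>k\<in>K. (norm (x t k))\<^sup>2)"
  have En: "E t \<le> E 0" if t: "t \<in> {0..T}" for t
  proof (rule nonincreasing_on_interval[OF _ _ t])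
    fix s assume s: "s \<in> {0..T}"
    show "(E has_real_derivative (\<Sum>k\<in>K. 2 * (x s k \<bullet> F (x s) k))) (at s within {0..T})"
      unfolding E_def by (intro DERIV_sum norm2_has_derivative der s)
    have "(\<Sum>k\<in>K. 2 * (x s k \<bullet> F (x s) k)) = (\<Sum>k\<in>K. - (2 * \<nu>) * ((norm (wave L k))\<^sup>2 * (norm (x s k))\<^sup>2) - 2 * b * (c (x s))\<^sup>2 * (x s k \<bullet> bil L K (x s) (x s) k))"
      by (intro sum.cong refl) (simp add: Fx inner_diff_right dot_square_norm algebra_simps)
    also have "\<dots> = - (2 * \<nu>) * (\<Sum>k\<in>K. (norm (wave L k))\<^sup>2 * (norm (x s k))\<^sup>2) - 2 * b * (c (x s))\<^sup>2 * (\<Sum>k\<in>K. x s k \<bullet> bil L K (x s) (x s) k)"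
      by (simp only: sum_subtractf sum_distrib_left)
    also have "(\<Sum>k\<in>K. x s k \<bullet> bil L K (x s) (x s) k) = 0"
      by (rule energy_cancellation[OF K div[OF s] re[OF s]])
    finally show "(\<Sum>k\<in>K. 2 * (x s k \<bullet> F (x s) k)) \<le> 0"
      using \<nu> by (simp add: sum_nonneg)
  qed
  \<comment> \<open>The energy bound keeps the solution within radius \<open>R\<close>, so the
    retraction was never active.\<close>
  have c1: "c (x t) = 1" if t: "t \<in> {0..T}" for t
  proof -
    have "(Nm (x t))\<^sup>2 \<le> E t * card K" unfolding Nm_def E_def by (rule sum_squared_le_sum_of_squares)
    also have "\<dots> \<le> E0 * card K" using En[OF t] x0 by (intro mult_right_mono) (auto simp: E_def E0_def)
    finally have "Nm (x t) \<le> sqrt (card K * E0)" by (intro real_le_rsqrt) (simp add: mult.commute)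
    then have "Nm (x t) \<le> R" by (simp add: R_def)
    then show ?thesis using R by (simp add: c_def max_def)
  qed
  have "galerkin L \<nu> b N T a0 x"
    unfolding galerkin_def K_def[symmetric]
  proof (intro conjI ballI allI impI)
    fix t k assume t: "t \<in> {0..T}" and k: "k \<in> K"
    have "F (x t) k = - (\<nu> * (norm (wave L k))\<^sup>2) *\<^sub>R x t k - b *\<^sub>R bil L K (x t) (x t) k"
      by (simp add: Fx[OF k] c1[OF t])
    then show "((\<lambda>t. x t k) has_vector_derivative - (\<nu> * (norm (wave L k))\<^sup>2) *\<^sub>R x t k - b *\<^sub>R bil L K (x t) (x t) k) (at t within {0..T})"
      using der[OF k t] by (simp only:)
  qed (auto simp: x0 xout zero div re)
  then show ?thesis by (rule that)
qed

text \<open>Young's convolution inequality with one factor in l1 and two in l2: for a fixed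
  \<open>j\<close> Cauchy--Schwarz is applied in \<open>k\<close>, and the norms of
  \<open>x j\<close> are summed last.\<close>

lemma trilinear_bound:
  fixes x :: "int^3 \<Rightarrow> complex^3"
  assumes div: "\<And>k. cdot (wave L k) (x k) = 0" and K: "finite K"
  shows "\<bar>\<Sum>k\<in>K. (norm (wave L k))\<^sup>2 * (x k \<bullet> bil L K x x k)\<bar> \<le> (\<Sum>k\<in>K. norm (x k)) *
    (sqrt (\<Sum>k\<in>K. (norm (wave L k)) ^ 4 * (norm (x k))\<^sup>2) * sqrt (\<Sum>k\<in>K. (norm (wave L k))\<^sup>2 * (norm (x k))\<^sup>2))"
proof -
  let ?f = "\<lambda>k. (norm (wave L k))\<^sup>2 * norm (x k)" and ?g = "\<lambda>k. norm (wave L k) * norm (x k)"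
  have b: "norm (bil L K x x k) \<le> (\<Sum>j | j \<in> K \<and> k - j \<in> K. norm (x j) * ?g (k - j))" for k
    unfolding bil_def
  proof (rule sum_norm_le)
    fix j
    \<comment> \<open>Solenoidality moves the derivative to the factor with index
      \<open>k - j\<close>, so that the gradient norm appears and not a third derivative count on
      the output frequency.\<close>
    have "cdot (wave L k) (x j) = cdot (wave L (k - j)) (x j)"
      by (simp add: wave_diff cdot_left_diff div)
    then have "norm (\<i> * cdot (wave L k) (x j)) \<le> norm (wave L (k - j)) * norm (x j)"
      using norm_cdot_le[of "wave L (k - j)" "x j"] by (simp add: norm_mult)
    then have "norm (\<i> * cdot (wave L k) (x j)) * norm (pr (wave L k) (x (k - j))) \<le> (norm (wave L (k - j)) * norm (x j)) * norm (x (k - j))"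
      by (intro mult_mono norm_pr_le) auto
    then show "norm ((\<i> * cdot (wave L k) (x j)) *s pr (wave L k) (x (k - j))) \<le> norm (x j) * ?g (k - j)"
      unfolding norm_smult by (simp add: mult_ac)
  qed
  have inner: "(\<Sum>k | k \<in> K \<and> k - j \<in> K. ?f k * ?g (k - j)) \<le> sqrt (\<Sum>k\<in>K. (?f k)\<^sup>2) * sqrt (\<Sum>k\<in>K. (?g k)\<^sup>2)" for j
  proof -
    let ?I = "{k. k \<in> K \<and> k - j \<in> K}"
    have "(\<Sum>k\<in>?I. ?f k * ?g (k - j)) = (\<Sum>k\<in>?I. \<bar>?f k\<bar> * \<bar>?g (k - j)\<bar>)" by simp
    also have "\<dots> \<le> L2_set ?f ?I * L2_set (\<lambda>k. ?g (k - j)) ?I" by (rule L2_set_mult_ineq)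
    also have "\<dots> \<le> L2_set ?f K * L2_set ?g K"
    proof (rule mult_mono)
      show "L2_set ?f ?I \<le> L2_set ?f K"
        unfolding L2_set_def using K by (intro real_sqrt_le_mono sum_mono2) auto
      have "(\<Sum>k\<in>?I. (?g (k - j))\<^sup>2) = (\<Sum>k\<in>(\<lambda>k. k - j) ` ?I. (?g k)\<^sup>2)"
        by (subst sum.reindex) (auto simp: inj_on_def)
      also have "\<dots> \<le> (\<Sum>k\<in>K. (?g k)\<^sup>2)" using K by (intro sum_mono2) auto
      finally show "L2_set (\<lambda>k. ?g (k - j)) ?I \<le> L2_set ?g K"
        unfolding L2_set_def by (rule real_sqrt_le_mono)
    qed (auto simp: L2_set_nonneg)
    finally show ?thesis by (simp only: L2_set_def)
  qed
  have "\<bar>\<Sum>k\<in>K. (norm (wave L k))\<^sup>2 * (x k \<bullet> bil L K x x k)\<bar> \<le> (\<Sum>k\<in>K. ?f k * (\<Sum>j | j \<in> K \<and> k - j \<in> K. norm (x j) * ?g (k - j)))"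
  proof (rule order_trans[OF sum_abs sum_mono])
    fix k
    have "\<bar>x k \<bullet> bil L K x x k\<bar> \<le> norm (x k) * (\<Sum>j | j \<in> K \<and> k - j \<in> K. norm (x j) * ?g (k - j))"
      by (rule order_trans[OF Cauchy_Schwarz_ineq2 mult_left_mono[OF b]]) auto
    then have "(norm (wave L k))\<^sup>2 * \<bar>x k \<bullet> bil L K x x k\<bar> \<le> (norm (wave L k))\<^sup>2 * (norm (x k) * (\<Sum>j | j \<in> K \<and> k - j \<in> K. norm (x j) * ?g (k - j)))"
      by (rule mult_left_mono) auto
    then show "\<bar>(norm (wave L k))\<^sup>2 * (x k \<bullet> bil L K x x k)\<bar> \<le> ?f k * (\<Sum>j | j \<in> K \<and> k - j \<in> K. norm (x j) * ?g (k - j))"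
      by (simp only: abs_mult abs_power2 mult.assoc)
  qed
  also have "\<dots> = (\<Sum>k\<in>K. \<Sum>j | j \<in> K \<and> k - j \<in> K. norm (x j) * (?f k * ?g (k - j)))"
    by (simp only: sum_distrib_left mult.left_commute)
  also have "\<dots> = (\<Sum>j\<in>K. \<Sum>k | k \<in> K \<and> k - j \<in> K. norm (x j) * (?f k * ?g (k - j)))"
    by (rule sum.swap_restrict[OF K K])
  also have "\<dots> = (\<Sum>j\<in>K. norm (x j) * (\<Sum>k | k \<in> K \<and> k - j \<in> K. ?f k * ?g (k - j)))"
    by (simp only: sum_distrib_left)
  also have "\<dots> \<le> (\<Sum>j\<in>K. norm (x j) * (sqrt (\<Sum>k\<in>K. (?f k)\<^sup>2) * sqrt (\<Sum>k\<in>K. (?g k)\<^sup>2)))"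
    by (intro sum_mono mult_left_mono inner) auto
  also have "\<dots> = (\<Sum>j\<in>K. norm (x j)) * (sqrt (\<Sum>k\<in>K. (?f k)\<^sup>2) * sqrt (\<Sum>k\<in>K. (?g k)\<^sup>2))"
    by (simp only: sum_distrib_right)
  finally show ?thesis by (simp add: power_mult_distrib flip: power_mult)
qed

text \<open>Taking \<open>s\<close> as a function of \<open>Z\<close> alone makes the bound on
  \<open>S\<^sup>2\<close> affine in \<open>A\<close>. The square of the left side is then bounded
  by the two leading terms of a completed square, whose root is the right side. No fractional powers
  occur, and \<open>A = 0\<close> is not a special case.\<close>

lemma absorb_cubic:
  fixes A Z S b \<nu> :: real
  assumes \<nu>: "\<nu> > 0" and b: "b > 0" and A: "A \<ge> 0" and Z: "Z \<ge> 0" and S: "S \<ge> 0" and G: "G > 0"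
    and le: "\<And>s. s > 0 \<Longrightarrow> S\<^sup>2 \<le> G / sqrt s * (Z + s * A)"
  shows "2 * b * (S * (sqrt A * sqrt Z)) \<le> \<nu> * A + 8 * (b\<^sup>2 * G)\<^sup>2 / \<nu> ^ 3 * Z ^ 3"
proof (cases "Z = 0")
  case True then show ?thesis using \<nu> A by simp
next
  case False
  then have Z: "Z > 0" using Z by simp
  define q where "q = b\<^sup>2 * G"
  have q: "q > 0" using b G by (simp add: q_def)
  \<comment> \<open>Determined by \<open>4 q / d = \<nu>\<^sup>2\<close>, the coefficient of
    \<open>A\<^sup>2\<close> in the square of the right side.\<close>
  define d where "d = 4 * q / \<nu>\<^sup>2"
  have d: "d > 0" using q \<nu> by (simp add: d_def)
  have "S\<^sup>2 \<le> G / sqrt (1 / (d * Z)\<^sup>2) * (Z + 1 / (d * Z)\<^sup>2 * A)"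
    using d Z by (intro le) simp
  also have "sqrt (1 / (d * Z)\<^sup>2) = 1 / (d * Z)"
    using d Z by (simp add: real_sqrt_divide)
  also have "G / (1 / (d * Z)) * (Z + 1 / (d * Z)\<^sup>2 * A) = G * (d * Z\<^sup>2 + A / (d * Z))"
    using d Z by (simp add: field_simps power2_eq_square)
  finally have S2: "S\<^sup>2 \<le> G * (d * Z\<^sup>2 + A / (d * Z))" .
  have "(2 * b * (S * (sqrt A * sqrt Z)))\<^sup>2 = 4 * b\<^sup>2 * S\<^sup>2 * (A * Z)"
    using A Z by (simp add: power_mult_distrib)
  also have "\<dots> \<le> 4 * b\<^sup>2 * (G * (d * Z\<^sup>2 + A / (d * Z))) * (A * Z)"
    using A Z by (intro mult_right_mono mult_left_mono S2) auto
  also have "\<dots> = 4 * q * d * (A * Z ^ 3) + 4 * q / d * A\<^sup>2"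
    using d Z by (simp add: q_def field_simps power2_eq_square power3_eq_cube)
  also have "4 * q / d = \<nu>\<^sup>2" using q \<nu> by (simp add: d_def)
  \<comment> \<open>The coefficient of the mixed term \<open>A Z\<^sup>3\<close> must be twice
    \<open>\<nu>\<close> times the coefficient of \<open>Z\<^sup>3\<close>; this is where the 8
    comes from.\<close>
  also have "4 * q * d = 2 * \<nu> * (8 * q\<^sup>2 / \<nu> ^ 3)" using \<nu> by (simp add: d_def field_simps power2_eq_square power3_eq_cube)
  also have "2 * \<nu> * (8 * q\<^sup>2 / \<nu> ^ 3) * (A * Z ^ 3) + \<nu>\<^sup>2 * A\<^sup>2 \<le> (\<nu> * A + 8 * q\<^sup>2 / \<nu> ^ 3 * Z ^ 3)\<^sup>2"
  proof -
    have "(\<nu> * A + w * Z ^ 3)\<^sup>2 = 2 * \<nu> * w * (A * Z ^ 3) + \<nu>\<^sup>2 * A\<^sup>2 + (w * Z ^ 3)\<^sup>2" for w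
      by (simp add: power2_eq_square algebra_simps)
    note e = this
    show ?thesis unfolding e by (simp only: le_add_same_cancel1 zero_le_power2)
  qed
  finally have "(2 * b * (S * (sqrt A * sqrt Z)))\<^sup>2 \<le> (\<nu> * A + 8 * q\<^sup>2 / \<nu> ^ 3 * Z ^ 3)\<^sup>2" .
  moreover have "0 \<le> \<nu> * A + 8 * q\<^sup>2 / \<nu> ^ 3 * Z ^ 3"
    using \<nu> A Z by (intro add_nonneg_nonneg mult_nonneg_nonneg divide_nonneg_nonneg) auto
  ultimately have "2 * b * (S * (sqrt A * sqrt Z)) \<le> \<nu> * A + 8 * q\<^sup>2 / \<nu> ^ 3 * Z ^ 3"
    by (rule power2_le_imp_le)
  then show ?thesis by (simp only: q_def)
qed

text \<open>The coefficient of \<open>Z\<^sup>3\<close> that \<open>absorb_cubic\<close> leaves when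
  \<open>G\<close> is the constant \<open>agmon\<close>. Divided by \<open>2 * \<nu>\<close> it
  becomes the constant of the theorem.\<close>

definition growth :: "real \<Rightarrow> real \<Rightarrow> real" where
  "growth \<nu> b = 8 * (b\<^sup>2 * agmon)\<^sup>2 / \<nu> ^ 3"

lemma growth_pos: "\<nu> > 0 \<Longrightarrow> b > 0 \<Longrightarrow> growth \<nu> b > 0"
  using agmon_pos by (simp add: growth_def)

lemma galerkin_bounds:
  assumes \<nu>: "\<nu> > 0" and b: "b > 0" and T: "T > 0" and g: "galerkin L \<nu> b N T a0 x"
    and small: "growth \<nu> b / (2 * \<nu>) * (\<Sum>k\<in>cube N. (norm (a0 k))\<^sup>2) + arctan (\<Sum>k\<in>cube N. wt L k * (norm (a0 k))\<^sup>2) \<le> \<theta>"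
    and \<theta>: "\<theta> < pi / 2"
  shows "t \<in> {0..T} \<Longrightarrow> (\<Sum>k\<in>cube N. wt L k * (norm (x t k))\<^sup>2) \<le> tan \<theta>"
    and "continuous_on {0..T} (\<lambda>t. \<Sum>k\<in>cube N. (norm (wave L k)) ^ 4 * (norm (x t k))\<^sup>2)"
    and "integral {0..T} (\<lambda>t. \<Sum>k\<in>cube N. (norm (wave L k)) ^ 4 * (norm (x t k))\<^sup>2) \<le> (tan \<theta> + growth \<nu> b * (tan \<theta>) ^ 3 * T) / \<nu>"
proof -
  define K where "K = cube N"
  have K: "finite K" "\<And>k. - k \<in> K \<longleftrightarrow> k \<in> K" by (auto simp: K_def)
  define C where "C = growth \<nu> b"
  have C: "C > 0" using growth_pos[OF \<nu> b] by (simp add: C_def)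
  define F where "F = (\<lambda>t k. - (\<nu> * (norm (wave L k))\<^sup>2) *\<^sub>R x t k - b *\<^sub>R bil L K (x t) (x t) k)"
  have der: "((\<lambda>t. x t k) has_vector_derivative F t k) (at t within {0..T})" if "t \<in> {0..T}" "k \<in> K" for t k
    using g that by (simp add: galerkin_def F_def K_def)
  have x0: "x 0 k = a0 k" if "k \<in> K" for k using g that by (simp add: galerkin_def K_def)
  have zero: "x t 0 = 0" and div: "cdot (wave L k) (x t k) = 0" and re: "x t (- k) = cvec (x t k)" if "t \<in> {0..T}" for t k
    using g that by (auto simp: galerkin_def)
  define E where "E = (\<lambda>t. \<Sum>k\<in>K. (norm (x t k))\<^sup>2)"
  define Z where "Z = (\<lambda>t. \<Sum>k\<in>K. (norm (wave L k))\<^sup>2 * (norm (x t k))\<^sup>2)"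
  define A where "A = (\<lambda>t. \<Sum>k\<in>K. (norm (wave L k)) ^ 4 * (norm (x t k))\<^sup>2)"
  define B where "B = (\<lambda>t. \<Sum>k\<in>K. (norm (wave L k))\<^sup>2 * (x t k \<bullet> bil L K (x t) (x t) k))"
  define X where "X = (\<lambda>t. E t + Z t)"
  have nn: "E t \<ge> 0" "Z t \<ge> 0" "A t \<ge> 0" for t by (auto simp: E_def Z_def A_def intro!: sum_nonneg)
  have Xwt: "X t = (\<Sum>k\<in>K. wt L k * (norm (x t k))\<^sup>2)" for t
    by (simp add: X_def E_def Z_def wt_def distrib_right sum.distrib)
  have dE: "(E has_real_derivative - 2 * \<nu> * Z s) (at s within {0..T})" if s: "s \<in> {0..T}" for s
  proof -
    have "(E has_real_derivative (\<Sum>k\<in>K. 2 * (x s k \<bullet> F s k))) (at s within {0..T})"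
      unfolding E_def by (intro DERIV_sum norm2_has_derivative der s)
    moreover have "(\<Sum>k\<in>K. 2 * (x s k \<bullet> F s k)) = (\<Sum>k\<in>K. - (2 * \<nu>) * ((norm (wave L k))\<^sup>2 * (norm (x s k))\<^sup>2) - 2 * b * (x s k \<bullet> bil L K (x s) (x s) k))"
      by (intro sum.cong refl) (simp add: F_def inner_diff_right dot_square_norm algebra_simps)
    moreover have "\<dots> = - 2 * \<nu> * Z s - 2 * b * (\<Sum>k\<in>K. x s k \<bullet> bil L K (x s) (x s) k)"
      unfolding Z_def by (simp only: sum_subtractf sum_distrib_left) simp
    moreover have "(\<Sum>k\<in>K. x s k \<bullet> bil L K (x s) (x s) k) = 0"
      by (rule energy_cancellation[OF K div[OF s] re[OF s]])
    ultimately show ?thesis by simp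
  qed
  have dZ: "(Z has_real_derivative - 2 * \<nu> * A s - 2 * b * B s) (at s within {0..T})" if s: "s \<in> {0..T}" for s
  proof -
    have "(Z has_real_derivative (\<Sum>k\<in>K. (norm (wave L k))\<^sup>2 * (2 * (x s k \<bullet> F s k)))) (at s within {0..T})"
      unfolding Z_def by (intro DERIV_sum DERIV_cmult norm2_has_derivative der s)
    moreover have "(\<Sum>k\<in>K. (norm (wave L k))\<^sup>2 * (2 * (x s k \<bullet> F s k))) = (\<Sum>k\<in>K. - (2 * \<nu>) * ((norm (wave L k)) ^ 4 * (norm (x s k))\<^sup>2) - 2 * b * ((norm (wave L k))\<^sup>2 * (x s k \<bullet> bil L K (x s) (x s) k)))"
      by (intro sum.cong refl) (simp add: F_def inner_diff_right dot_square_norm algebra_simps power4_eq_xxxx power2_eq_square)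
    moreover have "\<dots> = - 2 * \<nu> * A s - 2 * b * B s"
      unfolding A_def B_def by (simp only: sum_subtractf sum_distrib_left) simp
    ultimately show ?thesis by simp
  qed
  \<comment> \<open>Half of the dissipation \<open>2 * \<nu> * A\<close> is spent here; the other
    half remains for the integral bound.\<close>
  have Bb: "- 2 * b * B s \<le> \<nu> * A s + C * Z s ^ 3" if s: "s \<in> {0..T}" for s
  proof -
    have "\<bar>B s\<bar> \<le> (\<Sum>k\<in>K. norm (x s k)) * (sqrt (A s) * sqrt (Z s))"
      unfolding B_def A_def Z_def by (rule trilinear_bound[OF div[OF s] K(1)])
    then have "2 * b * \<bar>B s\<bar> \<le> 2 * b * ((\<Sum>k\<in>K. norm (x s k)) * (sqrt (A s) * sqrt (Z s)))"
      using b by (intro mult_left_mono) auto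
    also have "\<dots> \<le> \<nu> * A s + C * Z s ^ 3"
      unfolding C_def growth_def
    proof (rule absorb_cubic[OF \<nu> b nn(3) nn(2) _ agmon_pos])
      show "(\<Sum>k\<in>K. norm (x s k))\<^sup>2 \<le> agmon / sqrt \<sigma> * (Z s + \<sigma> * A s)" if "\<sigma> > 0" for \<sigma>
        unfolding Z_def A_def K_def by (rule l1_coef_bound[where x = "x s", OF that zero[OF s]])
    qed (auto intro: sum_nonneg)
    moreover have "- 2 * b * B s \<le> 2 * b * \<bar>B s\<bar>"
      using b mult_left_mono[of "- B s" "\<bar>B s\<bar>" "2 * b"] by simp
    ultimately show ?thesis by linarith
  qed
  define X' where "X' = (\<lambda>s. - 2 * \<nu> * Z s + (- 2 * \<nu> * A s - 2 * b * B s))"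
  have dX: "(X has_real_derivative X' s) (at s within {0..T})" if s: "s \<in> {0..T}" for s
    unfolding X_def X'_def by (intro DERIV_add dE dZ s)
  have X'b: "X' s + \<nu> * A s \<le> C * Z s ^ 3" if s: "s \<in> {0..T}" for s
    using Bb[OF s] nn(2)[of s] \<nu> mult_nonneg_nonneg[of \<nu> "Z s"] unfolding X'_def by linarith
  have mono: "arctan (X t) + C / (2 * \<nu>) * E t \<le> arctan (X 0) + C / (2 * \<nu>) * E 0" if t: "t \<in> {0..T}" for t
  proof (rule nonincreasing_on_interval[OF _ _ t])
    fix s assume s: "s \<in> {0..T}"
    show "((\<lambda>t. arctan (X t) + C / (2 * \<nu>) * E t) has_real_derivative inverse (1 + (X s)\<^sup>2) * X' s + C / (2 * \<nu>) * (- 2 * \<nu> * Z s)) (at s within {0..T})"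
      by (intro DERIV_add DERIV_cmult dE s DERIV_chain2[OF DERIV_arctan dX])
    have "X' s \<le> C * Z s ^ 3"
      using X'b[OF s] nn(3)[of s] \<nu> mult_nonneg_nonneg[of \<nu> "A s"] by linarith
    also have "\<dots> = C * Z s * (Z s)\<^sup>2" by (simp add: power2_eq_square power3_eq_cube)
    \<comment> \<open>The step that produces the arctangent: two of the three powers of
      \<open>Z\<close> are absorbed by \<open>1 + X\<^sup>2\<close>, and the remaining one is
      cancelled by the decay of the energy.\<close>
    also have "\<dots> \<le> C * Z s * (1 + (X s)\<^sup>2)"
    proof (rule mult_left_mono)
      have "(Z s)\<^sup>2 \<le> (X s)\<^sup>2" using nn[of s] by (intro power_mono) (auto simp: X_def)
      then show "(Z s)\<^sup>2 \<le> 1 + (X s)\<^sup>2" by simp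
    qed (use C nn[of s] in auto)
    finally have "inverse (1 + (X s)\<^sup>2) * X' s \<le> C * Z s"
      by (simp add: inverse_eq_divide pos_divide_le_eq add_pos_nonneg)
    moreover have "C / (2 * \<nu>) * (- 2 * \<nu> * Z s) = - (C * Z s)" using \<nu> by simp
    ultimately show "inverse (1 + (X s)\<^sup>2) * X' s + C / (2 * \<nu>) * (- 2 * \<nu> * Z s) \<le> 0" by linarith
  qed
  have E0: "E 0 = (\<Sum>k\<in>cube N. (norm (a0 k))\<^sup>2)" and X0: "X 0 = (\<Sum>k\<in>cube N. wt L k * (norm (a0 k))\<^sup>2)"
    by (auto simp: E_def Xwt K_def[symmetric] x0 intro!: sum.cong)
  have Xb: "X t \<le> tan \<theta>" if t: "t \<in> {0..T}" for t
  proof -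
    have "0 \<le> C / (2 * \<nu>) * E t" using C \<nu> nn by simp
    then have at: "arctan (X t) \<le> \<theta>"
      using mono[OF t] small unfolding E0[symmetric] X0[symmetric] C_def[symmetric] by linarith
    \<comment> \<open>The smallness condition is used here: the tangent is increasing only below
      \<open>pi / 2\<close>. The bound obtained does not involve the length of the time
      interval.\<close>
    have "tan (arctan (X t)) \<le> tan \<theta>"
      using at \<theta> arctan_lbound[of "X t"] by (intro tan_mono_le) auto
    then show ?thesis by (simp add: tan_arctan)
  qed
  then show "(\<Sum>k\<in>cube N. wt L k * (norm (x t k))\<^sup>2) \<le> tan \<theta>" if "t \<in> {0..T}"
    using that by (simp add: Xwt K_def)
  have xc: "continuous_on {0..T} (\<lambda>t. x t k)" if "k \<in> K" for k
    by (rule continuous_on_vector_derivative) (rule der[OF _ that])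
  have Ac: "continuous_on {0..T} A"
    unfolding A_def by (intro continuous_intros xc)
  then show "continuous_on {0..T} (\<lambda>t. \<Sum>k\<in>cube N. (norm (wave L k)) ^ 4 * (norm (x t k))\<^sup>2)"
    by (simp only: A_def K_def)
  have T0: "0 \<in> {0..T}" "T \<in> {0..T}" using T by auto
  have tan0: "tan \<theta> \<ge> 0" using Xb[OF T0(1)] nn[of 0] by (simp add: X_def)
  \<comment> \<open>With \<open>Z\<close> bounded by \<open>tan \<theta>\<close>, the sum of
    \<open>X\<close> and the integrated dissipation grows at most at a constant rate, which is
    subtracted.\<close>
  have "X T + \<nu> * integral {0..T} A - C * (tan \<theta>) ^ 3 * T \<le> X 0 + \<nu> * integral {0..0} A - C * (tan \<theta>) ^ 3 * 0"
  proof (rule nonincreasing_on_interval[OF _ _ T0(2)])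
    fix s assume s: "s \<in> {0..T}"
    have "((\<lambda>t. integral {0..t} A) has_real_derivative A s) (at s within {0..T})"
      by (rule integral_has_real_derivative[OF Ac s])
    then show "((\<lambda>t. X t + \<nu> * integral {0..t} A - C * (tan \<theta>) ^ 3 * t) has_real_derivative X' s + \<nu> * A s - C * (tan \<theta>) ^ 3 * 1) (at s within {0..T})"
      by (intro DERIV_add DERIV_diff DERIV_cmult dX s DERIV_ident)
    have "Z s ^ 3 \<le> (tan \<theta>) ^ 3" using Xb[OF s] nn[of s] by (intro power_mono) (auto simp: X_def)
    then have "C * Z s ^ 3 \<le> C * (tan \<theta>) ^ 3" using C by (intro mult_left_mono) auto
    then show "X' s + \<nu> * A s - C * (tan \<theta>) ^ 3 * 1 \<le> 0" using X'b[OF s] by simp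
  qed
  then have "\<nu> * integral {0..T} A \<le> tan \<theta> + C * (tan \<theta>) ^ 3 * T"
    using Xb[OF T0(1)] nn[of T] by (simp add: X_def)
  then have "integral {0..T} A \<le> (tan \<theta> + C * (tan \<theta>) ^ 3 * T) / \<nu>"
    using \<nu> by (simp add: pos_le_divide_eq mult.commute)
  then show "integral {0..T} (\<lambda>t. \<Sum>k\<in>cube N. (norm (wave L k)) ^ 4 * (norm (x t k))\<^sup>2) \<le> (tan \<theta> + growth \<nu> b * (tan \<theta>) ^ 3 * T) / \<nu>"
    unfolding A_def K_def C_def .
qed

end

section \<open>Passage to the limit\<close>

text \<open>The full convolution. With \<open>wave L k\<close> outside the sum its terms are bounded
  by products of coefficients, so the series converges for square summable \<open>a\<close>, without
  any summability of derivatives.\<close>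

definition nlin :: "real^3 \<Rightarrow> (int^3 \<Rightarrow> complex^3) \<Rightarrow> int^3 \<Rightarrow> complex^3" where
  "nlin L a k = (\<Sum>\<^sub>\<infinity>j. (\<i> * cdot (wave L k) (a j)) *s pr (wave L k) (a (k - j)))"

text \<open>Phrased with finite sums so that it passes to coefficientwise limits at once.\<close>

definition wt_bounded :: "real^3 \<Rightarrow> real \<Rightarrow> (int^3 \<Rightarrow> complex^3) \<Rightarrow> bool" where
  "wt_bounded L B y \<longleftrightarrow> (\<forall>F. finite F \<longrightarrow> (\<Sum>k\<in>F. wt L k * (norm (y k))\<^sup>2) \<le> B)"

lemma wt_bounded_sum:
  assumes "wt_bounded L B y" "finite F" shows "(\<Sum>k\<in>F. (norm (y k))\<^sup>2) \<le> B"
proof -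
  have "(\<Sum>k\<in>F. (norm (y k))\<^sup>2) \<le> (\<Sum>k\<in>F. wt L k * (norm (y k))\<^sup>2)"
  proof (rule sum_mono)
    fix k show "(norm (y k))\<^sup>2 \<le> wt L k * (norm (y k))\<^sup>2"
      using mult_right_mono[OF wt_ge_1[of L k], of "(norm (y k))\<^sup>2"] by simp
  qed
  then show ?thesis using assms by (force simp: wt_bounded_def)
qed

lemma wt_bounded_nonneg: "wt_bounded L B y \<Longrightarrow> B \<ge> 0"
  unfolding wt_bounded_def by (metis finite.emptyI sum.empty)

lemma wt_bounded_norm: "wt_bounded L B y \<Longrightarrow> norm (y k) \<le> sqrt B"
  using wt_bounded_sum[of L B y "{k}"] by (simp add: real_le_rsqrt)

lemma wt_bounded_limit:
  assumes lim: "\<And>j. (\<lambda>n. y n j) \<longlonglongrightarrow> a j" and b: "\<And>n. wt_bounded L B (y n)"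
  shows "wt_bounded L B a"
  unfolding wt_bounded_def
proof (intro allI impI)
  fix F :: "(int^3) set" assume F: "finite F"
  have "(\<lambda>n. \<Sum>k\<in>F. wt L k * (norm (y n k))\<^sup>2) \<longlonglongrightarrow> (\<Sum>k\<in>F. wt L k * (norm (a k))\<^sup>2)"
    by (intro tendsto_intros lim)
  then show "(\<Sum>k\<in>F. wt L k * (norm (a k))\<^sup>2) \<le> B"
    by (rule LIMSEQ_le_const2) (use b F in \<open>auto simp: wt_bounded_def\<close>)
qed

lemma norm_nlin_term_le:
  "norm ((\<i> * cdot (wave L k) (a j)) *s pr (wave L k) (a (k - j))) \<le> norm (wave L k) * (norm (a j) * norm (a (k - j)))"
proof -
  have "norm (\<i> * cdot (wave L k) (a j)) \<le> norm (wave L k) * norm (a j)"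
    using norm_cdot_le[of "wave L k" "a j"] by (simp add: norm_mult)
  then have "norm (\<i> * cdot (wave L k) (a j)) * norm (pr (wave L k) (a (k - j))) \<le> (norm (wave L k) * norm (a j)) * norm (a (k - j))"
    by (intro mult_mono norm_pr_le) auto
  then show ?thesis by (simp add: norm_smult mult.assoc)
qed

lemma conv_sum_le:
  assumes F: "finite F" and y: "wt_bounded L B y" and s: "(\<Sum>j\<in>F. (norm (y j))\<^sup>2) \<le> e"
  shows "(\<Sum>j\<in>F. norm (y j) * norm (y (k - j))) \<le> sqrt e * sqrt B"
proof -
  have "(\<Sum>j\<in>F. (norm (y (k - j)))\<^sup>2) = (\<Sum>j\<in>(\<lambda>j. k - j) ` F. (norm (y j))\<^sup>2)"
    by (subst sum.reindex) (auto simp: inj_on_def)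
  also have "\<dots> \<le> B" using F by (intro wt_bounded_sum[OF y]) auto
  finally have 2: "(\<Sum>j\<in>F. (norm (y (k - j)))\<^sup>2) \<le> B" .
  have "(\<Sum>j\<in>F. norm (y j) * norm (y (k - j))) = (\<Sum>j\<in>F. \<bar>norm (y j)\<bar> * \<bar>norm (y (k - j))\<bar>)" by simp
  also have "\<dots> \<le> L2_set (\<lambda>j. norm (y j)) F * L2_set (\<lambda>j. norm (y (k - j))) F"
    by (rule L2_set_mult_ineq)
  also have "\<dots> \<le> sqrt e * sqrt B"
    unfolding L2_set_def using s 2 by (intro mult_mono real_sqrt_le_mono) (auto intro: sum_nonneg order_trans[OF sum_nonneg s])
  finally show ?thesis .
qed

lemma bounded_linear_pr: "bounded_linear (pr \<kappa>)"
proof (rule bounded_linear_intro[where K = 1])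
  show "pr \<kappa> (x + y) = pr \<kappa> x + pr \<kappa> y" for x y
    by (simp add: pr_def cdot_add vec_eq_iff add_divide_distrib distrib_right)
  show "pr \<kappa> (r *\<^sub>R x) = r *\<^sub>R pr \<kappa> x" for r x by (rule pr_scaleR)
  show "norm (pr \<kappa> x) \<le> norm x * 1" for x by (simp add: norm_pr_le)
qed

lemma norm_add_diff_le: "norm (a + b - c) \<le> norm a + norm b + norm (c :: 'a::real_normed_vector)"
  using norm_triangle_ineq4[of "a + b" c] norm_triangle_ineq[of a b] by linarith

context periodic_box
begin

text \<open>Outside the cube of size \<open>R\<close> the weight is at least
  \<open>(del * (R + 1))\<^sup>2\<close>, so the weighted bound makes the tail in one factor small.
  The estimate is uniform in \<open>y\<close>, and this uniformity takes the place of a compact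
  embedding.\<close>

lemma conv_tail_le:
  assumes F: "finite F" "F \<inter> cube R = {}" and y: "wt_bounded L B y"
  shows "(\<Sum>j\<in>F. norm (y j) * norm (y (k - j))) \<le> B / (del * (R + 1))"
proof -
  have d: "del * real (R + 1) > 0" using del_pos by simp
  have B: "B \<ge> 0" by (rule wt_bounded_nonneg[OF y])
  have "(\<Sum>j\<in>F. (norm (y j))\<^sup>2) \<le> (\<Sum>j\<in>F. wt L j * (norm (y j))\<^sup>2 / (del * (R + 1))\<^sup>2)"
  proof (rule sum_mono)
    fix j assume "j \<in> F"
    then have "j \<notin> cube R" using F by blast
    then obtain i where "\<bar>j $ i\<bar> > int R" by (auto simp: cube_def not_le)
    then have "del * (real (Suc R)) \<le> norm (wave L j)" by (intro norm_wave_ge[of "Suc R" j i]) simp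
    then have "(del * real (R + 1))\<^sup>2 \<le> (norm (wave L j))\<^sup>2" using d by (intro power_mono) auto
    then have "(del * real (R + 1))\<^sup>2 * (norm (y j))\<^sup>2 \<le> wt L j * (norm (y j))\<^sup>2"
      by (intro mult_right_mono) (auto simp: wt_def)
    then show "(norm (y j))\<^sup>2 \<le> wt L j * (norm (y j))\<^sup>2 / (del * (R + 1))\<^sup>2"
      using d by (subst pos_le_divide_eq) (simp_all only: zero_less_power mult.commute)
  qed
  also have "\<dots> \<le> B / (del * (R + 1))\<^sup>2"
    unfolding sum_divide_distrib[symmetric] using y F by (intro divide_right_mono) (auto simp: wt_bounded_def)
  finally have "(\<Sum>j\<in>F. norm (y j) * norm (y (k - j))) \<le> sqrt (B / (del * (R + 1))\<^sup>2) * sqrt B"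
    by (rule conv_sum_le[OF F(1) y])
  also have "\<dots> = (sqrt B * sqrt B) / (del * (R + 1))"
    by (simp only: real_sqrt_divide real_sqrt_abs abs_of_pos[OF d] times_divide_eq_left)
  also have "\<dots> = B / (del * (R + 1))" using B by simp
  finally show ?thesis .
qed

lemma nlin_has_sum:
  assumes y: "wt_bounded L B y"
  shows "((\<lambda>j. (\<i> * cdot (wave L k) (y j)) *s pr (wave L k) (y (k - j))) has_sum nlin L y k) UNIV"
proof -
  let ?f = "\<lambda>j. (\<i> * cdot (wave L k) (y j)) *s pr (wave L k) (y (k - j))"
  have "(\<lambda>j. norm (?f j)) summable_on UNIV"
  proof (rule nonneg_bdd_above_summable_on)
    show "bdd_above (sum (\<lambda>j. norm (?f j)) ` {F. F \<subseteq> UNIV \<and> finite F})"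
    proof (rule bdd_aboveI, safe)
      fix F :: "(int^3) set" assume F: "finite F"
      have "(\<Sum>j\<in>F. norm (?f j)) \<le> (\<Sum>j\<in>F. norm (wave L k) * (norm (y j) * norm (y (k - j))))"
        by (intro sum_mono norm_nlin_term_le)
      also have "\<dots> \<le> norm (wave L k) * (sqrt B * sqrt B)"
        unfolding sum_distrib_left[symmetric]
        by (intro mult_left_mono conv_sum_le[OF F y] wt_bounded_sum[OF y F]) auto
      finally show "(\<Sum>j\<in>F. norm (?f j)) \<le> norm (wave L k) * (sqrt B * sqrt B)" .
    qed
  qed auto
  then have "?f summable_on UNIV" by (rule abs_summable_summable)
  then show ?thesis unfolding nlin_def by (rule has_sum_infsum)
qed

lemma nlin_partial_sum:
  assumes y: "wt_bounded L B y"
  shows "norm (nlin L y k - (\<Sum>j\<in>cube R. (\<i> * cdot (wave L k) (y j)) *s pr (wave L k) (y (k - j)))) \<le> norm (wave L k) * (B / (del * (R + 1)))"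
proof -
  let ?f = "\<lambda>j. (\<i> * cdot (wave L k) (y j)) *s pr (wave L k) (y (k - j))"
  have "(\<lambda>n. norm (sum ?f (cube n) - sum ?f (cube R))) \<longlonglongrightarrow> norm (nlin L y k - sum ?f (cube R))"
    by (intro tendsto_norm tendsto_diff tendsto_const has_sum_cube nlin_has_sum[OF y])
  then show ?thesis
  proof (rule LIMSEQ_le_const2, intro exI[of _ R] allI impI)
    fix n assume "n \<ge> R"
    then have "sum ?f (cube n) - sum ?f (cube R) = sum ?f (cube n - cube R)"
      by (intro sum_diff[symmetric] cube_mono) auto
    then have "norm (sum ?f (cube n) - sum ?f (cube R)) \<le> (\<Sum>j\<in>cube n - cube R. norm (wave L k) * (norm (y j) * norm (y (k - j))))"
      by (simp only:) (intro sum_norm_le norm_nlin_term_le)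
    also have "\<dots> \<le> norm (wave L k) * (B / (del * (R + 1)))"
      unfolding sum_distrib_left[symmetric] by (intro mult_left_mono conv_tail_le y) auto
    finally show "norm (sum ?f (cube n) - sum ?f (cube R)) \<le> norm (wave L k) * (B / (del * (R + 1)))" .
  qed
qed

lemma nlin_bound:
  assumes y: "wt_bounded L B y" shows "norm (nlin L y k) \<le> norm (wave L k) * B"
proof -
  let ?f = "\<lambda>j. (\<i> * cdot (wave L k) (y j)) *s pr (wave L k) (y (k - j))"
  have "norm (sum ?f (cube n)) \<le> norm (wave L k) * B" for n
  proof -
    have "norm (sum ?f (cube n)) \<le> (\<Sum>j\<in>cube n. norm (wave L k) * (norm (y j) * norm (y (k - j))))"
      by (intro sum_norm_le norm_nlin_term_le)
    also have "\<dots> \<le> norm (wave L k) * (sqrt B * sqrt B)"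
      unfolding sum_distrib_left[symmetric]
      by (intro mult_left_mono conv_sum_le[OF _ y] wt_bounded_sum[OF y]) auto
    finally show ?thesis using wt_bounded_nonneg[OF y] by simp
  qed
  then show ?thesis
    by (intro LIMSEQ_le_const2[OF tendsto_norm[OF has_sum_cube[OF nlin_has_sum[OF y]]]]) auto
qed

text \<open>Up to tails that are uniformly small, only finitely many terms matter, and each of these
  is continuous in two coefficients. So coefficientwise convergence is enough for the nonlinear
  term.\<close>

lemma nlin_tendsto:
  assumes lim: "\<And>j. (\<lambda>n. y n j) \<longlonglongrightarrow> a j" and b: "\<And>n. wt_bounded L B (y n)"
  shows "(\<lambda>n. nlin L (y n) k) \<longlonglongrightarrow> nlin L a k"
proof (rule LIMSEQ_I)
  fix e :: real assume e: "e > 0"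
  have a: "wt_bounded L B a" by (rule wt_bounded_limit[OF lim b])
  let ?f = "\<lambda>y j. (\<i> * cdot (wave L k) (y j)) *s pr (wave L k) (y (k - j))"
  have "(\<lambda>R. norm (wave L k) * (B / (del * (real R + 1)))) \<longlonglongrightarrow> norm (wave L k) * 0"
    using del_pos by (intro tendsto_intros) real_asymp
  from order_tendstoD(2)[OF this, of "e / 3"] e
  obtain R :: nat where R: "norm (wave L k) * (B / (del * (real R + 1))) < e / 3"
    by (auto simp: eventually_sequentially)
  then have R: "norm (wave L k) * (B / (del * real (R + 1))) < e / 3"
    by (simp add: add.commute)
  have "(\<lambda>n. sum (?f (y n)) (cube R)) \<longlonglongrightarrow> sum (?f a) (cube R)"
  proof (intro tendsto_sum)
    fix j
    have 1: "(\<lambda>n. cdot (wave L k) (y n j)) \<longlonglongrightarrow> cdot (wave L k) (a j)"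
      by (intro bounded_linear.tendsto[OF bounded_linear_cdot] lim)
    have 2: "(\<lambda>n. pr (wave L k) (y n (k - j))) \<longlonglongrightarrow> pr (wave L k) (a (k - j))"
      by (intro bounded_linear.tendsto[OF bounded_linear_pr] lim)
    show "(\<lambda>n. ?f (y n) j) \<longlonglongrightarrow> ?f a j"
      by (rule vec_tendstoI) (simp, intro tendsto_mult tendsto_const 1 tendsto_vec_nth[OF 2])
  qed
  from LIMSEQ_D[OF this, of "e / 3"] e
  obtain n0 where n0: "\<And>n. n \<ge> n0 \<Longrightarrow> norm (sum (?f (y n)) (cube R) - sum (?f a) (cube R)) < e / 3"
    by auto
  show "\<exists>no. \<forall>n\<ge>no. norm (nlin L (y n) k - nlin L a k) < e"
  proof (intro exI allI impI)
    fix n assume n: "n \<ge> n0"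
    have "nlin L (y n) k - nlin L a k = (nlin L (y n) k - sum (?f (y n)) (cube R)) +
       (sum (?f (y n)) (cube R) - sum (?f a) (cube R)) - (nlin L a k - sum (?f a) (cube R))" by simp
    then have "norm (nlin L (y n) k - nlin L a k) \<le> norm (nlin L (y n) k - sum (?f (y n)) (cube R)) +
       norm (sum (?f (y n)) (cube R) - sum (?f a) (cube R)) + norm (nlin L a k - sum (?f a) (cube R))"
      by (simp only: norm_add_diff_le)
    moreover define W where "W = norm (wave L k) * (B / (del * real (R + 1)))"
    note W = nlin_partial_sum[OF b[of n], of k R, folded W_def] nlin_partial_sum[OF a, of k R, folded W_def] R[folded W_def]
    ultimately show "norm (nlin L (y n) k - nlin L a k) < e"
      using W n0[OF n] by linarith
  qed
qed

text \<open>For a field supported in the cube the restrictions on \<open>j\<close> and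
  \<open>k - j\<close> are automatic. The Galerkin term is thus the full nonlinearity at the
  truncated field, and one convergence lemma serves all orders.\<close>

lemma bil_eq_nlin:
  assumes "\<And>k. k \<notin> cube N \<Longrightarrow> y k = 0"
  shows "bil L (cube N) y y k = nlin L y k"
proof -
  let ?F = "{j. j \<in> cube N \<and> k - j \<in> cube N}"
  have fin: "finite ?F" by (rule finite_subset[of _ "cube N"]) auto
  have pr0: "pr (wave L k) 0 = 0" by (simp add: pr_def vec_eq_iff)
  have "((\<lambda>j. (\<i> * cdot (wave L k) (y j)) *s pr (wave L k) (y (k - j))) has_sum bil L (cube N) y y k) UNIV"
    unfolding bil_def by (rule has_sum_finite_neutralI[OF fin]) (use assms pr0 in auto)
  then show ?thesis unfolding nlin_def by (rule infsumI[symmetric])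
qed

lemma rational_near:
  fixes t T d :: real
  assumes "T > 0" "t \<in> {0..T}" "d > 0"
  obtains q where "q \<in> \<rat>" "q \<in> {0..T}" "\<bar>t - q\<bar> < d"
proof (cases "t < T")
  case True
  then have "t < min T (t + d)" using assms by simp
  then obtain q where "q \<in> \<rat>" "t < q" "q < min T (t + d)" using Rats_dense_in_real by blast
  then show ?thesis using assms by (intro that[of q]) auto
next
  case False
  then have "max 0 (t - d) < t" using assms by auto
  then obtain q where "q \<in> \<rat>" "max 0 (t - d) < q" "q < t" using Rats_dense_in_real by blast
  then show ?thesis using assms by (intro that[of q]) auto
qed

text \<open>A diagonal sequence converges on the countable set of pairs of a rational time and a
  mode. The Lipschitz bound, uniform in \<open>n\<close> for a fixed mode, extends convergence to
  all times; the constant may grow with \<open>k\<close>.\<close>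

lemma equilipschitz_convergent_subsequence:
  fixes x :: "nat \<Rightarrow> real \<Rightarrow> int^3 \<Rightarrow> complex^3"
  assumes T: "T > 0" and bd: "\<And>n t k. t \<in> {0..T} \<Longrightarrow> norm (x n t k) \<le> B"
    and lip: "\<And>n s t k. s \<in> {0..T} \<Longrightarrow> t \<in> {0..T} \<Longrightarrow> norm (x n s k - x n t k) \<le> \<Lambda> k * \<bar>s - t\<bar>"
  shows "\<exists>r a. strict_mono r \<and> (\<forall>t\<in>{0..T}. \<forall>k. (\<lambda>n. x (r n) t k) \<longlonglongrightarrow> a t k)"
proof -
  let ?S = "(\<rat> \<inter> {0..T}) \<times> (UNIV :: (int^3) set)"
  have "countable ?S" by (intro countable_SIGMA countable_Int1 countable_rat countable_int3)
  moreover have "norm (x n (fst p) (snd p)) \<le> B" if "p \<in> ?S" for n p using that bd by auto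
  ultimately obtain r where r: "strict_mono r" "\<And>p. p \<in> ?S \<Longrightarrow> \<exists>l. (\<lambda>n. x (r n) (fst p) (snd p)) \<longlonglongrightarrow> l"
    using function_convergent_subsequence[of ?S "\<lambda>n p. x n (fst p) (snd p)" B] by blast
  have "Cauchy (\<lambda>n. x (r n) t k)" if t: "t \<in> {0..T}" for t k
  proof (rule CauchyI)
    fix e :: real assume e: "e > 0"
    define K where "K = \<bar>\<Lambda> k\<bar> + 1"
    have K: "K > 0" "\<Lambda> k \<le> K" by (auto simp: K_def)
    obtain q where q: "q \<in> \<rat>" "q \<in> {0..T}" "\<bar>t - q\<bar> < e / (3 * K)"
      using rational_near[OF T t, of "e / (3 * K)"] e K by auto
    have near: "norm (x n t k - x n q k) < e / 3" for n
    proof -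
      have "norm (x n t k - x n q k) \<le> \<Lambda> k * \<bar>t - q\<bar>" by (rule lip[OF t q(2)])
      also have "\<dots> \<le> K * \<bar>t - q\<bar>" using K by (intro mult_right_mono) auto
      also have "\<dots> < K * (e / (3 * K))" using K q by (intro mult_strict_left_mono)
      also have "\<dots> = e / 3" using K by simp
      finally show ?thesis .
    qed
    have "\<exists>l. (\<lambda>n. x (r n) q k) \<longlonglongrightarrow> l" using r(2)[of "(q, k)"] q by auto
    then have "Cauchy (\<lambda>n. x (r n) q k)" using LIMSEQ_imp_Cauchy by blast
    from CauchyD[OF this, of "e / 3"] e
    obtain n0 where n0: "\<And>m n. m \<ge> n0 \<Longrightarrow> n \<ge> n0 \<Longrightarrow> norm (x (r m) q k - x (r n) q k) < e / 3"
      by auto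
    have "norm (x (r m) t k - x (r n) t k) < e" if "m \<ge> n0" "n \<ge> n0" for m n
    proof -
      have "x (r m) t k - x (r n) t k = (x (r m) t k - x (r m) q k) + (x (r m) q k - x (r n) q k) - (x (r n) t k - x (r n) q k)" by simp
      then have "norm (x (r m) t k - x (r n) t k) \<le> norm (x (r m) t k - x (r m) q k) + norm (x (r m) q k - x (r n) q k) + norm (x (r n) t k - x (r n) q k)"
        by (simp only: norm_add_diff_le)
      then show ?thesis using near[of "r m"] near[of "r n"] n0[OF that] by linarith
    qed
    then show "\<exists>M. \<forall>m\<ge>M. \<forall>n\<ge>M. norm (x (r m) t k - x (r n) t k) < e" by blast
  qed
  then have l: "(\<lambda>n. x (r n) t k) \<longlonglongrightarrow> lim (\<lambda>n. x (r n) t k)" if "t \<in> {0..T}" for t k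
    using that by (simp add: Cauchy_convergent_iff convergent_LIMSEQ_iff)
  show ?thesis
    by (rule exI[of _ r], rule exI[of _ "\<lambda>t k. lim (\<lambda>n. x (r n) t k)"]) (intro conjI ballI allI r(1) l)
qed

text \<open>Three bounds are uniform in the order: the weighted sum by
  \<open>B = tan \<theta>\<close>, the speed of mode \<open>k\<close> by \<open>\<Lambda> k\<close>,
  and the time integral of the second order sum by \<open>B2\<close>. The equation passes to the
  limit one mode at a time, dominated by the constant \<open>\<Lambda> k\<close>.\<close>

theorem fourier_solution:
  fixes T \<nu> b :: real
  assumes \<nu>: "\<nu> > 0" and b: "b > 0" and T: "T > 0"
    and a0: "a0 0 = 0" "\<And>k. cdot (wave L k) (a0 k) = 0" "\<And>k. a0 (- k) = cvec (a0 k)"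
    and E0: "\<forall>F. finite F \<longrightarrow> (\<Sum>k\<in>F. (norm (a0 k))\<^sup>2) \<le> E0"
    and X0: "wt_bounded L X0 a0"
    and small: "growth \<nu> b / (2 * \<nu>) * E0 + arctan X0 < pi / 2"
  obtains a :: "real \<Rightarrow> int^3 \<Rightarrow> complex^3" and B B2 :: real where "\<And>k. a 0 k = a0 k"
    "\<And>t. t \<in> {0..T} \<Longrightarrow> a t 0 = 0" "\<And>t k. t \<in> {0..T} \<Longrightarrow> cdot (wave L k) (a t k) = 0"
    "\<And>t k. t \<in> {0..T} \<Longrightarrow> a t (- k) = cvec (a t k)"
    "\<And>t. t \<in> {0..T} \<Longrightarrow> wt_bounded L B (a t)"
    "\<And>k. continuous_on {0..T} (\<lambda>t. a t k)"
    "\<And>F. finite F \<Longrightarrow> integral {0..T} (\<lambda>t. \<Sum>k\<in>F. (norm (wave L k)) ^ 4 * (norm (a t k))\<^sup>2) \<le> B2"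
    "\<And>k. continuous_on {0..T} (\<lambda>s. nlin L (a s) k)"
    "\<And>t k. t \<in> {0..T} \<Longrightarrow> a t k - a0 k = integral {0..t} (\<lambda>s. - (\<nu> * (norm (wave L k))\<^sup>2) *\<^sub>R a s k - b *\<^sub>R nlin L (a s) k)"
proof -
  define \<theta> where "\<theta> = growth \<nu> b / (2 * \<nu>) * E0 + arctan X0"
  define B where "B = tan \<theta>"
  define B2 where "B2 = (B + growth \<nu> b * B ^ 3 * T) / \<nu>"
  \<comment> \<open>Truncating the initial datum only lowers both sums, and the arctangent is
    increasing, so one \<open>\<theta>\<close> serves every order.\<close>
  have sm: "growth \<nu> b / (2 * \<nu>) * (\<Sum>k\<in>cube N. (norm (a0 k))\<^sup>2) + arctan (\<Sum>k\<in>cube N. wt L k * (norm (a0 k))\<^sup>2) \<le> \<theta>" for N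
    unfolding \<theta>_def using growth_pos[OF \<nu> b] \<nu> E0 X0
    by (intro add_mono mult_left_mono) (auto simp: wt_bounded_def arctan_le_iff)
  have \<theta>: "\<theta> < pi / 2" using small by (simp add: \<theta>_def)
  have "\<exists>x. galerkin L \<nu> b N T a0 x" for N
    using galerkin_exists[OF \<nu> T a0, where N=N and b=b] by blast
  then obtain x where g: "\<And>N. galerkin L \<nu> b N T a0 (x N)" by metis
  note bounds = galerkin_bounds[OF \<nu> b T g sm \<theta>, folded B_def, folded B2_def]
  have x_init: "x N 0 k = a0 k" if "k \<in> cube N" for N k using g[of N] that by (simp add: galerkin_def)
  have x_out: "x N t k = 0" if "k \<notin> cube N" for N t k using g[of N] that by (simp add: galerkin_def)
  have x_der: "((\<lambda>t. x N t k) has_vector_derivative - (\<nu> * (norm (wave L k))\<^sup>2) *\<^sub>R x N t k - b *\<^sub>R bil L (cube N) (x N t) (x N t) k) (at t within {0..T})"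
    if "t \<in> {0..T}" "k \<in> cube N" for N t k using g[of N] that by (simp add: galerkin_def)
  have x_prop: "x N t 0 = 0" "cdot (wave L k) (x N t k) = 0" "x N t (- k) = cvec (x N t k)" if "t \<in> {0..T}" for N t k
    using g[of N] that by (auto simp: galerkin_def)
  have wtb: "wt_bounded L B (x N t)" if t: "t \<in> {0..T}" for N t
    unfolding wt_bounded_def
  proof (intro allI impI)
    fix F :: "(int^3) set" assume F: "finite F"
    have "(\<Sum>k\<in>F. wt L k * (norm (x N t k))\<^sup>2) = (\<Sum>k\<in>F \<inter> cube N. wt L k * (norm (x N t k))\<^sup>2)"
      using F by (intro sum.mono_neutral_right) (auto simp: x_out)
    also have "\<dots> \<le> (\<Sum>k\<in>cube N. wt L k * (norm (x N t k))\<^sup>2)"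
      by (intro sum_mono2) (auto intro!: mult_nonneg_nonneg order_trans[OF zero_le_one wt_ge_1])
    finally show "(\<Sum>k\<in>F. wt L k * (norm (x N t k))\<^sup>2) \<le> B" using bounds(1)[OF t, of N] by linarith
  qed
  have B: "B \<ge> 0" using wt_bounded_nonneg[OF wtb[of 0]] T by simp
  define G where "G = (\<lambda>y k. - (\<nu> * (norm (wave L k))\<^sup>2) *\<^sub>R y k - b *\<^sub>R nlin L y k)"
  \<comment> \<open>Bounds the right side of the equation for mode \<open>k\<close> in terms of the
    weighted bound alone.\<close>
  define \<Lambda> where "\<Lambda> = (\<lambda>k. \<nu> * (norm (wave L k))\<^sup>2 * sqrt B + b * (norm (wave L k) * B))"
  have \<Lambda>0: "\<Lambda> k \<ge> 0" for k using \<nu> b B by (simp add: \<Lambda>_def)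
  have Gb: "norm (G y k) \<le> \<Lambda> k" if y: "wt_bounded L B y" for y k
  proof -
    have "norm (G y k) \<le> norm (- (\<nu> * (norm (wave L k))\<^sup>2) *\<^sub>R y k) + norm (b *\<^sub>R nlin L y k)"
      unfolding G_def by (rule norm_triangle_ineq4)
    also have "\<dots> = \<nu> * (norm (wave L k))\<^sup>2 * norm (y k) + b * norm (nlin L y k)"
      using \<nu> b by (simp add: abs_mult)
    also have "\<dots> \<le> \<Lambda> k" unfolding \<Lambda>_def
      using \<nu> b by (intro add_mono mult_left_mono wt_bounded_norm[OF y] nlin_bound[OF y]) auto
    finally show ?thesis .
  qed
  have x_int: "((\<lambda>s. G (x N s) k) has_integral (x N t k - x N s k)) {s..t}"
    if "s \<in> {0..T}" "t \<in> {0..T}" "s \<le> t" "k \<in> cube N" for N s t k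
  proof (rule fundamental_theorem_of_calculus[OF that(3)])
    fix u assume "u \<in> {s..t}"
    then have u: "u \<in> {0..T}" and sub: "{s..t} \<subseteq> {0..T}" using that by auto
    have "((\<lambda>t. x N t k) has_vector_derivative G (x N u) k) (at u within {0..T})"
      unfolding G_def using x_der[OF u that(4)] bil_eq_nlin[of N "x N u" k, OF x_out] by simp
    then show "((\<lambda>t. x N t k) has_vector_derivative G (x N u) k) (at u within {s..t})"
      by (rule has_vector_derivative_within_subset[OF _ sub])
  qed
  have lip1: "norm (x N t k - x N s k) \<le> \<Lambda> k * (t - s)" if st: "s \<in> {0..T}" "t \<in> {0..T}" "s \<le> t" for N s t k
  proof (cases "k \<in> cube N")
    case True
    have "norm (x N t k - x N s k) \<le> \<Lambda> k * measure lborel {s..t}"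
    proof (rule has_integral_bound_real[OF \<Lambda>0 finite.emptyI x_int[OF st True]])
      fix u assume "u \<in> {s..t} - {}"
      then show "norm (G (x N u) k) \<le> \<Lambda> k" using st by (intro Gb wtb) auto
    qed
    then show ?thesis using st by simp
  next
    case False
    then show ?thesis using st \<Lambda>0 by (simp add: x_out)
  qed
  have lip: "norm (x N s k - x N t k) \<le> \<Lambda> k * \<bar>s - t\<bar>" if st: "s \<in> {0..T}" "t \<in> {0..T}" for N s t k
    using lip1[OF st(1) st(2), of N k] lip1[OF st(2) st(1), of N k]
    by (cases "s \<le> t") (auto simp: norm_minus_commute)
  have "\<exists>r a. strict_mono r \<and> (\<forall>t\<in>{0..T}. \<forall>k. (\<lambda>n. x (r n) t k) \<longlonglongrightarrow> a t k)"
  proof (rule equilipschitz_convergent_subsequence[OF T])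
    show "norm (x n t k) \<le> sqrt B" if "t \<in> {0..T}" for n t k by (rule wt_bounded_norm[OF wtb[OF that]])
    show "norm (x n s k - x n t k) \<le> \<Lambda> k * \<bar>s - t\<bar>" if "s \<in> {0..T}" "t \<in> {0..T}" for n s t k by (rule lip[OF that])
  qed
  then obtain r a where r: "strict_mono r" and lim': "\<forall>t\<in>{0..T}. \<forall>k. (\<lambda>n. x (r n) t k) \<longlonglongrightarrow> a t k"
    by (elim exE conjE)
  have lim: "(\<lambda>n. x (r n) t k) \<longlonglongrightarrow> a t k" if "t \<in> {0..T}" for t k
    using lim' that by blast
  \<comment> \<open>A given mode belongs to the truncated system from some order on; before that its
    equation does not hold.\<close>
  have ev: "\<forall>\<^sub>F n in sequentially. k \<in> cube (r n)" for k
  proof -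
    obtain m where "k \<in> cube m" using ex_cube by blast
    moreover have "cube m \<subseteq> cube (r n)" if "m \<le> n" for n
      using that seq_suble[OF r, of n] by (intro cube_mono) linarith
    ultimately show ?thesis
      unfolding eventually_sequentially by blast
  qed
  have T0: "0 \<in> {0..T}" using T by simp
  have init: "a 0 k = a0 k" for k
  proof (rule LIMSEQ_unique[OF lim[OF T0]])
    show "(\<lambda>n. x (r n) 0 k) \<longlonglongrightarrow> a0 k"
      by (rule tendsto_eventually, rule eventually_mono[OF ev[of k]]) (rule x_init)
  qed
  have awt: "wt_bounded L B (a t)" if t: "t \<in> {0..T}" for t
    by (rule wt_bounded_limit[OF lim[OF t] wtb[OF t]])
  have alip: "norm (a s k - a t k) \<le> \<Lambda> k * \<bar>s - t\<bar>" if st: "s \<in> {0..T}" "t \<in> {0..T}" for s t k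
    by (rule LIMSEQ_le_const2[OF tendsto_norm[OF tendsto_diff[OF lim[OF st(1)] lim[OF st(2)]]]]) (use lip[OF st] in auto)
  have acont: "continuous_on {0..T} (\<lambda>t. a t k)" for k
    unfolding continuous_on_iff
  proof (intro ballI allI impI)
    fix t e :: real assume t: "t \<in> {0..T}" and e: "e > 0"
    have p: "\<Lambda> k + 1 > 0" using \<Lambda>0[of k] by linarith
    show "\<exists>d>0. \<forall>s\<in>{0..T}. dist s t < d \<longrightarrow> dist (a s k) (a t k) < e"
    proof (intro exI[of _ "e / (\<Lambda> k + 1)"] conjI ballI impI)
      show "e / (\<Lambda> k + 1) > 0" using e p by simp
      fix s assume s: "s \<in> {0..T}" "dist s t < e / (\<Lambda> k + 1)"
      have "dist (a s k) (a t k) \<le> \<Lambda> k * \<bar>s - t\<bar>" using alip[OF s(1) t] by (simp add: dist_norm)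
      also have "\<dots> \<le> (\<Lambda> k + 1) * \<bar>s - t\<bar>" by (intro mult_right_mono) auto
      also have "\<dots> < (\<Lambda> k + 1) * (e / (\<Lambda> k + 1))"
        using s(2) p by (intro mult_strict_left_mono) (auto simp: dist_real_def)
      also have "\<dots> = e" using p by simp
      finally show "dist (a s k) (a t k) < e" .
    qed
  qed
  have ncont: "continuous_on {0..T} (\<lambda>s. nlin L (a s) k)" for k
    unfolding continuous_on_sequentially
  proof (intro allI ballI impI)
    fix u t assume "t \<in> {0..T}" and u: "(\<forall>n. u n \<in> {0..T}) \<and> u \<longlonglongrightarrow> t"
    then have "(\<lambda>n. a (u n) j) \<longlonglongrightarrow> a t j" for j
      using acont[of j] unfolding continuous_on_sequentially by (auto simp: o_def)
    then have "(\<lambda>n. nlin L (a (u n)) k) \<longlonglongrightarrow> nlin L (a t) k"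
      by (rule nlin_tendsto) (use u awt in auto)
    then show "((\<lambda>s. nlin L (a s) k) \<circ> u) \<longlonglongrightarrow> nlin L (a t) k" by (simp add: o_def)
  qed
  have eq: "a t k - a0 k = integral {0..t} (\<lambda>s. G (a s) k)" if t: "t \<in> {0..T}" for t k
  proof -
    obtain m where m: "\<And>n. n \<ge> m \<Longrightarrow> k \<in> cube (r n)" using ev[of k] by (auto simp: eventually_sequentially)
    have sub: "{0..t} \<subseteq> {0..T}" "0 \<le> t" using t by auto
    have i: "((\<lambda>s. G (x (r (n + m)) s) k) has_integral (x (r (n + m)) t k - x (r (n + m)) 0 k)) {0..t}" for n
      by (rule x_int[OF T0 t]) (use m t in auto)
    have "(\<lambda>n. integral {0..t} (\<lambda>s. G (x (r (n + m)) s) k)) \<longlonglongrightarrow> integral {0..t} (\<lambda>s. G (a s) k)"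
    proof (rule dominated_convergence(2))
      show "(\<lambda>s. G (x (r (n + m)) s) k) integrable_on {0..t}" for n using i by blast
      show "(\<lambda>s. \<Lambda> k) integrable_on {0..t}" by (rule integrable_const_ivl)
      show "norm (G (x (r (n + m)) s) k) \<le> \<Lambda> k" if "s \<in> {0..t}" for n s
        using that sub by (intro Gb wtb) auto
      show "(\<lambda>n. G (x (r (n + m)) s) k) \<longlonglongrightarrow> G (a s) k" if "s \<in> {0..t}" for s
      proof -
        have s: "s \<in> {0..T}" using that sub by auto
        have l: "(\<lambda>n. x (r (n + m)) s j) \<longlonglongrightarrow> a s j" for j
          by (rule LIMSEQ_ignore_initial_segment[OF lim[OF s]])
        show ?thesis unfolding G_def
          by (intro tendsto_diff tendsto_scaleR tendsto_const l nlin_tendsto[OF l wtb[OF s]])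
      qed
    qed
    moreover have "integral {0..t} (\<lambda>s. G (x (r (n + m)) s) k) = x (r (n + m)) t k - a0 k" for n
      using integral_unique[OF i[of n]] x_init[OF m[of "n + m"]] by simp
    moreover have "(\<lambda>n. x (r (n + m)) t k - a0 k) \<longlonglongrightarrow> a t k - a0 k"
      by (intro tendsto_diff tendsto_const LIMSEQ_ignore_initial_segment[OF lim[OF t]])
    ultimately show ?thesis using LIMSEQ_unique by auto
  qed
  \<comment> \<open>Only finite sets of modes are treated here, where the integrand is dominated by
    a constant. The sum over all modes is taken later by monotone convergence.\<close>
  have int2: "integral {0..T} (\<lambda>t. \<Sum>k\<in>F. (norm (wave L k)) ^ 4 * (norm (a t k))\<^sup>2) \<le> B2" if F: "finite F" for F
  proof -
    have xc: "continuous_on {0..T} (\<lambda>t. x N t k)" for N k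
    proof (cases "k \<in> cube N")
      case True
      then show ?thesis by (intro continuous_on_vector_derivative[OF x_der])
    qed (simp add: x_out)
    have "(\<lambda>n. integral {0..T} (\<lambda>t. \<Sum>k\<in>F. (norm (wave L k)) ^ 4 * (norm (x (r n) t k))\<^sup>2)) \<longlonglongrightarrow>
      integral {0..T} (\<lambda>t. \<Sum>k\<in>F. (norm (wave L k)) ^ 4 * (norm (a t k))\<^sup>2)"
    proof (rule dominated_convergence(2))
      show "(\<lambda>t. \<Sum>k\<in>F. (norm (wave L k)) ^ 4 * (norm (x (r n) t k))\<^sup>2) integrable_on {0..T}" for n
        by (intro integrable_continuous_real continuous_intros xc)
      show "(\<lambda>t. \<Sum>k\<in>F. (norm (wave L k)) ^ 4 * (sqrt B)\<^sup>2) integrable_on {0..T}"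
        by (rule integrable_const_ivl)
      show "norm (\<Sum>k\<in>F. (norm (wave L k)) ^ 4 * (norm (x (r n) t k))\<^sup>2) \<le> (\<Sum>k\<in>F. (norm (wave L k)) ^ 4 * (sqrt B)\<^sup>2)" if t: "t \<in> {0..T}" for n t
      proof -
        have "norm (\<Sum>k\<in>F. (norm (wave L k)) ^ 4 * (norm (x (r n) t k))\<^sup>2) = (\<Sum>k\<in>F. (norm (wave L k)) ^ 4 * (norm (x (r n) t k))\<^sup>2)"
          by (simp add: sum_nonneg)
        also have "\<dots> \<le> (\<Sum>k\<in>F. (norm (wave L k)) ^ 4 * (sqrt B)\<^sup>2)"
          by (intro sum_mono mult_left_mono power_mono wt_bounded_norm[OF wtb[OF t]]) auto
        finally show ?thesis .
      qed
      show "(\<lambda>n. \<Sum>k\<in>F. (norm (wave L k)) ^ 4 * (norm (x (r n) t k))\<^sup>2) \<longlonglongrightarrow> (\<Sum>k\<in>F. (norm (wave L k)) ^ 4 * (norm (a t k))\<^sup>2)" if "t \<in> {0..T}" for t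
        by (intro tendsto_intros lim that)
    qed
    then show ?thesis
    proof (rule LIMSEQ_le_const2, intro exI allI impI)
      fix n
      have "integral {0..T} (\<lambda>t. \<Sum>k\<in>F. (norm (wave L k)) ^ 4 * (norm (x (r n) t k))\<^sup>2) \<le>
        integral {0..T} (\<lambda>t. \<Sum>k\<in>cube (r n). (norm (wave L k)) ^ 4 * (norm (x (r n) t k))\<^sup>2)"
      proof (rule integral_le)
        fix t assume "t \<in> {0..T}"
        have "(\<Sum>k\<in>F. (norm (wave L k)) ^ 4 * (norm (x (r n) t k))\<^sup>2) = (\<Sum>k\<in>F \<inter> cube (r n). (norm (wave L k)) ^ 4 * (norm (x (r n) t k))\<^sup>2)"
          using F by (intro sum.mono_neutral_right) (auto simp: x_out)
        also have "\<dots> \<le> (\<Sum>k\<in>cube (r n). (norm (wave L k)) ^ 4 * (norm (x (r n) t k))\<^sup>2)"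
          by (intro sum_mono2) auto
        finally show "(\<Sum>k\<in>F. (norm (wave L k)) ^ 4 * (norm (x (r n) t k))\<^sup>2) \<le> (\<Sum>k\<in>cube (r n). (norm (wave L k)) ^ 4 * (norm (x (r n) t k))\<^sup>2)" .
      qed (intro integrable_continuous_real continuous_intros xc)+
      then show "integral {0..T} (\<lambda>t. \<Sum>k\<in>F. (norm (wave L k)) ^ 4 * (norm (x (r n) t k))\<^sup>2) \<le> B2"
        using bounds(3)[of "r n"] by linarith
    qed
  qed
  have a_prop: "a t 0 = 0" "cdot (wave L k) (a t k) = 0" "a t (- k) = cvec (a t k)" if t: "t \<in> {0..T}" for t k
  proof -
    show "a t 0 = 0" using lim[OF t, of 0] x_prop(1)[OF t] by (simp add: LIMSEQ_const_iff)
    have "(\<lambda>n. cdot (wave L k) (x (r n) t k)) \<longlonglongrightarrow> cdot (wave L k) (a t k)"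
      by (intro bounded_linear.tendsto[OF bounded_linear_cdot] lim t)
    then show "cdot (wave L k) (a t k) = 0" using x_prop(2)[OF t] by (simp add: LIMSEQ_const_iff)
    have "(\<lambda>n. cvec (x (r n) t k)) \<longlonglongrightarrow> cvec (a t k)"
      by (intro bounded_linear.tendsto[OF bounded_linear_cvec] lim t)
    then have "(\<lambda>n. x (r n) t (- k)) \<longlonglongrightarrow> cvec (a t k)" using x_prop(3)[OF t] by simp
    then show "a t (- k) = cvec (a t k)" using lim[OF t, of "- k"] LIMSEQ_unique by blast
  qed
  show ?thesis
    by (rule that[of a B B2, OF init a_prop(1) a_prop(2) a_prop(3) awt acont int2 ncont eq[unfolded G_def]])
qed

end

section \<open>Strong solutions\<close>

text \<open>Lebesgue measure is complete: \<open>measurable_on\<close> ignores negligible sets, so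
  convergence may fail on a null set about which nothing else is known.\<close>

lemma AE_limit_measurable:
  fixes f :: "nat \<Rightarrow> 'a::euclidean_space \<Rightarrow> 'b::euclidean_space"
  assumes S: "S \<in> sets lebesgue" and f: "\<And>n. f n \<in> borel_measurable (lebesgue_on S)"
    and lim: "AE t in lebesgue_on S. (\<lambda>n. f n t) \<longlonglongrightarrow> g t"
  shows "g \<in> borel_measurable (lebesgue_on S)"
proof -
  obtain N where N: "{t \<in> space (lebesgue_on S). \<not> (\<lambda>n. f n t) \<longlonglongrightarrow> g t} \<subseteq> N"
      "emeasure (lebesgue_on S) N = 0" "N \<in> sets (lebesgue_on S)"
    using lim by (rule AE_E)
  have "N \<in> null_sets (lebesgue_on S)" using N by blast
  then have "negligible N"
    unfolding null_sets_restrict_space[OF S] negligible_iff_null_sets by blast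
  moreover have "f n measurable_on S" for n
    using measurable_on_iff_borel_measurable[OF S] f by blast
  moreover have "(\<lambda>n. f n t) \<longlonglongrightarrow> g t" if "t \<in> S - N" for t
    using N(1) that by auto
  ultimately have "g measurable_on S"
    by (intro measurable_on_limit[of f S N g])
  then show ?thesis using measurable_on_iff_borel_measurable[OF S] by blast
qed

lemma AE_lebesgue_on_subset:
  assumes "S \<in> sets lebesgue" "S' \<in> sets lebesgue" "S' \<subseteq> S" "AE t in lebesgue_on S. P t"
  shows "AE t in lebesgue_on S'. P t"
proof -
  have "AE t in lebesgue. t \<in> S \<longrightarrow> P t"
    using assms(1,4) by (subst (asm) AE_restrict_space_iff) auto
  then have "AE t in lebesgue. t \<in> S' \<longrightarrow> P t"
    by (rule eventually_mono) (use assms(3) in blast)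
  then show ?thesis using assms(2) by (subst AE_restrict_space_iff) auto
qed

lemma integrable_lebesgue_on_subset:
  fixes f :: "'a::euclidean_space \<Rightarrow> real"
  assumes S: "S \<in> sets lebesgue" "S' \<in> sets lebesgue" "S' \<subseteq> S" and f: "integrable (lebesgue_on S) f"
  shows "integrable (lebesgue_on S') f"
proof -
  have "integrable lebesgue (\<lambda>x. indicator S x *\<^sub>R f x)"
    using f S(1) by (subst (asm) integrable_restrict_space) auto
  then have "integrable lebesgue (\<lambda>x. indicator S' x *\<^sub>R (indicator S x *\<^sub>R f x))"
    by (rule integrable_mult_indicator[OF S(2)])
  moreover have "(\<lambda>x. indicator S' x *\<^sub>R (indicator S x *\<^sub>R f x)) = (\<lambda>x. indicator S' x *\<^sub>R f x)"
    using S(3) by (auto simp: indicator_def fun_eq_iff)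
  ultimately have "integrable lebesgue (\<lambda>x. indicator S' x *\<^sub>R f x)"
    by (simp only:)
  then show ?thesis using S(2) by (subst integrable_restrict_space) auto
qed

lemma cauchy_schwarz_sum_inner:
  fixes x y :: "'i \<Rightarrow> 'a::real_inner"
  shows "\<bar>\<Sum>k\<in>K. x k \<bullet> y k\<bar> \<le> sqrt (\<Sum>k\<in>K. (norm (x k))\<^sup>2) * sqrt (\<Sum>k\<in>K. (norm (y k))\<^sup>2)"
proof -
  have "\<bar>\<Sum>k\<in>K. x k \<bullet> y k\<bar> \<le> (\<Sum>k\<in>K. \<bar>norm (x k)\<bar> * \<bar>norm (y k)\<bar>)"
    by (rule order_trans[OF sum_abs sum_mono]) (simp add: Cauchy_Schwarz_ineq2)
  also have "\<dots> \<le> L2_set (\<lambda>k. norm (x k)) K * L2_set (\<lambda>k. norm (y k)) K"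
    by (rule L2_set_mult_ineq)
  finally show ?thesis by (simp only: L2_set_def)
qed

text \<open>Crude, but it replaces square roots of an integrable function by an affine expression in
  it, which serves as an integrable majorant.\<close>

lemma sqrt_le_add_one: "x \<ge> 0 \<Longrightarrow> sqrt x \<le> 1 + (x :: real)"
  by (intro real_le_lsqrt) (auto simp: power2_eq_square algebra_simps)

context periodic_box
begin

lemma wt_bounded_summable:
  assumes "wt_bounded L B y" shows "(\<lambda>k. wt L k * (norm (y k))\<^sup>2) summable_on UNIV"
proof (rule nonneg_bdd_above_summable_on)
  show "0 \<le> wt L k * (norm (y k))\<^sup>2" for k using wt_ge_1[of L k] by (intro mult_nonneg_nonneg) auto
  show "bdd_above (sum (\<lambda>k. wt L k * (norm (y k))\<^sup>2) ` {F. F \<subseteq> UNIV \<and> finite F})"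
    by (rule bdd_aboveI[of _ B]) (use assms in \<open>auto simp: wt_bounded_def\<close>)
qed

lemma wt_bounded_summable_0:
  assumes "wt_bounded L B y" shows "(\<lambda>k. (norm (y k))\<^sup>2) summable_on UNIV"
proof (rule nonneg_bdd_above_summable_on)
  show "bdd_above (sum (\<lambda>k. (norm (y k))\<^sup>2) ` {F. F \<subseteq> UNIV \<and> finite F})"
    by (rule bdd_aboveI[of _ B]) (use wt_bounded_sum[OF assms] in auto)
qed auto

lemma initial_coef:
  assumes u0: "u0 \<in> V L 1"
  shows "vcoef L u0 (- k) = cvec (vcoef L u0 k)"
    and "\<forall>F. finite F \<longrightarrow> (\<Sum>k\<in>F. (norm (vcoef L u0 k))\<^sup>2) \<le> (l2_norm L u0)\<^sup>2"
    and "wt_bounded L ((H_norm L 1 u0)\<^sup>2) (vcoef L u0)"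
proof -
  show "vcoef L u0 (- k) = cvec (vcoef L u0 k)"
    by (simp add: vec_eq_iff cvec_def vcoef_minus_index)
  show "\<forall>F. finite F \<longrightarrow> (\<Sum>k\<in>F. (norm (vcoef L u0 k))\<^sup>2) \<le> (l2_norm L u0)\<^sup>2"
    by (intro allI impI finite_sum_le_has_sum[OF vparseval_norm[OF V_D(2)[OF u0]]]) auto
  show "wt_bounded L ((H_norm L 1 u0)\<^sup>2) (vcoef L u0)"
    unfolding wt_bounded_def
  proof (intro allI impI)
    fix F :: "(int^3) set" assume F: "finite F"
    have "(\<Sum>k\<in>F. wt L k * (norm (vcoef L u0 k))\<^sup>2) \<le> (\<Sum>k\<in>F. hw L 1 k * (norm (vcoef L u0 k))\<^sup>2)"
      by (intro sum_mono mult_right_mono wt_le_hw1) auto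
    also have "\<dots> \<le> (H_norm L 1 u0)\<^sup>2"
      using F by (intro finite_sum_le_has_sum[OF H_norm_has_sum[OF V_D(1)[OF u0]]]) (auto simp: hw_nonneg)
    finally show "(\<Sum>k\<in>F. wt L k * (norm (vcoef L u0 k))\<^sup>2) \<le> (H_norm L 1 u0)\<^sup>2" .
  qed
qed

text \<open>Fields with equal coefficients have the same set of weak derivatives, hence the choice
  operator picks the same representative for both. This transfers hypotheses on \<open>u 0\<close>
  to \<open>u0\<close>, which agree only almost everywhere.\<close>

lemma norms_AE_cong:
  assumes u: "square_integrable L u" and v: "square_integrable L v" and ae: "AE x in M. u x = v x"
  shows "l2_norm L u = l2_norm L v" "H_norm L m u = H_norm L m v"
proof -
  have eq: "vcoef L u k = vcoef L v k" for k by (rule vcoef_AE_cong[OF u v ae])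
  have "(l2_norm L u)\<^sup>2 = (l2_norm L v)\<^sup>2"
    using has_sum_unique[OF vparseval_norm[OF u]] vparseval_norm[OF v] by (simp add: eq)
  moreover have "l2_norm L u \<ge> 0" "l2_norm L v \<ge> 0"
    by (auto simp: l2_norm_def intro!: integral_nonneg_AE)
  ultimately show "l2_norm L u = l2_norm L v" by simp
  have "has_weak_D L \<beta> u g \<longleftrightarrow> has_weak_D L \<beta> v g" for \<beta> g
    unfolding has_weak_D_iff[OF u] has_weak_D_iff[OF v] eq ..
  then have "weak_D L \<beta> u = weak_D L \<beta> v" for \<beta> by (simp add: weak_D_def)
  then show "H_norm L m u = H_norm L m v" by (simp add: H_norm_def)
qed

lemma l2_inner_lin:
  assumes "square_integrable L u" "square_integrable L v" "square_integrable L z"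
  shows "l2_inner L (\<lambda>x. a *\<^sub>R u x + b *\<^sub>R v x) z = a * l2_inner L u z + b * l2_inner L v z"
proof -
  have "((\<lambda>k. a * (vcoef L u k \<bullet> vcoef L z k) + b * (vcoef L v k \<bullet> vcoef L z k)) has_sum a * l2_inner L u z + b * l2_inner L v z) UNIV"
    by (intro has_sum_add has_sum_cmult_right vparseval assms)
  then have "((\<lambda>k. vcoef L (\<lambda>x. a *\<^sub>R u x + b *\<^sub>R v x) k \<bullet> vcoef L z k) has_sum a * l2_inner L u z + b * l2_inner L v z) UNIV"
    by (simp add: vcoef_lin assms inner_add_left)
  with vparseval[OF square_integrable_lin[OF assms(1,2)] assms(3)] show ?thesis
    by (rule has_sum_unique)
qed

text \<open>Testing with a solenoidal \<open>v\<close> removes the projection from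
  \<open>nlin\<close>, and solenoidality of \<open>u\<close> exchanges the frequencies
  \<open>k\<close> and \<open>k - j\<close>. This is where the coefficient form meets the operator
  in the definition of a strong solution.\<close>

lemma advection_inner:
  assumes u: "u \<in> V L 1" and s: "(\<lambda>k. norm (vcoef L u k)) summable_on UNIV"
    and w: "wt_bounded L B (vcoef L u)" and v: "v \<in> V L 0"
  shows "vcoef L (advection L u) k \<bullet> vcoef L v k = (1 / sqrt (vol L)) * (nlin L (vcoef L u) k \<bullet> vcoef L v k)"
proof -
  let ?a = "vcoef L u" and ?v = "vcoef L v k"
  define z where "z = (\<lambda>j. (\<i> * cdot (wave L k) (?a j)) *s ?a (k - j))"
  have "((\<lambda>j. ((\<i> * cdot (wave L k) (?a j)) *s pr (wave L k) (?a (k - j))) \<bullet> ?v) has_sum nlin L ?a k \<bullet> ?v) UNIV"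
    by (rule has_sum_bounded_linear[OF bounded_linear_inner_left nlin_has_sum[OF w]])
  moreover have "((\<i> * cdot (wave L k) (?a j)) *s pr (wave L k) (?a (k - j))) \<bullet> ?v = z j \<bullet> ?v" for j
  proof -
    have "c *s pr (wave L k) y = pr (wave L k) (c *s y)" for c y
      by (simp add: pr_def cdot_smult vec_eq_iff right_diff_distrib mult_ac)
    then show ?thesis using pr_inner[OF V_D(4)[OF v]] by (simp add: z_def)
  qed
  ultimately have "((\<lambda>j. z j \<bullet> ?v) has_sum nlin L ?a k \<bullet> ?v) UNIV" by simp
  then have 1: "((\<lambda>j. (1 / sqrt (vol L)) * (z j \<bullet> ?v)) has_sum (1 / sqrt (vol L)) * (nlin L ?a k \<bullet> ?v)) UNIV"
    by (rule has_sum_cmult_right)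
  have "((\<lambda>j. \<Sum>i\<in>UNIV. ((\<i> / of_real (sqrt (vol L)) * cdot (wave L (k - j)) (?a j)) *s ?a (k - j)) $ i \<bullet> ?v $ i)
      has_sum (\<Sum>i\<in>UNIV. vcoef L (advection L u) k $ i \<bullet> ?v $ i)) UNIV"
    by (intro has_sum_finite_sum has_sum_bounded_linear[OF bounded_linear_inner_left] advection_coef(2)[OF V_D(1)[OF u] s]) auto
  moreover have "(\<Sum>i\<in>UNIV. ((\<i> / of_real (sqrt (vol L)) * cdot (wave L (k - j)) (?a j)) *s ?a (k - j)) $ i \<bullet> ?v $ i) =
      (1 / sqrt (vol L)) * (z j \<bullet> ?v)" for j
  proof -
    have "cdot (wave L (k - j)) (?a j) = cdot (wave L k) (?a j)"
      by (simp add: wave_diff cdot_left_diff V_D(4)[OF u])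
    then have "(\<i> / of_real (sqrt (vol L)) * cdot (wave L (k - j)) (?a j)) *s ?a (k - j) = (1 / sqrt (vol L)) *\<^sub>R z j"
      by (simp add: z_def vec_eq_iff scaleR_conv_of_real[where 'a=complex])
    then show ?thesis by (simp only: inner_vec_def[symmetric] inner_scaleR_left)
  qed
  ultimately have 2: "((\<lambda>j. (1 / sqrt (vol L)) * (z j \<bullet> ?v)) has_sum (\<Sum>i\<in>UNIV. vcoef L (advection L u) k $ i \<bullet> ?v $ i)) UNIV"
    by simp
  show ?thesis using has_sum_unique[OF 2 1] by (simp only: inner_vec_def[symmetric])
qed

text \<open>The Agmon inequality with \<open>s = 1\<close>, uniformly over the cubes: a field with
  two square integrable derivatives has an absolutely convergent Fourier series.\<close>

lemma l1_coef_summable: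
  assumes w: "wt_bounded L B y" and y0: "y 0 = 0"
    and Q: "\<And>n. (\<Sum>k\<in>cube n. (norm (wave L k)) ^ 4 * (norm (y k))\<^sup>2) \<le> Q"
  shows "(\<lambda>k. norm (y k)) summable_on UNIV" "(\<Sum>\<^sub>\<infinity>k. norm (y k))\<^sup>2 \<le> agmon * (B + Q)"
proof -
  have b: "(\<Sum>k\<in>cube n. norm (y k)) \<le> sqrt (agmon * (B + Q))" for n
  proof -
    have "(\<Sum>k\<in>cube n. norm (y k))\<^sup>2 \<le> agmon / sqrt 1 *
       ((\<Sum>k\<in>cube n. (norm (wave L k))\<^sup>2 * (norm (y k))\<^sup>2) + 1 * (\<Sum>k\<in>cube n. (norm (wave L k)) ^ 4 * (norm (y k))\<^sup>2))"
      by (rule l1_coef_bound[where x = y and s = 1, OF zero_less_one y0])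
    also have "\<dots> \<le> agmon / sqrt 1 * (B + 1 * Q)"
    proof (intro mult_left_mono add_mono Q)
      have "(\<Sum>k\<in>cube n. (norm (wave L k))\<^sup>2 * (norm (y k))\<^sup>2) \<le> (\<Sum>k\<in>cube n. wt L k * (norm (y k))\<^sup>2)"
        by (intro sum_mono mult_right_mono) (auto simp: wt_def)
      also have "\<dots> \<le> B" using w by (simp add: wt_bounded_def)
      finally show "(\<Sum>k\<in>cube n. (norm (wave L k))\<^sup>2 * (norm (y k))\<^sup>2) \<le> B" .
    qed (use agmon_pos in auto)
    finally show ?thesis by (intro real_le_rsqrt) simp
  qed
  show s: "(\<lambda>k. norm (y k)) summable_on UNIV"
  proof (rule nonneg_bdd_above_summable_on)
    show "bdd_above (sum (\<lambda>k. norm (y k)) ` {F. F \<subseteq> UNIV \<and> finite F})"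
    proof (rule bdd_aboveI[of _ "sqrt (agmon * (B + Q))"], safe)
      fix F :: "(int^3) set" assume "finite F"
      then obtain n where "F \<subseteq> cube n" using finite_subset_cube by blast
      then have "(\<Sum>k\<in>F. norm (y k)) \<le> (\<Sum>k\<in>cube n. norm (y k))" by (intro sum_mono2) auto
      then show "(\<Sum>k\<in>F. norm (y k)) \<le> sqrt (agmon * (B + Q))" using b[of n] by linarith
    qed
  qed auto
  have "(\<Sum>\<^sub>\<infinity>k. norm (y k)) \<le> sqrt (agmon * (B + Q))"
    by (rule LIMSEQ_le_const2[OF has_sum_cube[OF has_sum_infsum[OF s]]]) (use b in auto)
  moreover have "(\<Sum>\<^sub>\<infinity>k. norm (y k)) \<ge> 0" by (intro infsum_nonneg) auto
  moreover have "0 \<le> agmon * (B + Q)"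
    using agmon_pos wt_bounded_nonneg[OF w] order_trans[OF sum_nonneg Q] by simp
  ultimately show "(\<Sum>\<^sub>\<infinity>k. norm (y k))\<^sup>2 \<le> agmon * (B + Q)"
    using power_mono[of "\<Sum>\<^sub>\<infinity>k. norm (y k)" "sqrt (agmon * (B + Q))" 2] by simp
qed

lemma wt_sq_summable:
  assumes w: "wt_bounded L B y" and s: "(\<lambda>k. (norm (wave L k)) ^ 4 * (norm (y k))\<^sup>2) summable_on UNIV"
  shows "(\<lambda>k. wt L k ^ 2 * (norm (y k))\<^sup>2) summable_on UNIV"
    "finite F \<Longrightarrow> (\<Sum>k\<in>F. wt L k ^ 2 * (norm (y k))\<^sup>2) \<le> 2 * B + 2 * (\<Sum>\<^sub>\<infinity>k. (norm (wave L k)) ^ 4 * (norm (y k))\<^sup>2)"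
proof -
  let ?Q = "\<Sum>\<^sub>\<infinity>k. (norm (wave L k)) ^ 4 * (norm (y k))\<^sup>2"
  have b: "(\<Sum>k\<in>F. wt L k ^ 2 * (norm (y k))\<^sup>2) \<le> 2 * B + 2 * ?Q" if F: "finite F" for F
  proof -
    have "(\<Sum>k\<in>F. wt L k ^ 2 * (norm (y k))\<^sup>2) \<le> (\<Sum>k\<in>F. 2 * (norm (y k))\<^sup>2 + 2 * ((norm (wave L k)) ^ 4 * (norm (y k))\<^sup>2))"
    proof (rule sum_mono)
      fix k
      have "wt L k ^ 2 \<le> 2 + 2 * (norm (wave L k)) ^ 4"
        using sum_squares_bound[of 1 "(norm (wave L k))\<^sup>2"]
        by (simp add: wt_def power2_eq_square power4_eq_xxxx algebra_simps)
      then have "wt L k ^ 2 * (norm (y k))\<^sup>2 \<le> (2 + 2 * (norm (wave L k)) ^ 4) * (norm (y k))\<^sup>2"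
        by (rule mult_right_mono) auto
      then show "wt L k ^ 2 * (norm (y k))\<^sup>2 \<le> 2 * (norm (y k))\<^sup>2 + 2 * ((norm (wave L k)) ^ 4 * (norm (y k))\<^sup>2)"
        by (simp add: algebra_simps)
    qed
    also have "\<dots> = 2 * (\<Sum>k\<in>F. (norm (y k))\<^sup>2) + 2 * (\<Sum>k\<in>F. (norm (wave L k)) ^ 4 * (norm (y k))\<^sup>2)"
      by (simp only: sum.distrib sum_distrib_left)
    also have "\<dots> \<le> 2 * B + 2 * ?Q"
      using F by (intro add_mono mult_left_mono wt_bounded_sum[OF w] finite_sum_le_infsum s) auto
    finally show ?thesis .
  qed
  then show "(\<Sum>k\<in>F. wt L k ^ 2 * (norm (y k))\<^sup>2) \<le> 2 * B + 2 * ?Q" if "finite F" using that .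
  show "(\<lambda>k. wt L k ^ 2 * (norm (y k))\<^sup>2) summable_on UNIV"
    by (rule nonneg_bdd_above_summable_on) (auto intro!: bdd_aboveI[of _ "2 * B + 2 * ?Q"] b)
qed

lemma H_norm_sq_le:
  fixes C :: real
  assumes u: "u \<in> H_per L m" and b: "\<And>F. finite F \<Longrightarrow> (\<Sum>k\<in>F. wt L k ^ m * (norm (vcoef L u k))\<^sup>2) \<le> C"
  shows "(H_norm L m u)\<^sup>2 \<le> real (card {\<beta>. mi_order \<beta> \<le> m}) * C"
proof (rule LIMSEQ_le_const2[OF has_sum_cube[OF H_norm_has_sum[OF u]]], intro exI allI impI)
  fix n
  have "(\<Sum>k\<in>cube n. hw L m k * (norm (vcoef L u k))\<^sup>2) \<le> (\<Sum>k\<in>cube n. (card {\<beta>. mi_order \<beta> \<le> m} * wt L k ^ m) * (norm (vcoef L u k))\<^sup>2)"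
    by (intro sum_mono mult_right_mono hw_le) auto
  also have "\<dots> = card {\<beta>. mi_order \<beta> \<le> m} * (\<Sum>k\<in>cube n. wt L k ^ m * (norm (vcoef L u k))\<^sup>2)"
    by (simp only: sum_distrib_left mult.assoc)
  also have "\<dots> \<le> real (card {\<beta>. mi_order \<beta> \<le> m}) * C"
    by (intro mult_left_mono b) auto
  finally show "(\<Sum>k\<in>cube n. hw L m k * (norm (vcoef L u k))\<^sup>2) \<le> real (card {\<beta>. mi_order \<beta> \<le> m}) * C" .
qed

text \<open>The coefficients are resummed to a field at each time. It lies in \<open>V L 1\<close>
  at every time, but in \<open>V L 2\<close> only at almost every time, namely where the second
  order sum is finite. The operators are identified there, and the time integrals ignore the
  exceptional set.\<close>

theorem strong_solution_exists:
  fixes \<nu> T :: real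
  assumes \<nu>: "\<nu> > 0" and T: "T > 0" and u0: "u0 \<in> V L 1"
    and small: "growth \<nu> (1 / sqrt (vol L)) / (2 * \<nu>) * (l2_norm L u0)\<^sup>2 + arctan ((H_norm L 1 u0)\<^sup>2) < pi / 2"
  shows "\<exists>w. strong_solution L \<nu> u0 w T"
proof -
  define b where "b = 1 / sqrt (vol L)"
  have b: "b > 0" using vol_pos by (simp add: b_def)
  obtain a B B2 where a_init: "\<And>k. a 0 k = vcoef L u0 k"
    and a_zero: "\<And>t. t \<in> {0..T} \<Longrightarrow> a t 0 = 0" and a_div: "\<And>t k. t \<in> {0..T} \<Longrightarrow> cdot (wave L k) (a t k) = 0"
    and a_re: "\<And>t k. t \<in> {0..T} \<Longrightarrow> a t (- k) = cvec (a t k)"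
    and a_wt: "\<And>t. t \<in> {0..T} \<Longrightarrow> wt_bounded L B (a t)"
    and a_cont: "\<And>k. continuous_on {0..T} (\<lambda>t. a t k)"
    and a_int: "\<And>F. finite F \<Longrightarrow> integral {0..T} (\<lambda>t. \<Sum>k\<in>F. (norm (wave L k)) ^ 4 * (norm (a t k))\<^sup>2) \<le> B2"
    and n_cont: "\<And>k. continuous_on {0..T} (\<lambda>s. nlin L (a s) k)"
    and a_eq: "\<And>t k. t \<in> {0..T} \<Longrightarrow> a t k - vcoef L u0 k = integral {0..t} (\<lambda>s. - (\<nu> * (norm (wave L k))\<^sup>2) *\<^sub>R a s k - b *\<^sub>R nlin L (a s) k)"
    by (rule fourier_solution[OF \<nu> b T V_D(3)[OF u0] V_D(4)[OF u0] initial_coef(1)[OF u0] initial_coef(2)[OF u0] initial_coef(3)[OF u0] small[folded b_def]]) (rule that)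
  have "\<forall>t\<in>{0..T}. \<exists>u. square_integrable L u \<and> (\<forall>k. vcoef L u k = a t k)"
  proof
    fix t assume t: "t \<in> {0..T}"
    have "a t (- k) $ i = cnj (a t k $ i)" for k i using a_re[OF t, of k] by (simp add: cvec_def)
    then show "\<exists>u. square_integrable L u \<and> (\<forall>k. vcoef L u k = a t k)"
      using vector_synthesis[OF wt_bounded_summable_0[OF a_wt[OF t]]] by blast
  qed
  then obtain w where w': "\<forall>t\<in>{0..T}. square_integrable L (w t) \<and> (\<forall>k. vcoef L (w t) k = a t k)"
    by (rule bchoice[THEN exE])
  have w: "square_integrable L (w t)" "vcoef L (w t) = a t" if "t \<in> {0..T}" for t
    using w' that by auto
  \<comment> \<open>The function spaces refer to the open interval and the equation to the closed
    one; the work is done on the closed interval and restricted afterwards.\<close>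
  define N0 where "N0 = lebesgue_on {0..T}"
  have leb: "{0..T} \<in> sets lebesgue" "{0<..<T} \<in> sets lebesgue" "{0<..<T} \<subseteq> {0..T}" by auto
  have meas: "f \<in> borel_measurable N0" if "continuous_on {0..T} f" for f :: "real \<Rightarrow> real"
    unfolding N0_def using that by (intro continuous_imp_measurable_on_sets_lebesgue) auto
  have to_open: "f \<in> borel_measurable (lebesgue_on {0<..<T})" if "f \<in> borel_measurable N0" for f :: "real \<Rightarrow> real"
    using measurable_restrict_mono[OF that[unfolded N0_def] leb(3)] .
  have AE_open: "AE t in lebesgue_on {0<..<T}. P t" if "AE t in N0. P t" for P
    by (rule AE_lebesgue_on_subset[OF leb that[unfolded N0_def]])
  have AE_T: "AE t in N0. t \<in> {0..T}" unfolding N0_def by (rule AE_I2) simp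
  have V1: "w t \<in> V L 1" and V0: "w t \<in> V L 0" if t: "t \<in> {0..T}" for t
    by (rule V_I[OF w(1)[OF t]], use w(2)[OF t] wt_bounded_summable[OF a_wt[OF t]] wt_bounded_summable_0[OF a_wt[OF t]] a_zero[OF t] a_div[OF t] in auto)+

  define q where "q = (\<lambda>n t. \<Sum>k\<in>cube n. (norm (wave L k)) ^ 4 * (norm (a t k))\<^sup>2)"
  define Q where "Q = (\<lambda>t. \<Sum>\<^sub>\<infinity>k. (norm (wave L k)) ^ 4 * (norm (a t k))\<^sup>2)"
  have qc: "continuous_on {0..T} (q n)" for n unfolding q_def by (intro continuous_intros a_cont)
  have q0: "q n t \<ge> 0" for n t by (auto simp: q_def intro!: sum_nonneg)
  have qmono: "q m t \<le> q n t" if "m \<le> n" for m n t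
    unfolding q_def using cube_mono[OF that] by (intro sum_mono2) auto
  have qi: "integrable N0 (q n)" for n
    unfolding N0_def by (rule continuous_imp_integrable_real[OF qc])
  have qB: "(LINT t|N0. q n t) \<le> B2" for n
    using lebesgue_integral_eq_integral[OF qi[of n, unfolded N0_def] leb(1)] a_int[of "cube n"]
    by (simp add: N0_def q_def)
  \<comment> \<open>Monotone convergence turns the bounds for finite sets of modes into one for the
    full sum, which is therefore finite at almost every time.\<close>
  have "(\<integral>\<^sup>+t. (SUP n. ennreal (q n t)) \<partial>N0) = (SUP n. \<integral>\<^sup>+t. ennreal (q n t) \<partial>N0)"
    by (rule nn_integral_monotone_convergence_SUP)
       (auto simp: incseq_def le_fun_def intro!: ennreal_leI qmono measurable_compose[OF meas[OF qc] measurable_ennreal])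
  also have "\<dots> \<le> ennreal B2"
  proof (rule SUP_least)
    fix n
    have "(\<integral>\<^sup>+t. ennreal (q n t) \<partial>N0) = ennreal (LINT t|N0. q n t)"
      by (rule nn_integral_eq_integral[OF qi]) (simp add: q0)
    then show "(\<integral>\<^sup>+t. ennreal (q n t) \<partial>N0) \<le> ennreal B2" using qB[of n] by (simp add: ennreal_leI)
  qed
  finally have SUPfin: "(\<integral>\<^sup>+t. (SUP n. ennreal (q n t)) \<partial>N0) \<le> ennreal B2" .
  have "AE t in N0. (SUP n. ennreal (q n t)) \<noteq> \<infinity>"
  proof (rule nn_integral_PInf_AE)
    show "(\<lambda>t. SUP n. ennreal (q n t)) \<in> borel_measurable N0"
      by (intro borel_measurable_SUP) (auto intro!: measurable_compose[OF meas[OF qc] measurable_ennreal])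
    show "(\<integral>\<^sup>+t. (SUP n. ennreal (q n t)) \<partial>N0) \<noteq> \<infinity>"
      using SUPfin by (auto simp: top_unique)
  qed
  then have good: "AE t in N0. (\<lambda>k. (norm (wave L k)) ^ 4 * (norm (a t k))\<^sup>2) summable_on UNIV"
  proof eventually_elim
    case (elim t)
    then obtain r where r: "r \<ge> 0" "(SUP n. ennreal (q n t)) = ennreal r"
      by (cases "SUP n. ennreal (q n t)") auto
    have "q n t \<le> r" for n
    proof -
      have "ennreal (q n t) \<le> ennreal r" unfolding r(2)[symmetric] by (rule SUP_upper) simp
      then show ?thesis using r(1) by simp
    qed
    note qr = this
    show ?case
    proof (rule nonneg_bdd_above_summable_on)
      show "bdd_above (sum (\<lambda>k. (norm (wave L k)) ^ 4 * (norm (a t k))\<^sup>2) ` {F. F \<subseteq> UNIV \<and> finite F})"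
      proof (rule bdd_aboveI[of _ r], safe)
        fix F :: "(int^3) set" assume "finite F"
        then obtain n where "F \<subseteq> cube n" using finite_subset_cube by blast
        then have "(\<Sum>k\<in>F. (norm (wave L k)) ^ 4 * (norm (a t k))\<^sup>2) \<le> q n t"
          unfolding q_def by (intro sum_mono2) auto
        then show "(\<Sum>k\<in>F. (norm (wave L k)) ^ 4 * (norm (a t k))\<^sup>2) \<le> r" using qr[of n] by linarith
      qed
    qed auto
  qed
  have qQ: "q n t \<le> Q t" and qlim: "(\<lambda>n. q n t) \<longlonglongrightarrow> Q t"
    if "(\<lambda>k. (norm (wave L k)) ^ 4 * (norm (a t k))\<^sup>2) summable_on UNIV" for n t
    unfolding q_def Q_def using that
    by (auto intro!: finite_sum_le_infsum has_sum_cube has_sum_infsum)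
  have Q0: "Q t \<ge> 0" for t unfolding Q_def by (intro infsum_nonneg) auto
  have Qlim: "AE t in N0. (\<lambda>n. q n t) \<longlonglongrightarrow> Q t"
    using good by eventually_elim (rule qlim)
  have Qm: "Q \<in> borel_measurable N0"
    unfolding N0_def by (rule AE_limit_measurable[OF leb(1) meas[OF qc, unfolded N0_def] Qlim[unfolded N0_def]])
  have Qi: "integrable N0 Q"
  proof (rule integrableI_bounded[OF Qm])
    have "(\<integral>\<^sup>+t. ennreal (norm (Q t)) \<partial>N0) \<le> (\<integral>\<^sup>+t. (SUP n. ennreal (q n t)) \<partial>N0)"
    proof (rule nn_integral_mono_AE)
      show "AE t in N0. ennreal (norm (Q t)) \<le> (SUP n. ennreal (q n t))"
        using Qlim
      proof eventually_elim
        case (elim t)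
        have "(\<lambda>n. ennreal (q n t)) \<longlonglongrightarrow> ennreal (Q t)" using elim by (rule tendsto_ennrealI)
        then have "ennreal (Q t) \<le> (SUP n. ennreal (q n t))"
          by (rule LIMSEQ_le_const2) (intro exI allI impI SUP_upper UNIV_I)
        then show ?case using Q0[of t] by simp
      qed
    qed
    also have "\<dots> \<le> ennreal B2" by (rule SUPfin)
    finally show "(\<integral>\<^sup>+t. ennreal (norm (Q t)) \<partial>N0) < \<infinity>" by (simp add: le_less_trans)
  qed
  have V2: "w t \<in> V L 2" if t: "t \<in> {0..T}" and g: "(\<lambda>k. (norm (wave L k)) ^ 4 * (norm (a t k))\<^sup>2) summable_on UNIV" for t
    by (rule V_I[OF w(1)[OF t]], use w(2)[OF t] wt_sq_summable(1)[OF a_wt[OF t] g] a_zero[OF t] a_div[OF t] in auto)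
  have AEV: "AE t in N0. w t \<in> V L m" if m: "m \<in> {1, 2}" for m
    using good AE_T
  proof eventually_elim
    case (elim t)
    show ?case using m V1[OF elim(2)] V2[OF elim(2) elim(1)] by auto
  qed
  have tm: "time_measurable L m T w" if m: "m \<in> {1, 2}" for m
    unfolding time_measurable_def
  proof
    fix v assume v: "v \<in> V L m"
    \<comment> \<open>Partial sums of the series for the inner product: they are continuous in time,
      so the inner product is an almost everywhere limit of measurable functions.\<close>
    let ?f = "\<lambda>n t. \<Sum>k\<in>cube n. \<Sum>\<beta> | mi_order \<beta> \<le> m. (dsym L \<beta> k *s a t k) \<bullet> (dsym L \<beta> k *s vcoef L v k)"
    have "continuous_on {0..T} (?f n)" for n
    proof (intro continuous_on_sum continuous_on_inner continuous_on_const)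
      fix \<beta> k
      have "continuous_on {0..T} (\<lambda>t. \<chi> i. dsym L \<beta> k * a t k $ i)"
        by (intro continuous_intros a_cont)
      then show "continuous_on {0..T} (\<lambda>t. dsym L \<beta> k *s a t k)"
        by (simp only: vector_scalar_mult_def)
    qed
    then have "?f n \<in> borel_measurable (lebesgue_on {0..T})" for n using meas unfolding N0_def by blast
    moreover have "AE t in lebesgue_on {0..T}. (\<lambda>n. ?f n t) \<longlonglongrightarrow> H_inner L m (w t) v"
      using AEV[OF m] AE_T unfolding N0_def
    proof eventually_elim
      case (elim t)
      show ?case
        using has_sum_cube[OF H_inner_has_sum[OF V_D(1)[OF elim(1)] V_D(1)[OF v]]] by (simp add: w(2)[OF elim(2)])
    qed
    ultimately have "(\<lambda>t. H_inner L m (w t) v) \<in> borel_measurable (lebesgue_on {0..T})"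
      by (rule AE_limit_measurable[OF leb(1)])
    then show "(\<lambda>t. H_inner L m (w t) v) \<in> borel_measurable (lebesgue_on {0<..<T})"
      using to_open unfolding N0_def by blast
  qed
  have Linf: "w \<in> Linf_V L 1 T"
    unfolding Linf_V_def
  proof (intro CollectI conjI tm exI)
    show "AE t in lebesgue_on {0<..<T}. w t \<in> V L 1" by (rule AE_open[OF AEV]) simp
    show "AE t in lebesgue_on {0<..<T}. H_norm L 1 (w t) \<le> sqrt (real (card {\<beta>. mi_order \<beta> \<le> 1}) * B)"
    proof (rule AE_open, use AE_T in eventually_elim)
      case (elim t)
      have "(H_norm L 1 (w t))\<^sup>2 \<le> real (card {\<beta>. mi_order \<beta> \<le> 1}) * B"
        by (rule H_norm_sq_le[OF V_D(1)[OF V1[OF elim]]]) (use a_wt[OF elim] in \<open>simp add: w(2)[OF elim] wt_bounded_def\<close>)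
      then show ?case by (rule real_le_rsqrt)
    qed
  qed simp
  have L2: "w \<in> L2_V L 2 T"
    unfolding L2_V_def
  proof (intro CollectI conjI tm)
    show "AE t in lebesgue_on {0<..<T}. w t \<in> V L 2" by (rule AE_open[OF AEV]) simp
    let ?c = "real (card {\<beta>. mi_order \<beta> \<le> 2})"
    have "integrable N0 (\<lambda>t. (H_norm L 2 (w t))\<^sup>2)"
    proof (rule Bochner_Integration.integrable_bound)
      have "integrable N0 (\<lambda>t. 2 * B)" unfolding N0_def by (intro continuous_imp_integrable_real) auto
      then show "integrable N0 (\<lambda>t. ?c * (2 * B + 2 * Q t))" using Qi by auto
      let ?f = "\<lambda>n t. \<Sum>k\<in>cube n. hw L 2 k * (norm (a t k))\<^sup>2"
      have "continuous_on {0..T} (?f n)" for n by (intro continuous_intros a_cont)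
      then have "?f n \<in> borel_measurable (lebesgue_on {0..T})" for n using meas unfolding N0_def by blast
      moreover have "AE t in lebesgue_on {0..T}. (\<lambda>n. ?f n t) \<longlonglongrightarrow> (H_norm L 2 (w t))\<^sup>2"
        using AEV[of 2, simplified] AE_T unfolding N0_def
      proof eventually_elim
        case (elim t)
        show ?case using has_sum_cube[OF H_norm_has_sum[OF V_D(1)[OF elim(1)]]] by (simp add: w(2)[OF elim(2)])
      qed
      ultimately show "(\<lambda>t. (H_norm L 2 (w t))\<^sup>2) \<in> borel_measurable N0"
        unfolding N0_def by (rule AE_limit_measurable[OF leb(1)])
      show "AE t in N0. norm ((H_norm L 2 (w t))\<^sup>2) \<le> norm (?c * (2 * B + 2 * Q t))"
        using AE_T good
      proof eventually_elim
        case (elim t)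
        have "(H_norm L 2 (w t))\<^sup>2 \<le> ?c * (2 * B + 2 * Q t)"
          by (rule H_norm_sq_le[OF V_D(1)[OF V2[OF elim]]])
             (use wt_sq_summable(2)[OF a_wt[OF elim(1)] elim(2)] in \<open>simp add: w(2)[OF elim(1)] Q_def\<close>)
        then show ?case by simp
      qed
    qed
    then show "integrable (lebesgue_on {0<..<T}) (\<lambda>t. (H_norm L 2 (w t))\<^sup>2)"
      unfolding N0_def by (rule integrable_lebesgue_on_subset[OF leb])
  qed simp
  have init: "AE x in M. w 0 x = u0 x"
    using T by (intro vcoef_unique w V_D(2)[OF u0]) (auto simp: w(2) a_init)
  have eq: "let F = (\<lambda>s. l2_inner L (\<lambda>x. \<nu> *\<^sub>R stokes L (w s) x + leray L (advection L (w s)) x) v)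
        in integrable (lebesgue_on {0..T}) F \<and>
           (\<forall>t\<in>{0..T}. l2_inner L (w t) v - l2_inner L (w 0) v + (LINT s|lebesgue_on {0..t}. F s) = 0)"
    if v: "v \<in> V L 0" for v
  proof -
    define F where "F = (\<lambda>s. l2_inner L (\<lambda>x. \<nu> *\<^sub>R stokes L (w s) x + leray L (advection L (w s)) x) v)"
    define G where "G = (\<lambda>s k. - (\<nu> * (norm (wave L k))\<^sup>2) *\<^sub>R a s k - b *\<^sub>R nlin L (a s) k)"
    define f where "f = (\<lambda>n s. \<Sum>k\<in>cube n. - (G s k \<bullet> vcoef L v k))"
    define Kv where "Kv = l2_norm L v"
    have Kv0: "Kv \<ge> 0" unfolding Kv_def l2_norm_def by (auto intro!: integral_nonneg_AE)
    \<comment> \<open>A majorant affine in \<open>Q\<close>. The first part bounds the viscous term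
      by \<open>sqrt Q \<le> 1 + Q\<close>, the second the advection term by its L2 estimate, with
      the squared l1 norm of the coefficients bounded by \<open>agmon * (B + Q)\<close>.\<close>
    define D where "D = (\<lambda>s. Kv * (\<nu> * (1 + Q s) + (1 + 3 / vol L * (agmon * (B + Q s)) * B)))"
    have Gc: "continuous_on {0..T} (\<lambda>s. G s k)" for k
      unfolding G_def by (intro continuous_intros a_cont n_cont)
    have fc: "continuous_on {0..T} (f n)" for n
      unfolding f_def by (intro continuous_intros Gc)
    have vF: "sqrt (\<Sum>k\<in>K. (norm (vcoef L v k))\<^sup>2) \<le> Kv" if "finite K" for K
    proof -
      have "(\<Sum>k\<in>K. (norm (vcoef L v k))\<^sup>2) \<le> Kv\<^sup>2"
        unfolding Kv_def using that by (intro finite_sum_le_has_sum[OF vparseval_norm[OF V_D(2)[OF v]]]) auto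
      then show ?thesis using Kv0 by (intro real_le_lsqrt) (auto intro: sum_nonneg)
    qed
    have key: "AE s in N0. (\<lambda>n. f n s) \<longlonglongrightarrow> F s \<and> (\<forall>n. \<bar>f n s\<bar> \<le> D s)"
      using AE_T good
    proof eventually_elim
      case (elim s)
      note s = elim(1) and g = elim(2)
      have wV2: "w s \<in> V L 2" and wV1: "w s \<in> V L 1" using V1 V2 s g by auto
      note l1 = l1_coef_summable[OF a_wt[OF s] a_zero[OF s], OF qQ[OF g, unfolded q_def]]
      have sn: "(\<lambda>k. norm (vcoef L (w s) k)) summable_on UNIV" using l1(1) by (simp add: w(2)[OF s])
      note adv = advection_coef[OF V_D(1)[OF wV1] sn]
      note lap = laplacian_coef[OF V_D(1)[OF wV2]]
      have advi: "vcoef L (advection L (w s)) k \<bullet> vcoef L v k = b * (nlin L (a s) k \<bullet> vcoef L v k)" for k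
        using advection_inner[OF wV1 sn _ v, of B k] a_wt[OF s] by (simp add: w(2)[OF s] b_def)
      have "F s = l2_inner L (\<lambda>x. (- \<nu>) *\<^sub>R leray L (laplacian L (w s)) x + 1 *\<^sub>R leray L (advection L (w s)) x) v"
        by (simp add: F_def stokes_def)
      also have "\<dots> = - \<nu> * l2_inner L (leray L (laplacian L (w s))) v + 1 * l2_inner L (leray L (advection L (w s))) v"
        by (intro l2_inner_lin V_D(2)[OF leray(1)] V_D(2)[OF v] adv(1) lap(1))
      \<comment> \<open>Against \<open>v\<close> in \<open>V L 0\<close> both projections disappear,
        so the fields themselves can be expanded by Parseval.\<close>
      also have "\<dots> = - \<nu> * l2_inner L (laplacian L (w s)) v + l2_inner L (advection L (w s)) v"
        by (simp add: leray(2)[OF lap(1) v] leray(2)[OF adv(1) v])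
      finally have Fs: "F s = - \<nu> * l2_inner L (laplacian L (w s)) v + l2_inner L (advection L (w s)) v" .
      have "((\<lambda>k. - \<nu> * (vcoef L (laplacian L (w s)) k \<bullet> vcoef L v k) + vcoef L (advection L (w s)) k \<bullet> vcoef L v k) has_sum F s) UNIV"
        unfolding Fs by (intro has_sum_add has_sum_cmult_right vparseval lap(1) adv(1) V_D(2)[OF v])
      moreover have "- \<nu> * (vcoef L (laplacian L (w s)) k \<bullet> vcoef L v k) + vcoef L (advection L (w s)) k \<bullet> vcoef L v k = - (G s k \<bullet> vcoef L v k)" for k
        by (simp add: lap(2) advi w(2)[OF s] G_def inner_diff_left)
      ultimately have hs: "((\<lambda>k. - (G s k \<bullet> vcoef L v k)) has_sum F s) UNIV" by simp
      have bound: "\<bar>f n s\<bar> \<le> D s" for n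
      proof -
        have split: "f n s = \<nu> * (\<Sum>k\<in>cube n. ((norm (wave L k))\<^sup>2 *\<^sub>R a s k) \<bullet> vcoef L v k) + (\<Sum>k\<in>cube n. vcoef L (advection L (w s)) k \<bullet> vcoef L v k)"
          unfolding f_def sum_distrib_left sum.distrib[symmetric]
          by (intro sum.cong refl) (simp add: G_def inner_diff_left advi)
        have 1: "\<bar>\<Sum>k\<in>cube n. ((norm (wave L k))\<^sup>2 *\<^sub>R a s k) \<bullet> vcoef L v k\<bar> \<le> (1 + Q s) * Kv"
        proof -
          have "(\<Sum>k\<in>cube n. (norm ((norm (wave L k))\<^sup>2 *\<^sub>R a s k))\<^sup>2) = q n s"
            unfolding q_def by (intro sum.cong refl) (simp add: power_mult_distrib flip: power_mult)
          then have "\<bar>\<Sum>k\<in>cube n. ((norm (wave L k))\<^sup>2 *\<^sub>R a s k) \<bullet> vcoef L v k\<bar> \<le> sqrt (q n s) * sqrt (\<Sum>k\<in>cube n. (norm (vcoef L v k))\<^sup>2)"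
            using cauchy_schwarz_sum_inner[of "\<lambda>k. (norm (wave L k))\<^sup>2 *\<^sub>R a s k" "vcoef L v" "cube n"] by simp
          also have "\<dots> \<le> (1 + Q s) * Kv"
          proof (rule mult_mono)
            have "sqrt (q n s) \<le> sqrt (Q s)" by (intro real_sqrt_le_mono qQ[OF g])
            also have "\<dots> \<le> 1 + Q s" by (rule sqrt_le_add_one[OF Q0])
            finally show "sqrt (q n s) \<le> 1 + Q s" .
            show "sqrt (\<Sum>k\<in>cube n. (norm (vcoef L v k))\<^sup>2) \<le> Kv" by (rule vF) simp
          qed (use Q0[of s] in \<open>auto intro: sum_nonneg\<close>)
          finally show ?thesis .
        qed
        have 2: "\<bar>\<Sum>k\<in>cube n. vcoef L (advection L (w s)) k \<bullet> vcoef L v k\<bar> \<le> (1 + 3 / vol L * (agmon * (B + Q s)) * B) * Kv"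
        proof -
          let ?A = "3 / vol L * (agmon * (B + Q s)) * B"
          have B0: "B \<ge> 0" by (rule wt_bounded_nonneg[OF a_wt[OF s]])
          have A0: "?A \<ge> 0" using vol_pos agmon_pos B0 Q0[of s] by (intro mult_nonneg_nonneg divide_nonneg_nonneg add_nonneg_nonneg) auto
          have "(\<Sum>k\<in>cube n. (norm (vcoef L (advection L (w s)) k))\<^sup>2) \<le> (l2_norm L (advection L (w s)))\<^sup>2"
            by (intro finite_sum_le_has_sum[OF vparseval_norm[OF adv(1)]]) auto
          also have "\<dots> \<le> 3 / vol L * (\<Sum>\<^sub>\<infinity>k. norm (a s k))\<^sup>2 * (\<Sum>\<^sub>\<infinity>k. (norm (wave L k))\<^sup>2 * (norm (a s k))\<^sup>2)"
            using adv(3) by (simp add: w(2)[OF s])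
          also have "\<dots> \<le> ?A"
          proof (intro mult_mono l1(2)[folded Q_def] mult_left_mono)
            show "(\<Sum>\<^sub>\<infinity>k. (norm (wave L k))\<^sup>2 * (norm (a s k))\<^sup>2) \<le> B"
            proof (rule infsum_le_finite_sums)
              show "(\<lambda>k. (norm (wave L k))\<^sup>2 * (norm (a s k))\<^sup>2) summable_on UNIV"
                by (rule summable_on_comparison_test[OF wt_bounded_summable[OF a_wt[OF s]]])
                   (auto intro!: mult_right_mono simp: wt_def)
              fix F :: "(int^3) set" assume "finite F"
              moreover have "(\<Sum>k\<in>F. (norm (wave L k))\<^sup>2 * (norm (a s k))\<^sup>2) \<le> (\<Sum>k\<in>F. wt L k * (norm (a s k))\<^sup>2)"
                by (intro sum_mono mult_right_mono) (auto simp: wt_def)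
              ultimately show "(\<Sum>k\<in>F. (norm (wave L k))\<^sup>2 * (norm (a s k))\<^sup>2) \<le> B"
                using a_wt[OF s] by (force simp: wt_bounded_def)
            qed
          qed (use vol_pos agmon_pos B0 Q0[of s] in \<open>auto intro!: infsum_nonneg\<close>)
          finally have "sqrt (\<Sum>k\<in>cube n. (norm (vcoef L (advection L (w s)) k))\<^sup>2) \<le> sqrt ?A"
            by (rule real_sqrt_le_mono)
          also have "\<dots> \<le> 1 + ?A" by (rule sqrt_le_add_one[OF A0])
          finally have "sqrt (\<Sum>k\<in>cube n. (norm (vcoef L (advection L (w s)) k))\<^sup>2) * sqrt (\<Sum>k\<in>cube n. (norm (vcoef L v k))\<^sup>2) \<le> (1 + ?A) * Kv"
            using A0 by (intro mult_mono vF) (auto intro: sum_nonneg)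
          then show ?thesis
            by (rule order_trans[OF cauchy_schwarz_sum_inner])
        qed
        have "\<bar>f n s\<bar> \<le> \<nu> * \<bar>\<Sum>k\<in>cube n. ((norm (wave L k))\<^sup>2 *\<^sub>R a s k) \<bullet> vcoef L v k\<bar> + \<bar>\<Sum>k\<in>cube n. vcoef L (advection L (w s)) k \<bullet> vcoef L v k\<bar>"
          unfolding split using \<nu> by (intro order_trans[OF abs_triangle_ineq]) (simp add: abs_mult)
        also have "\<dots> \<le> \<nu> * ((1 + Q s) * Kv) + (1 + 3 / vol L * (agmon * (B + Q s)) * B) * Kv"
          using \<nu> by (intro add_mono mult_left_mono 1 2) auto
        also have "\<dots> = D s" by (simp only: D_def) (simp only: distrib_left mult_ac)
        finally show ?thesis .
      qed
      show ?case using has_sum_cube[OF hs] bound by (simp add: f_def)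
    qed
    have Di: "integrable N0 D"
    proof -
      have c: "integrable N0 (\<lambda>t. c)" for c :: real unfolding N0_def by (intro continuous_imp_integrable_real) auto
      have "D = (\<lambda>s. (Kv * (\<nu> + 1 + 3 / vol L * agmon * B * B)) + (Kv * (\<nu> + 3 / vol L * agmon * B)) * Q s)"
        by (simp add: D_def fun_eq_iff algebra_simps)
      then show ?thesis using c Qi by simp
    qed
    have fm: "f n \<in> borel_measurable N0" for n by (rule meas[OF fc])
    have klim: "AE s in N0. (\<lambda>n. f n s) \<longlonglongrightarrow> F s" using key by eventually_elim blast
    have kbd: "AE s in N0. norm (f n s) \<le> D s" for n using key by eventually_elim simp
    have Fm: "F \<in> borel_measurable N0"
      unfolding N0_def by (rule AE_limit_measurable[OF leb(1) fm[unfolded N0_def] klim[unfolded N0_def]])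
    have Fi: "integrable N0 F"
      by (rule integrable_dominated_convergence[OF Fm fm Di klim kbd])
    have "l2_inner L (w t) v - l2_inner L (w 0) v + (LINT s|lebesgue_on {0..t}. F s) = 0" if t: "t \<in> {0..T}" for t
    proof -
      have sub: "{0..t} \<in> sets lebesgue" "{0..t} \<subseteq> {0..T}" using t by auto
      have "(\<lambda>n. LINT s|lebesgue_on {0..t}. f n s) \<longlonglongrightarrow> (LINT s|lebesgue_on {0..t}. F s)"
      proof (rule integral_dominated_convergence)
        show "F \<in> borel_measurable (lebesgue_on {0..t})" "f n \<in> borel_measurable (lebesgue_on {0..t})" for n
          using measurable_restrict_mono[OF _ sub(2)] Fm fm unfolding N0_def by blast+
        show "integrable (lebesgue_on {0..t}) D"
          by (rule integrable_lebesgue_on_subset[OF leb(1) sub Di[unfolded N0_def]])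
        show "AE s in lebesgue_on {0..t}. (\<lambda>n. f n s) \<longlonglongrightarrow> F s"
          by (rule AE_lebesgue_on_subset[OF leb(1) sub klim[unfolded N0_def]])
        show "AE s in lebesgue_on {0..t}. norm (f n s) \<le> D s" for n
          by (rule AE_lebesgue_on_subset[OF leb(1) sub kbd[unfolded N0_def]])
      qed
      \<comment> \<open>For finitely many modes the claim is the sum of the integral equations of
        the coefficients, paired with those of \<open>v\<close>.\<close>
      moreover have "(LINT s|lebesgue_on {0..t}. f n s) = - (\<Sum>k\<in>cube n. (a t k - a 0 k) \<bullet> vcoef L v k)" for n
      proof -
        have fc': "continuous_on {0..t} (f n)" and Gc': "continuous_on {0..t} (\<lambda>s. G s k)" for k
          using continuous_on_subset[OF _ sub(2)] fc Gc by blast+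
        have Gi: "(\<lambda>s. G s k) integrable_on {0..t}" for k by (rule integrable_continuous_real[OF Gc'])
        have "(LINT s|lebesgue_on {0..t}. f n s) = integral {0..t} (f n)"
          by (intro lebesgue_integral_eq_integral continuous_imp_integrable_real fc' sub(1))
        also have "\<dots> = (\<Sum>k\<in>cube n. integral {0..t} (\<lambda>s. - (G s k \<bullet> vcoef L v k)))"
          unfolding f_def by (intro Henstock_Kurzweil_Integration.integral_sum integrable_continuous_real continuous_intros Gc') auto
        also have "\<dots> = (\<Sum>k\<in>cube n. - ((a t k - a 0 k) \<bullet> vcoef L v k))"
        proof (intro sum.cong refl)
          fix k
          have "((\<lambda>s. G s k \<bullet> vcoef L v k) has_integral (integral {0..t} (\<lambda>s. G s k) \<bullet> vcoef L v k)) {0..t}"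
            using has_integral_linear[OF integrable_integral[OF Gi] bounded_linear_inner_left] by (simp add: o_def)
          moreover have "integral {0..t} (\<lambda>s. G s k) = a t k - a 0 k"
            using a_eq[OF t, of k] by (simp add: G_def a_init)
          ultimately show "integral {0..t} (\<lambda>s. - (G s k \<bullet> vcoef L v k)) = - ((a t k - a 0 k) \<bullet> vcoef L v k)"
            by (simp add: integral_unique)
        qed
        finally show ?thesis by (simp add: sum_negf)
      qed
      moreover have "(\<lambda>n. - (\<Sum>k\<in>cube n. (a t k - a 0 k) \<bullet> vcoef L v k)) \<longlonglongrightarrow> - (l2_inner L (w t) v - l2_inner L (w 0) v)"
      proof -
        have T0: "0 \<in> {0..T}" using T by simp
        have "(\<lambda>n. \<Sum>k\<in>cube n. a s k \<bullet> vcoef L v k) \<longlonglongrightarrow> l2_inner L (w s) v" if s: "s \<in> {0..T}" for s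
          using has_sum_cube[OF vparseval[OF w(1)[OF s] V_D(2)[OF v]]] by (simp add: w(2)[OF s])
        from tendsto_minus[OF tendsto_diff[OF this[OF t] this[OF T0]]] show ?thesis
          by (simp add: inner_diff_left sum_subtractf)
      qed
      ultimately have "(LINT s|lebesgue_on {0..t}. F s) = - (l2_inner L (w t) v - l2_inner L (w 0) v)"
        using LIMSEQ_unique by auto
      then show ?thesis by simp
    qed
    then show ?thesis using Fi unfolding F_def[symmetric] Let_def N0_def by blast
  qed
  have "strong_solution L \<nu> u0 w T"
    unfolding strong_solution_def using Linf L2 V0 init eq by blast
  then show ?thesis by blast
qed

end

theorem corollary3p4:
  fixes L :: "real^3" and \<nu> :: real
  assumes "\<forall>i. L $ i > 0" and "\<nu> > 0"
  shows "\<exists>c\<^sub>1\<^sub>1>0. \<forall>u0 u.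
    u0 \<in> V L 1 \<longrightarrow>
    maximal_strong_solution L \<nu> u0 u \<longrightarrow>
    c\<^sub>1\<^sub>1 * (l2_norm L (u 0))\<^sup>2 + arctan ((H_norm L 1 (u 0))\<^sup>2) < pi / 2 \<longrightarrow>
    (\<forall>T>0. strong_solution L \<nu> u0 u T)"
proof -
  interpret periodic_box L using assms(1) by unfold_locales auto
  \<comment> \<open>Depends on \<nu> and, through \<open>agmon\<close> and the volume, on the box;
    neither the datum nor the time \<open>T\<close> enters.\<close>
  define c where "c = growth \<nu> (1 / sqrt (vol L)) / (2 * \<nu>)"
  have c: "c > 0" using growth_pos[OF assms(2)] vol_pos assms(2) by (simp add: c_def)
  have "strong_solution L \<nu> u0 u T"
    if u0: "u0 \<in> V L 1" and max: "maximal_strong_solution L \<nu> u0 u"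
      and small: "c * (l2_norm L (u 0))\<^sup>2 + arctan ((H_norm L 1 (u 0))\<^sup>2) < pi / 2" and T: "T > 0" for u0 u T
  proof -
    \<comment> \<open>One interval of existence is enough to know that \<open>u 0\<close> and
      \<open>u0\<close> agree almost everywhere, so that the smallness condition on
      \<open>u 0\<close> becomes one on the datum.\<close>
    obtain T1 where "T1 > 0" "strong_solution L \<nu> u0 u T1"
      using max by (auto simp: maximal_strong_solution_def)
    then have "u 0 \<in> V L 0" and ae: "AE x in M. u 0 x = u0 x"
      unfolding strong_solution_def by auto
    then have "l2_norm L (u 0) = l2_norm L u0" "H_norm L 1 (u 0) = H_norm L 1 u0"
      using norms_AE_cong[OF V_D(2) V_D(2)[OF u0] ae] by auto
    then have "\<exists>w. strong_solution L \<nu> u0 w T"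
      using small strong_solution_exists[OF assms(2) T u0] by (simp add: c_def)
    then show ?thesis using max T unfolding maximal_strong_solution_def by blast
  qed
  then show ?thesis using c by blast
qed

end
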